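(* For any $j_0\in\mathbb Z$, the group-based Gabor shearlet system $$\{\Phi_{j_0,k,m}:k\in\mathbb Z,\ m\in\mathbb Z^2\}\cup\{\Psi^\ell_{j,k,m}: j,k\in\mathbb Z,\ j\ge j_0,\ m\in\mathbb Z^2,\ \ell=1,\dots,15\}$$ is a unit-norm $b^{-1}$-tight frame for $L^2(\mathbb R^2)$, and so is the system $\{\Psi^\ell_{j,k,m}:j,k\in\mathbb Z,\ m\in\mathbb Z^2,\ \ell=1,\dots,15\}$. Consequently each of these systems has uniform redundancy $\mathcal R^-=\mathcal R^+=b^{-1}$.
   Context: Fourier transform: $\widehat f(\xi)=\int f(x)e^{-2\pi i x\cdot\xi}dx$, extended to $L^2$. A family $\{\varphi_i\}$ in a Hilbert space $\mathcal H$ is an $a$-tight frame for $\mathcal H$ if $\sum_i|\langle f,\varphi_i\rangle|^2=a\|f\|^2$ for all $f\in\mathcal H$; it is unit-norm if every $\|\varphi_i\|=1$. For a frame $\{\varphi_i\}_{i\in I}$ without zero vectors, the redundancy function on the unit sphere is $\mathcal R(x)=\sum_{i\in I}\|\varphi_i\|^{-2}|\langle x,\varphi_i\rangle|^2$, and $\mathcal R^+=\sup_{\|x\|=1}\mathcal R(x)$, $\mathcal R^-=\inf_{\|x\|=1}\mathcal R(x)$; the redundancy is uniform if $\mathcal R^-=\mathcal R^+$. Let $\phi$ be an orthogonal scaling function of a $16$-band multiresolution analysis (dilation factor $16$) in $L^2(\mathbb R)$, with associated orthonormal wavelets $\psi_1,\dots,\psi_{15}$. Let $b>0$ and let $w\in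 L^2(\mathbb R)$ be a unit-norm window such that the functions $x\mapsto e^{2\pi i m b x}w(x-k)$, $m,k\in\mathbb Z$, form a $b^{-1}$-tight frame for $L^2(\mathbb R)$. For $\xi=(\xi_1,\xi_2)$ with $\xi_1\neq0$ put $\gamma_1(\xi)=\frac12\mathrm{sgn}(\xi_1)\xi_1^2$ and $\gamma_2(\xi)=\xi_2/\xi_1$. For $j,k\in\mathbb Z$, $m=(m_1,m_2)\in\mathbb Z^2$, $1\le\ell\le15$, the functions $\Phi_{j,k,m},\Psi^\ell_{j,k,m}\in L^2(\mathbb R^2)$ are defined by $$\widehat{\Phi_{j,k,m}}(\xi)=2^{-3j/2}\,\widehat\phi(2^{-4j}\gamma_1(\xi))\,w(2^j\gamma_2(\xi)-k)\,e^{2\pi i m_1 2^{-4j}\gamma_1(\xi)}e^{2\pi i m_2 b 2^j\gamma_2(\xi)},$$ $$\widehat{\Psi^\ell_{j,k,m}}(\xi)=2^{-3j/2}\,\widehat\psi_\ell(2^{-4j}\gamma_1(\xi))\,w(2^j\gamma_2(\xi)-k)\,e^{2\pi i m_1 2^{-4j}\gamma_1(\xi)}e^{2\pi i m_2 b 2^j\gamma_2(\xi)}.$$ *)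

theory Defs
  imports "HOL-Analysis.Analysis"
begin

section \<open>Square-integrable functions and the Fourier transform\<close>

text \<open>
  Elements of \<open>L\<^sup>2(\<real>\<^sup>d)\<close> are represented by Borel functions, not by classes modulo
  null sets; equality almost everywhere is expressed by the vanishing of \<open>l2_norm\<close> of the
  difference. The plane is \<open>real \<times> real\<close>.
\<close>

definition L2 :: "('a::euclidean_space \<Rightarrow> complex) set" where
  "L2 = {f \<in> borel_measurable lborel. integrable lborel (\<lambda>x. (cmod (f x))\<^sup>2)}"

definition l2_inner :: "('a::euclidean_space \<Rightarrow> complex) \<Rightarrow> ('a \<Rightarrow> complex) \<Rightarrow> complex" where
  "l2_inner f g = (LINT x|lborel. f x * cnj (g x))"

definition l2_norm :: "('a::euclidean_space \<Rightarrow> complex) \<Rightarrow> real" where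
  "l2_norm f = sqrt (LINT x|lborel. (cmod (f x))\<^sup>2)"

definition l2_tendsto ::
    "(nat \<Rightarrow> 'a::euclidean_space \<Rightarrow> complex) \<Rightarrow> ('a \<Rightarrow> complex) \<Rightarrow> bool" where
  "l2_tendsto u f \<longleftrightarrow> (\<lambda>n. l2_norm (\<lambda>x. u n x - f x)) \<longlonglongrightarrow> 0"

definition fourier_integral ::
    "('a::euclidean_space \<Rightarrow> complex) \<Rightarrow> 'a \<Rightarrow> complex" where
  "fourier_integral f \<xi> = (LINT x|lborel. f x * cis (- 2 * pi * (x \<bullet> \<xi>)))"

text \<open>
  Extension of the Fourier integral from \<open>L\<^sup>1 \<inter> L\<^sup>2\<close> to \<open>L\<^sup>2\<close> by continuity. The requirement
  that the transforms of the approximants lie in \<open>L\<^sup>2\<close> always holds, by Plancherel; it is listed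
  because \<open>l2_norm\<close> is meaningful only on \<open>L\<^sup>2\<close>.
\<close>

definition has_L2_fourier ::
    "('a::euclidean_space \<Rightarrow> complex) \<Rightarrow> ('a \<Rightarrow> complex) \<Rightarrow> bool" where
  "has_L2_fourier f F \<longleftrightarrow> f \<in> L2 \<and> F \<in> L2 \<and>
     (\<exists>u. (\<forall>n. u n \<in> L2 \<and> integrable lborel (u n) \<and> fourier_integral (u n) \<in> L2) \<and>
          l2_tendsto u f \<and> l2_tendsto (\<lambda>n. fourier_integral (u n)) F)"

text \<open>Both choices below are unique up to equality almost everywhere.\<close>

definition L2_fourier :: "('a::euclidean_space \<Rightarrow> complex) \<Rightarrow> ('a \<Rightarrow> complex)" where
  "L2_fourier f = (SOME F. has_L2_fourier f F)"

definition inv_L2_fourier :: "('a::euclidean_space \<Rightarrow> complex) \<Rightarrow> ('a \<Rightarrow> complex)" where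
  "inv_L2_fourier F = (SOME f. has_L2_fourier f F)"

section \<open>Tight frames and redundancy\<close>

definition tight_frame ::
    "real \<Rightarrow> 'i set \<Rightarrow> ('i \<Rightarrow> 'a::euclidean_space \<Rightarrow> complex) \<Rightarrow> bool" where
  "tight_frame a I \<phi> \<longleftrightarrow> (\<forall>i\<in>I. \<phi> i \<in> L2) \<and>
     (\<forall>f\<in>L2. ((\<lambda>i. (cmod (l2_inner f (\<phi> i)))\<^sup>2) has_sum a * (l2_norm f)\<^sup>2) I)"

definition unit_norm_family ::
    "'i set \<Rightarrow> ('i \<Rightarrow> 'a::euclidean_space \<Rightarrow> complex) \<Rightarrow> bool" where
  "unit_norm_family I \<phi> \<longleftrightarrow> (\<forall>i\<in>I. l2_norm (\<phi> i) = 1)"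

text \<open>Valued in \<open>ennreal\<close>, so that the sum, the supremum and the infimum are unconditionally
  the mathematical ones.\<close>

definition redundancy ::
    "'i set \<Rightarrow> ('i \<Rightarrow> 'a::euclidean_space \<Rightarrow> complex) \<Rightarrow> ('a \<Rightarrow> complex) \<Rightarrow> ennreal" where
  "redundancy I \<phi> x =
     (\<Sum>\<^sub>\<infinity>i\<in>I. ennreal (inverse ((l2_norm (\<phi> i))\<^sup>2) * (cmod (l2_inner x (\<phi> i)))\<^sup>2))"

definition upper_redundancy ::
    "'i set \<Rightarrow> ('i \<Rightarrow> 'a::euclidean_space \<Rightarrow> complex) \<Rightarrow> ennreal" where
  "upper_redundancy I \<phi> = (SUP x\<in>{x \<in> L2. l2_norm x = 1}. redundancy I \<phi> x)"

definition lower_redundancy ::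
    "'i set \<Rightarrow> ('i \<Rightarrow> 'a::euclidean_space \<Rightarrow> complex) \<Rightarrow> ennreal" where
  "lower_redundancy I \<phi> = (INF x\<in>{x \<in> L2. l2_norm x = 1}. redundancy I \<phi> x)"

definition uniform_redundancy ::
    "'i set \<Rightarrow> ('i \<Rightarrow> 'a::euclidean_space \<Rightarrow> complex) \<Rightarrow> bool" where
  "uniform_redundancy I \<phi> \<longleftrightarrow> lower_redundancy I \<phi> = upper_redundancy I \<phi>"

section \<open>Multiresolution analyses\<close>

text \<open>Closedness under \<open>L\<^sup>2\<close> limits includes closedness under equality almost everywhere
  (constant sequences).\<close>

definition closed_l2_subspace :: "('a::euclidean_space \<Rightarrow> complex) set \<Rightarrow> bool" where
  "closed_l2_subspace V \<longleftrightarrow> V \<subseteq> L2 \<and> (\<lambda>x. 0) \<in> V \<and>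
     (\<forall>f\<in>V. \<forall>g\<in>V. (\<lambda>x. f x + g x) \<in> V) \<and>
     (\<forall>f\<in>V. \<forall>c. (\<lambda>x. c * f x) \<in> V) \<and>
     (\<forall>u f. (\<forall>n. u n \<in> V) \<and> f \<in> L2 \<and> l2_tendsto u f \<longrightarrow> f \<in> V)"

definition orthonormal_basis_of ::
    "('a::euclidean_space \<Rightarrow> complex) set \<Rightarrow> 'i set \<Rightarrow> ('i \<Rightarrow> 'a \<Rightarrow> complex) \<Rightarrow> bool" where
  "orthonormal_basis_of V I e \<longleftrightarrow> (\<forall>i\<in>I. e i \<in> V) \<and>
     (\<forall>i\<in>I. \<forall>i'\<in>I. l2_inner (e i) (e i') = (if i = i' then 1 else 0)) \<and>
     (\<forall>f\<in>V. \<forall>\<epsilon>>0. \<exists>F c. finite F \<and> F \<subseteq> I \<and> l2_norm (\<lambda>x. f x - (\<Sum>i\<in>F. c i * e i x)) < \<epsilon>)"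

definition orthogonal_mra ::
    "nat \<Rightarrow> (int \<Rightarrow> (real \<Rightarrow> complex) set) \<Rightarrow> (real \<Rightarrow> complex) \<Rightarrow> bool" where
  "orthogonal_mra M V \<phi> \<longleftrightarrow>
     (\<forall>j. closed_l2_subspace (V j)) \<and>
     (\<forall>j. V j \<subseteq> V (j + 1)) \<and>
     (\<forall>j. \<forall>f\<in>L2. f \<in> V j \<longleftrightarrow> (\<lambda>x. f (real M * x)) \<in> V (j + 1)) \<and>
     (\<forall>f\<in>(\<Inter>j. V j). l2_norm f = 0) \<and>
     (\<forall>f\<in>L2. \<forall>\<epsilon>>0. \<exists>g\<in>(\<Union>j. V j). l2_norm (\<lambda>x. f x - g x) < \<epsilon>) \<and>
     orthonormal_basis_of (V 0) UNIV (\<lambda>(k::int) x. \<phi> (x - of_int k))"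

text \<open>The integer translates of the \<open>M - 1\<close> wavelets form an orthonormal basis of the
  orthogonal complement of \<open>V 0\<close> in \<open>V 1\<close>.\<close>

definition mra_wavelets ::
    "nat \<Rightarrow> (int \<Rightarrow> (real \<Rightarrow> complex) set) \<Rightarrow> (nat \<Rightarrow> real \<Rightarrow> complex) \<Rightarrow> bool" where
  "mra_wavelets M V \<psi> \<longleftrightarrow>
     orthonormal_basis_of {f \<in> V 1. \<forall>g\<in>V 0. l2_inner f g = 0} ({1..M - 1} \<times> UNIV)
       (\<lambda>(l, k::int) x. \<psi> l (x - of_int k))"

section \<open>Gabor systems and group-based Gabor shearlets\<close>

definition gabor_atom :: "real \<Rightarrow> (real \<Rightarrow> complex) \<Rightarrow> int \<times> int \<Rightarrow> real \<Rightarrow> complex" where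
  "gabor_atom b w = (\<lambda>(m, k) x. cis (2 * pi * of_int m * b * x) * w (x - of_int k))"

definition \<gamma>\<^sub>1 :: "real \<times> real \<Rightarrow> real" where
  "\<gamma>\<^sub>1 \<xi> = 1/2 * sgn (fst \<xi>) * (fst \<xi>)\<^sup>2"

text \<open>The value on the null set \<open>fst \<xi> = 0\<close> is irrelevant.\<close>

definition \<gamma>\<^sub>2 :: "real \<times> real \<Rightarrow> real" where
  "\<gamma>\<^sub>2 \<xi> = snd \<xi> / fst \<xi>"

text \<open>The atom with generator \<open>g\<close>: it is \<open>\<Phi>\<close> for \<open>g = \<phi>\<close> and \<open>\<Psi>\<close> for \<open>g = \<psi> l\<close>.\<close>

definition shearlet_atom ::
    "(real \<Rightarrow> complex) \<Rightarrow> (real \<Rightarrow> complex) \<Rightarrow> real \<Rightarrow> int \<Rightarrow> int \<Rightarrow> int \<times> int \<Rightarrow> real \<times> real \<Rightarrow> complex"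
  where
  "shearlet_atom g w b j k m = inv_L2_fourier (\<lambda>\<xi>.
     complex_of_real (2 powr (- 3 * of_int j / 2)) *
     L2_fourier g (2 powi (- 4 * j) * \<gamma>\<^sub>1 \<xi>) *
     w (2 powi j * \<gamma>\<^sub>2 \<xi> - of_int k) *
     cis (2 * pi * of_int (fst m) * 2 powi (- 4 * j) * \<gamma>\<^sub>1 \<xi>) *
     cis (2 * pi * of_int (snd m) * b * 2 powi j * \<gamma>\<^sub>2 \<xi>))"

type_synonym coarse_index = "int \<times> (int \<times> int)"
type_synonym fine_index = "int \<times> int \<times> (int \<times> int) \<times> nat"

definition fine_atom ::
    "(nat \<Rightarrow> real \<Rightarrow> complex) \<Rightarrow> (real \<Rightarrow> complex) \<Rightarrow> real \<Rightarrow> fine_index \<Rightarrow> real \<times> real \<Rightarrow> complex"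
  where
  "fine_atom \<psi> w b = (\<lambda>(j, k, m, l). shearlet_atom (\<psi> l) w b j k m)"

definition inhomogeneous_atom ::
    "(real \<Rightarrow> complex) \<Rightarrow> (nat \<Rightarrow> real \<Rightarrow> complex) \<Rightarrow> (real \<Rightarrow> complex) \<Rightarrow> real \<Rightarrow> int \<Rightarrow>
     coarse_index + fine_index \<Rightarrow> real \<times> real \<Rightarrow> complex" where
  "inhomogeneous_atom \<phi> \<psi> w b j\<^sub>0 =
     case_sum (\<lambda>(k, m). shearlet_atom \<phi> w b j\<^sub>0 k m) (fine_atom \<psi> w b)"

definition inhomogeneous_indices :: "int \<Rightarrow> (coarse_index + fine_index) set" where
  "inhomogeneous_indices j\<^sub>0 = UNIV <+> ({j\<^sub>0..} \<times> UNIV \<times> UNIV \<times> {1..15})"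

definition homogeneous_indices :: "fine_index set" where
  "homogeneous_indices = UNIV \<times> UNIV \<times> UNIV \<times> {1..15}"

end

theory Submission
  imports Defs "HOL-Probability.Characteristic_Functions"
begin

text \<open>
  The map \<open>\<xi> \<mapsto> (\<gamma>\<^sub>1 \<xi>, \<gamma>\<^sub>2 \<xi>)\<close> preserves Lebesgue measure and is invertible off a null set, and in
  these coordinates the Fourier transform of an atom is a tensor product \<open>u \<otimes> v\<close>: \<open>u\<close> is the
  transform of a dilated translate of \<open>\<phi>\<close> or \<open>\<psi> l\<close>, and \<open>v\<close> is a dilated Gabor atom. By Plancherel
  the factors \<open>u\<close> form an orthonormal basis, while for each fixed \<open>u\<close> the factors \<open>v\<close> form a
  \<open>b\<^sup>-\<^sup>1\<close>-tight frame. Summing first over \<open>v\<close>, then over \<open>u\<close> with Tonelli, gives the claim, whatever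
  the dependence of the Gabor frame on the scale of \<open>u\<close>.
\<close>

section \<open>Square-integrable functions\<close>

text \<open>Two computations make the product structure exact. Since 2^(-4j) = 16^(-j), the first
  factor lives on the scale of the 16-band analysis, and 2^(-3j/2) = sqrt(16^(-j)) sqrt(2^j) is the
  product of the normalisations of the two dilations. The phase in the first component of
  \<open>m\<close> has a plus sign, which belongs to g(16^j x + m) and not to g(16^j x - m); as
  \<open>m\<close> runs through all integers, a reflection of the index reconciles the two. The
  Fourier transform is available only as a choice made up to null sets, so everything runs on the
  relation \<open>has_L2_fourier\<close>, which is shown to be isometric, total and onto. Plancherel
  is first proved for bounded integrable functions by Gaussian averaging; truncating values, then
  supports, extends it. Tight frames are carried along unitary maps. Isometry alone would not do:
  the frame identity is tested on every function, so each transport step exhibits a preimage.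
  Orthonormal bases act through Parseval's identity, as \<open>tight_frame 1\<close>, which comes
  from telescoping the squared norms of the projections onto the spaces \<open>V j\<close>.\<close>

lemma borel_measurable_cis [measurable (raw)]:
  "f \<in> borel_measurable M \<Longrightarrow> (\<lambda>x. cis (f x)) \<in> borel_measurable M"
  by (rule borel_measurable_continuous_on) (intro continuous_intros)

lemma borel_measurable_cnj [measurable (raw)]:
  "f \<in> borel_measurable M \<Longrightarrow> (\<lambda>x. cnj (f x)) \<in> borel_measurable M"
  by (rule borel_measurable_continuous_on) (intro continuous_intros)

lemma L2_measurable: "f \<in> L2 \<Longrightarrow> f \<in> borel_measurable borel"
  by (simp add: L2_def)

lemma L2_integrable: "f \<in> L2 \<Longrightarrow> integrable lborel (\<lambda>x. (cmod (f x))\<^sup>2)"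
  by (simp add: L2_def)

lemma L2I:
  "f \<in> borel_measurable borel \<Longrightarrow> integrable lborel (\<lambda>x. (cmod (f x))\<^sup>2) \<Longrightarrow> f \<in> L2"
  by (simp add: L2_def)

lemma L2_bound:
  assumes "g \<in> borel_measurable borel" "integrable lborel h" "\<And>x. (cmod (g x))\<^sup>2 \<le> h x"
  shows "g \<in> L2"
proof (rule L2I[OF assms(1)])
  show "integrable lborel (\<lambda>x. (cmod (g x))\<^sup>2)"
    by (rule Bochner_Integration.integrable_bound[OF assms(2)])
       (use assms in \<open>auto intro!: AE_I2 intro: order_trans[OF _ abs_ge_self]\<close>)
qed

lemma L2_dominated:
  assumes "f \<in> L2" "g \<in> borel_measurable borel" "\<And>x. cmod (g x) \<le> cmod (f x)"
  shows "g \<in> L2"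
  by (rule L2_bound[OF assms(2) L2_integrable[OF assms(1)]]) (simp add: assms(3) power_mono)

lemma L2_zero [simp]: "(\<lambda>x. 0) \<in> L2"
  by (simp add: L2_def)

lemma L2_add:
  assumes "f \<in> L2" "g \<in> L2"
  shows "(\<lambda>x. f x + g x) \<in> L2"
proof (rule L2_bound)
  show "(\<lambda>x. f x + g x) \<in> borel_measurable borel"
    using assms by (intro borel_measurable_add L2_measurable)
  show "integrable lborel (\<lambda>x. 2 * (cmod (f x))\<^sup>2 + 2 * (cmod (g x))\<^sup>2)"
    using assms by (intro Bochner_Integration.integrable_add integrable_mult_right L2_integrable)
  fix x
  have "(cmod (f x + g x))\<^sup>2 \<le> (cmod (f x) + cmod (g x))\<^sup>2"
    by (intro power_mono norm_triangle_ineq) simp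
  also have "\<dots> \<le> 2 * (cmod (f x))\<^sup>2 + 2 * (cmod (g x))\<^sup>2"
    using sum_squares_bound[of "cmod (f x)" "cmod (g x)"] by (simp add: power2_sum)
  finally show "(cmod (f x + g x))\<^sup>2 \<le> 2 * (cmod (f x))\<^sup>2 + 2 * (cmod (g x))\<^sup>2" .
qed

lemma L2_scale:
  assumes "f \<in> L2"
  shows "(\<lambda>x. c * f x) \<in> L2"
  using assms by (auto simp: L2_def norm_mult power_mult_distrib)

lemma L2_diff:
  assumes "f \<in> L2" "g \<in> L2"
  shows "(\<lambda>x. f x - g x) \<in> L2"
  using L2_add[OF assms(1) L2_scale[OF assms(2), of "-1"]] by simp

lemma L2_sum:
  assumes "\<And>i. i \<in> I \<Longrightarrow> f i \<in> L2"
  shows "(\<lambda>x. \<Sum>i\<in>I. f i x) \<in> L2"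
  using assms by (induction I rule: infinite_finite_induct) (auto intro!: L2_add)

lemma L2_cnj: "f \<in> L2 \<Longrightarrow> (\<lambda>x. cnj (f x)) \<in> L2"
  by (auto simp: L2_def)

lemma L2_mult_integrable:
  assumes "f \<in> L2" "g \<in> L2"
  shows "integrable lborel (\<lambda>x. f x * g x)"
proof (rule Bochner_Integration.integrable_bound)
  show "integrable lborel (\<lambda>x. (cmod (f x))\<^sup>2 + (cmod (g x))\<^sup>2)"
    using assms by (intro Bochner_Integration.integrable_add L2_integrable)
  show "(\<lambda>x. f x * g x) \<in> borel_measurable lborel"
    using L2_measurable[OF assms(1)] L2_measurable[OF assms(2)] by simp
  show "AE x in lborel. norm (f x * g x) \<le> norm ((cmod (f x))\<^sup>2 + (cmod (g x))\<^sup>2)"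
  proof (rule AE_I2)
    fix x
    have "2 * (cmod (f x) * cmod (g x)) \<le> (cmod (f x))\<^sup>2 + (cmod (g x))\<^sup>2"
      using sum_squares_bound[of "cmod (f x)" "cmod (g x)"] by (simp add: ac_simps)
    moreover have "0 \<le> cmod (f x) * cmod (g x)" by simp
    ultimately have "cmod (f x) * cmod (g x) \<le> (cmod (f x))\<^sup>2 + (cmod (g x))\<^sup>2"
      by linarith
    then show "norm (f x * g x) \<le> norm ((cmod (f x))\<^sup>2 + (cmod (g x))\<^sup>2)"
      by (simp add: norm_mult)
  qed
qed

section \<open>Inner product, Cauchy-Schwarz and triangle inequality\<close>

lemma L2_inner_integrable:
  "f \<in> L2 \<Longrightarrow> g \<in> L2 \<Longrightarrow> integrable lborel (\<lambda>x. f x * cnj (g x))"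
  by (rule L2_mult_integrable[OF _ L2_cnj])

lemma l2_norm_nonneg [simp]: "0 \<le> l2_norm f"
  by (simp add: l2_norm_def)

lemma l2_norm_power2: "(l2_norm f)\<^sup>2 = (LINT x|lborel. (cmod (f x))\<^sup>2)"
  by (simp add: l2_norm_def)

lemma l2_inner_self: "l2_inner f f = of_real ((l2_norm f)\<^sup>2)"
  unfolding l2_inner_def l2_norm_power2 complex_norm_square[symmetric] of_real_power[symmetric]
  by (rule integral_complex_of_real)

lemma nn_integral_l2_norm:
  assumes "f \<in> L2"
  shows "(\<integral>\<^sup>+x. ennreal ((cmod (f x))\<^sup>2) \<partial>lborel) = ennreal ((l2_norm f)\<^sup>2)"
  unfolding l2_norm_power2
  by (rule nn_integral_eq_integral) (use L2_integrable[OF assms] in auto)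

text \<open>The Fatou arguments end here: the nonnegative integral is meaningful before
  integrability is known, whereas \<open>l2_norm\<close> of a function outside \<open>L2\<close> is
  the default value 0.\<close>

lemma L2_I_nn:
  assumes "f \<in> borel_measurable borel"
    and "(\<integral>\<^sup>+x. ennreal ((cmod (f x))\<^sup>2) \<partial>lborel) \<le> ennreal (C\<^sup>2)" and "0 \<le> C"
  shows "f \<in> L2" "l2_norm f \<le> C"
proof -
  show L: "f \<in> L2"
    using assms by (intro L2I integrableI_nonneg) (auto simp: le_less_trans ennreal_less_top)
  have "(l2_norm f)\<^sup>2 \<le> C\<^sup>2"
    using assms(2) nn_integral_l2_norm[OF L] by simp
  then show "l2_norm f \<le> C"
    using assms(3) by (rule power2_le_imp_le)
qed

lemma l2_norm_cong_AE:
  assumes "f \<in> borel_measurable borel" "g \<in> borel_measurable borel" "AE x in lborel. f x = g x"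
  shows "l2_norm f = l2_norm g"
  unfolding l2_norm_def
  by (intro arg_cong[where f=sqrt] integral_cong_AE) (use assms in auto)

lemma l2_inner_add_left:
  "f \<in> L2 \<Longrightarrow> g \<in> L2 \<Longrightarrow> h \<in> L2 \<Longrightarrow> l2_inner (\<lambda>x. f x + g x) h = l2_inner f h + l2_inner g h"
  unfolding l2_inner_def
  by (subst Bochner_Integration.integral_add[symmetric]) (auto intro: L2_inner_integrable simp: algebra_simps)

lemma l2_inner_diff_left:
  "f \<in> L2 \<Longrightarrow> g \<in> L2 \<Longrightarrow> h \<in> L2 \<Longrightarrow> l2_inner (\<lambda>x. f x - g x) h = l2_inner f h - l2_inner g h"
  unfolding l2_inner_def
  by (subst Bochner_Integration.integral_diff[symmetric]) (auto intro: L2_inner_integrable simp: algebra_simps)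

lemma l2_inner_scale_left: "l2_inner (\<lambda>x. c * f x) g = c * l2_inner f g"
  unfolding l2_inner_def by (simp add: mult.assoc)

lemma l2_inner_commute: "l2_inner g f = cnj (l2_inner f g)"
  using Bochner_Integration.integral_cnj[of lborel "\<lambda>x. f x * cnj (g x)"] by (simp add: l2_inner_def mult.commute)

lemma l2_inner_scale_right: "l2_inner f (\<lambda>x. c * g x) = cnj c * l2_inner f g"
  unfolding l2_inner_def by (simp add: mult.left_commute)

lemma l2_inner_add_right:
  "f \<in> L2 \<Longrightarrow> g \<in> L2 \<Longrightarrow> h \<in> L2 \<Longrightarrow> l2_inner f (\<lambda>x. g x + h x) = l2_inner f g + l2_inner f h"
  using l2_inner_add_left[of g h f] l2_inner_commute[of f] by (metis complex_cnj_add)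

lemma l2_inner_sum_left:
  assumes "\<And>i. i \<in> I \<Longrightarrow> f i \<in> L2" "h \<in> L2"
  shows "l2_inner (\<lambda>x. \<Sum>i\<in>I. f i x) h = (\<Sum>i\<in>I. l2_inner (f i) h)"
  using assms
proof (induction I rule: infinite_finite_induct)
  case (insert i I)
  then show ?case
    by (simp add: l2_inner_add_left L2_sum)
qed (simp_all add: l2_inner_def)

lemma l2_norm_scale: "l2_norm (\<lambda>x. c * f x) = cmod c * l2_norm f"
  unfolding l2_norm_def by (simp add: norm_mult power_mult_distrib real_sqrt_mult)

lemma l2_norm_minus_commute: "l2_norm (\<lambda>x. f x - g x) = l2_norm (\<lambda>x. g x - f x)"
  unfolding l2_norm_def by (simp add: norm_minus_commute)

lemma l2_norm_add_power2:
  assumes "f \<in> L2" "g \<in> L2"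
  shows "(l2_norm (\<lambda>x. f x + g x))\<^sup>2 = (l2_norm f)\<^sup>2 + 2 * Re (l2_inner f g) + (l2_norm g)\<^sup>2"
proof -
  have "complex_of_real ((l2_norm (\<lambda>x. f x + g x))\<^sup>2) = l2_inner (\<lambda>x. f x + g x) (\<lambda>x. f x + g x)"
    by (rule l2_inner_self[symmetric])
  also have "\<dots> = l2_inner f f + l2_inner f g + (l2_inner g f + l2_inner g g)"
    using assms by (simp add: l2_inner_add_left l2_inner_add_right L2_add)
  finally have "Re (complex_of_real ((l2_norm (\<lambda>x. f x + g x))\<^sup>2)) = Re (l2_inner f f + l2_inner f g + (l2_inner g f + l2_inner g g))"
    by simp
  then show ?thesis
    by (simp add: l2_inner_self l2_inner_commute[of g f])
qed

lemma l2_norm_diff_power2: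
  assumes "f \<in> L2" "g \<in> L2"
  shows "(l2_norm (\<lambda>x. f x - g x))\<^sup>2 = (l2_norm f)\<^sup>2 - 2 * Re (l2_inner f g) + (l2_norm g)\<^sup>2"
  using l2_norm_add_power2[OF assms(1) L2_scale[OF assms(2), of "-1"]]
    l2_inner_scale_right[of f "-1" g] l2_norm_scale[of "-1" g] by simp

text \<open>Norm zero forces vanishing only almost everywhere, so this degenerate case of
  Cauchy-Schwarz is an argument about null sets.\<close>

lemma l2_inner_norm_zero:
  assumes "f \<in> L2" "g \<in> L2" "l2_norm g = 0"
  shows "l2_inner f g = 0"
proof -
  have "(LINT x|lborel. (cmod (g x))\<^sup>2) = 0"
    using assms(3) by (simp add: l2_norm_def)
  then have "AE x in lborel. (cmod (g x))\<^sup>2 = 0"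
    by (subst (asm) integral_nonneg_eq_0_iff_AE) (use L2_integrable[OF assms(2)] in auto)
  then have "AE x in lborel. f x * cnj (g x) = 0"
    by eventually_elim simp
  then show ?thesis
    unfolding l2_inner_def by (rule integral_eq_zero_AE)
qed

lemma l2_Cauchy_Schwarz:
  assumes "f \<in> L2" "g \<in> L2"
  shows "cmod (l2_inner f g) \<le> l2_norm f * l2_norm g"
proof (cases "l2_norm g = 0")
  case True
  then show ?thesis using l2_inner_norm_zero[OF assms] by simp
next
  case False
  \<comment> \<open>\<open>c * g\<close> is the projection of \<open>f\<close> onto the line spanned
    by \<open>g\<close>, the choice that makes the squared distance smallest.\<close>
  define c where "c = l2_inner f g / of_real ((l2_norm g)\<^sup>2)"
  have "0 \<le> (l2_norm (\<lambda>x. f x - c * g x))\<^sup>2" by simp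
  also have "\<dots> = (l2_norm f)\<^sup>2 - 2 * Re (cnj c * l2_inner f g) + (cmod c * l2_norm g)\<^sup>2"
    using assms by (simp add: l2_norm_diff_power2 L2_scale l2_inner_scale_right l2_norm_scale)
  also have "cnj c * l2_inner f g = of_real ((cmod (l2_inner f g))\<^sup>2 / (l2_norm g)\<^sup>2)"
    unfolding of_real_divide complex_norm_square by (simp add: c_def mult.commute)
  also have "(cmod c * l2_norm g)\<^sup>2 = (cmod (l2_inner f g))\<^sup>2 / (l2_norm g)\<^sup>2"
    using False by (simp add: c_def norm_divide norm_power norm_mult power_divide power_mult_distrib power2_eq_square)
  finally have "(cmod (l2_inner f g))\<^sup>2 / (l2_norm g)\<^sup>2 \<le> (l2_norm f)\<^sup>2"
    by simp
  then have "(cmod (l2_inner f g))\<^sup>2 \<le> (l2_norm f * l2_norm g)\<^sup>2"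
    using False by (simp add: divide_le_eq power_mult_distrib)
  then show ?thesis
    by (rule power2_le_imp_le) simp
qed

lemma l2_norm_triangle:
  assumes "f \<in> L2" "g \<in> L2"
  shows "l2_norm (\<lambda>x. f x + g x) \<le> l2_norm f + l2_norm g"
proof (rule power2_le_imp_le)
  have "Re (l2_inner f g) \<le> l2_norm f * l2_norm g"
    using l2_Cauchy_Schwarz[OF assms] complex_Re_le_cmod order_trans by blast
  then show "(l2_norm (\<lambda>x. f x + g x))\<^sup>2 \<le> (l2_norm f + l2_norm g)\<^sup>2"
    by (simp add: l2_norm_add_power2[OF assms] power2_sum)
qed simp

lemma l2_norm_triangle_diff:
  assumes "f \<in> L2" "g \<in> L2" "h \<in> L2"
  shows "l2_norm (\<lambda>x. f x - h x) \<le> l2_norm (\<lambda>x. f x - g x) + l2_norm (\<lambda>x. g x - h x)"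
  using l2_norm_triangle[OF L2_diff[OF assms(1,2)] L2_diff[OF assms(2,3)]] by simp

lemma l2_norm_triangle_sub:
  assumes "f \<in> L2" "g \<in> L2"
  shows "\<bar>l2_norm f - l2_norm g\<bar> \<le> l2_norm (\<lambda>x. f x - g x)"
  using l2_norm_triangle[OF assms(2) L2_diff[OF assms(1,2)]]
    l2_norm_triangle[OF assms(1) L2_diff[OF assms(2,1)]]
  by (simp add: l2_norm_minus_commute[of g f])

section \<open>Convergence in the mean and completeness\<close>

lemma l2_tendsto_norm:
  assumes "\<And>n. u n \<in> L2" "f \<in> L2" "l2_tendsto u f"
  shows "(\<lambda>n. l2_norm (u n)) \<longlonglongrightarrow> l2_norm f"
proof (rule LIM_zero_cancel, rule Lim_null_comparison)
  show "\<forall>\<^sub>F n in sequentially. norm (l2_norm (u n) - l2_norm f) \<le> l2_norm (\<lambda>x. u n x - f x)"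
    using l2_norm_triangle_sub[OF assms(1,2)] by simp
qed (use assms(3) in \<open>simp add: l2_tendsto_def\<close>)

lemma l2_tendsto_add:
  assumes "\<And>n. u n \<in> L2" "f \<in> L2" "l2_tendsto u f" "\<And>n. v n \<in> L2" "g \<in> L2" "l2_tendsto v g"
  shows "l2_tendsto (\<lambda>n x. u n x + v n x) (\<lambda>x. f x + g x)"
  unfolding l2_tendsto_def
proof (rule Lim_null_comparison)
  show "\<forall>\<^sub>F n in sequentially. norm (l2_norm (\<lambda>x. u n x + v n x - (f x + g x))) \<le> l2_norm (\<lambda>x. u n x - f x) + l2_norm (\<lambda>x. v n x - g x)"
    using l2_norm_triangle[OF L2_diff[OF assms(1,2)] L2_diff[OF assms(4,5)]]
    by (simp add: add_diff_add)
  show "(\<lambda>n. l2_norm (\<lambda>x. u n x - f x) + l2_norm (\<lambda>x. v n x - g x)) \<longlonglongrightarrow> 0"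
    using tendsto_add[OF assms(3,6)[unfolded l2_tendsto_def]] by simp
qed

lemma l2_tendsto_scale:
  assumes "l2_tendsto u f"
  shows "l2_tendsto (\<lambda>n x. c * u n x) (\<lambda>x. c * f x)"
  using tendsto_mult_left[OF assms[unfolded l2_tendsto_def], of "cmod c"]
  unfolding l2_tendsto_def right_diff_distrib[symmetric] l2_norm_scale by simp

text \<open>Cauchy-Schwarz on both parts of <u - f, v> + <f, v - g>; the factor
  \<open>l2_norm (v n)\<close> is harmless because it converges.\<close>

lemma l2_tendsto_inner:
  assumes "\<And>n. u n \<in> L2" "f \<in> L2" "l2_tendsto u f" "\<And>n. v n \<in> L2" "g \<in> L2" "l2_tendsto v g"
  shows "(\<lambda>n. l2_inner (u n) (v n)) \<longlonglongrightarrow> l2_inner f g"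
proof (rule LIM_zero_cancel, rule Lim_null_comparison)
  let ?d = "\<lambda>n. l2_norm (\<lambda>x. u n x - f x) * l2_norm (v n) + l2_norm f * l2_norm (\<lambda>x. v n x - g x)"
  show "\<forall>\<^sub>F n in sequentially. norm (l2_inner (u n) (v n) - l2_inner f g) \<le> ?d n"
  proof (rule always_eventually, rule allI)
    fix n
    have "l2_inner (u n) (v n) - l2_inner f g = l2_inner (\<lambda>x. u n x - f x) (v n) + (l2_inner f (v n) - l2_inner f g)"
      using assms by (simp add: l2_inner_diff_left)
    also have "l2_inner f (v n) - l2_inner f g = l2_inner f (\<lambda>x. v n x - g x)"
      using l2_inner_add_right[OF assms(2) L2_diff[OF assms(4)[of n] assms(5)] assms(5)] by simp
    also have "cmod (l2_inner (\<lambda>x. u n x - f x) (v n) + \<dots>) \<le> ?d n"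
      by (intro norm_triangle_mono l2_Cauchy_Schwarz L2_diff assms)
    finally show "norm (l2_inner (u n) (v n) - l2_inner f g) \<le> ?d n" .
  qed
  have "?d \<longlonglongrightarrow> 0 * l2_norm g + l2_norm f * 0"
    using assms(3,6) unfolding l2_tendsto_def
    by (intro tendsto_intros l2_tendsto_norm assms)
  then show "?d \<longlonglongrightarrow> 0" by simp
qed

text \<open>Multiplication by a positive \<open>L\<^sup>2\<close> weight turns a Cauchy sequence of \<open>L\<^sup>2\<close> into one of
  \<open>L\<^sup>1\<close>, for which the library provides an almost everywhere convergent subsequence.\<close>

lemma L2_complete_weighted:
  fixes u :: "nat \<Rightarrow> 'a::euclidean_space \<Rightarrow> complex" and h :: "'a \<Rightarrow> complex"
  assumes h: "h \<in> L2" "\<And>x. h x \<noteq> 0" and u: "\<And>n. u n \<in> L2"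
    and C: "\<And>e. e > 0 \<Longrightarrow> \<exists>N. \<forall>m\<ge>N. \<forall>n\<ge>N. l2_norm (\<lambda>x. u m x - u n x) < e"
  obtains f where "f \<in> L2" "l2_tendsto u f"
proof -
  have int: "integrable lborel (\<lambda>x. u n x * h x)" for n
    by (intro L2_mult_integrable u h)
  have "\<exists>N. \<forall>i\<ge>N. \<forall>j\<ge>N. (LINT x|lborel. norm (u i x * h x - u j x * h x)) < e" if "e > 0" for e
  proof -
    \<comment> \<open>The \<open>+ 1\<close> keeps the divisor positive without any lower bound on
      the norm of \<open>h\<close>.\<close>
    obtain N where N: "\<forall>m\<ge>N. \<forall>n\<ge>N. l2_norm (\<lambda>x. u m x - u n x) < e / (l2_norm h + 1)"
      using C[of "e / (l2_norm h + 1)"] \<open>e > 0\<close> l2_norm_nonneg[of h]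
      by (meson add_nonneg_pos divide_pos_pos zero_less_one)
    have "(LINT x|lborel. norm (u i x * h x - u j x * h x)) < e" if "i \<ge> N" "j \<ge> N" for i j
    proof -
      let ?d = "\<lambda>x. complex_of_real (cmod (u i x - u j x))" and ?h = "\<lambda>x. complex_of_real (cmod (h x))"
      have L: "?d \<in> L2" "?h \<in> L2"
        using L2_diff[OF u[of i] u[of j]] h(1) by (auto simp: L2_def)
      have "(LINT x|lborel. norm (u i x * h x - u j x * h x)) = cmod (l2_inner ?d ?h)"
        unfolding l2_inner_def left_diff_distrib[symmetric] norm_mult
        by (simp flip: of_real_mult)
      also have "\<dots> \<le> l2_norm ?d * l2_norm ?h"
        by (rule l2_Cauchy_Schwarz[OF L])
      also have "\<dots> = l2_norm (\<lambda>x. u i x - u j x) * l2_norm h"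
        by (simp add: l2_norm_def)
      also have "\<dots> \<le> e / (l2_norm h + 1) * l2_norm h"
        using N that by (intro mult_right_mono) (auto intro: less_imp_le)
      also have "\<dots> < e"
        using \<open>e > 0\<close> l2_norm_nonneg[of h] by (simp add: divide_less_eq add_nonneg_pos)
      finally show ?thesis .
    qed
    then show ?thesis by blast
  qed
  from cauchy_L1_AE_cauchy_subseq[OF int this]
  obtain r where r: "strict_mono r" and AE1: "AE x in lborel. Cauchy (\<lambda>i. u (r i) x * h x)"
    by blast
  \<comment> \<open>Where the subsequence diverges \<open>lim\<close> takes an arbitrary value;
    measurability holds regardless, and divergence occurs only on a null set.\<close>
  define f where "f x = lim (\<lambda>i. u (r i) x)" for x
  have AE2: "AE x in lborel. (\<lambda>i. u (r i) x) \<longlonglongrightarrow> f x"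
    using AE1
  proof eventually_elim
    case (elim x)
    then obtain l where "(\<lambda>i. u (r i) x * h x) \<longlonglongrightarrow> l"
      using Cauchy_convergent_iff convergent_def by blast
    from tendsto_divide[OF this tendsto_const h(2)[of x]] have "(\<lambda>i. u (r i) x) \<longlonglongrightarrow> l / h x"
      using h(2)[of x] by simp
    then show ?case
      unfolding f_def using limI by force
  qed
  have fm: "f \<in> borel_measurable borel"
    unfolding f_def[abs_def] by (intro borel_measurable_lim_metric L2_measurable u)
  have diff: "(\<lambda>x. f x - u m x) \<in> L2 \<and> l2_norm (\<lambda>x. f x - u m x) \<le> e"
    if "e > 0" and N: "\<forall>m\<ge>N. \<forall>n\<ge>N. l2_norm (\<lambda>x. u m x - u n x) < e" and "m \<ge> N" for e N m
  proof -
    have [measurable]: "u n \<in> borel_measurable borel" for n using u by (rule L2_measurable)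
    have "(\<integral>\<^sup>+x. ennreal ((cmod (f x - u m x))\<^sup>2) \<partial>lborel) = (\<integral>\<^sup>+x. liminf (\<lambda>i. ennreal ((cmod (u (r i) x - u m x))\<^sup>2)) \<partial>lborel)"
      by (rule nn_integral_cong_AE, use AE2 in eventually_elim)
         (rule lim_imp_Liminf[symmetric], auto intro!: tendsto_intros)
    \<comment> \<open>Fatou along the subsequence carries the Cauchy bound on
      \<open>u (r i) - u m\<close> over to \<open>f - u m\<close>.\<close>
    also have "\<dots> \<le> liminf (\<lambda>i. \<integral>\<^sup>+x. ennreal ((cmod (u (r i) x - u m x))\<^sup>2) \<partial>lborel)"
      by (rule nn_integral_liminf) measurable
    also have "\<dots> \<le> liminf (\<lambda>i. ennreal (e\<^sup>2))"
    proof (rule Liminf_mono, rule eventually_sequentiallyI)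
      fix i assume "N \<le> i"
      then have "N \<le> r i" using r seq_suble[of r i] by linarith
      then show "(\<integral>\<^sup>+x. ennreal ((cmod (u (r i) x - u m x))\<^sup>2) \<partial>lborel) \<le> ennreal (e\<^sup>2)"
        using N \<open>m \<ge> N\<close> by (subst nn_integral_l2_norm) (auto intro!: L2_diff u power_mono ennreal_leI intro: less_imp_le)
    qed
    finally have "(\<integral>\<^sup>+x. ennreal ((cmod (f x - u m x))\<^sup>2) \<partial>lborel) \<le> ennreal (e\<^sup>2)"
      by (simp add: Liminf_const)
    then show ?thesis
      using L2_I_nn[of "\<lambda>x. f x - u m x" e] fm \<open>e > 0\<close> by auto
  qed
  have "f \<in> L2"
  proof -
    obtain N where "\<forall>m\<ge>N. \<forall>n\<ge>N. l2_norm (\<lambda>x. u m x - u n x) < 1" using C[of 1] by auto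
    then have "(\<lambda>x. f x - u N x) \<in> L2" using diff[of 1 N N] by simp
    from L2_add[OF this u[of N]] show ?thesis by simp
  qed
  moreover have "l2_tendsto u f"
    unfolding l2_tendsto_def
  proof (rule LIMSEQ_I)
    fix e :: real assume "e > 0"
    then obtain N where N: "\<forall>m\<ge>N. \<forall>n\<ge>N. l2_norm (\<lambda>x. u m x - u n x) < e/2" using C[of "e/2"] by auto
    have "norm (l2_norm (\<lambda>x. u m x - f x) - 0) < e" if "m \<ge> N" for m
      using diff[OF _ N that] \<open>e > 0\<close> by (simp add: l2_norm_minus_commute[of "u m"])
    then show "\<exists>no. \<forall>n\<ge>no. norm (l2_norm (\<lambda>x. u n x - f x) - 0) < e" by blast
  qed
  ultimately show ?thesis by (rule that)
qed

section \<open>Gaussians and completeness of the space of square-integrable functions\<close>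

text \<open>Lebesgue measure is the image of a product of lines under the coordinate map, so
  integrals of products over single coordinates factor. This reduces the Gaussian to dimension
  one.\<close>

lemma lborel_integral_prod:
  fixes f :: "'a::euclidean_space \<Rightarrow> real \<Rightarrow> 'b::{real_normed_field,banach,second_countable_topology}"
  assumes f: "\<And>b. b \<in> Basis \<Longrightarrow> integrable lborel (f b)"
  shows "integrable lborel (\<lambda>x::'a. \<Prod>b\<in>Basis. f b (x \<bullet> b))"
    and "(LINT x::'a|lborel. (\<Prod>b\<in>Basis. f b (x \<bullet> b))) = (\<Prod>b\<in>Basis. LINT t|lborel. f b t)"
proof -
  interpret product_sigma_finite "\<lambda>_::'a. lborel::real measure" ..
  let ?T = "\<lambda>g. \<Sum>b\<in>Basis. g b *\<^sub>R b :: 'a"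
  have eq: "(lborel :: 'a measure) = distr (Pi\<^sub>M Basis (\<lambda>_. lborel :: real measure)) borel ?T"
    by (rule lborel_eq)
  have coord: "(\<Sum>c\<in>Basis. g c *\<^sub>R c) \<bullet> b = g b" if "b \<in> Basis" for g :: "'a \<Rightarrow> real" and b
    using that by (simp add: inner_sum_left inner_Basis if_distrib cong: if_cong)
  have [measurable]: "f b \<in> borel_measurable borel" if "b \<in> Basis" for b
    using borel_measurable_integrable[OF f[OF that]] by simp
  have m: "(\<lambda>x::'a. \<Prod>b\<in>Basis. f b (x \<bullet> b)) \<in> borel_measurable borel"
    by measurable
  have T: "?T \<in> Pi\<^sub>M Basis (\<lambda>_. lborel :: real measure) \<rightarrow>\<^sub>M borel"
    by measurable
  show "integrable lborel (\<lambda>x::'a. \<Prod>b\<in>Basis. f b (x \<bullet> b))"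
    unfolding eq integrable_distr_eq[OF T m] using product_integrable_prod[OF finite_Basis f]
    by (simp add: coord)
  show "(LINT x::'a|lborel. (\<Prod>b\<in>Basis. f b (x \<bullet> b))) = (\<Prod>b\<in>Basis. LINT t|lborel. f b t)"
    unfolding eq integral_distr[OF T m] using product_integral_prod[OF finite_Basis f]
    by (simp add: coord)
qed

lemma gaussian_integrable_real: "integrable lborel (\<lambda>x::real. exp (- pi * (x * x)))"
  and gaussian_integral_real: "(LINT x|lborel. exp (- pi * (x * x))) = 1"
proof -
  have eq: "normal_density 0 (1 / sqrt (2 * pi)) = (\<lambda>x. exp (- pi * (x * x)))"
    by (rule ext) (simp add: normal_density_def power_divide power2_eq_square mult.commute)
  show "integrable lborel (\<lambda>x::real. exp (- pi * (x * x)))"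
    unfolding eq[symmetric] by (rule integrable_normal_density) simp
  show "(LINT x|lborel. exp (- pi * (x * x))) = 1"
    unfolding eq[symmetric] by (rule integral_normal_density) simp
qed

text \<open>The characteristic function exp(-t^2/2) of the standard normal law, read at
  \<open>t = - c * \<xi>\<close> with \<open>c = sqrt (2 * pi)\<close> after rescaling the variable
  by \<open>c\<close>.\<close>

lemma gaussian_fourier_real:
  "(LINT x|lborel. complex_of_real (exp (- pi * (x * x))) * cis (- 2 * pi * (x * \<xi>))) =
     complex_of_real (exp (- pi * (\<xi> * \<xi>)))"
proof -
  define c where "c = sqrt (2 * pi)"
  have c: "c > 0" "c * c = 2 * pi" by (simp_all add: c_def)
  have "complex_of_real (exp (- pi * (\<xi> * \<xi>))) = char std_normal_distribution (- c * \<xi>)"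
    unfolding char_std_normal_distribution using c(2)
    by (simp add: power2_eq_square algebra_simps)
  also have "\<dots> = (LINT x|lborel. std_normal_density x *\<^sub>R iexp ((- c * \<xi>) * x))"
    unfolding char_def by (subst integral_density) (auto simp: normal_density_nonneg)
  also have "\<dots> = c *\<^sub>R (LINT x|lborel. std_normal_density (c * x) *\<^sub>R iexp ((- c * \<xi>) * (c * x)))"
    using c(1) by (subst lborel_integral_real_affine[of c _ 0]) auto
  also have "\<dots> = (LINT x|lborel. complex_of_real (exp (- pi * (x * x))) * cis (- 2 * pi * (x * \<xi>)))"
  proof -
    have "c * std_normal_density (c * x) = exp (- pi * (x * x))" for x
    proof -
      have "(c * x)\<^sup>2 / 2 = pi * (x * x)"
        using c(2) by (simp add: power2_eq_square algebra_simps)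
      then show ?thesis using c(1) by (simp add: std_normal_density_def c_def[symmetric])
    qed
    moreover have "iexp ((- c * \<xi>) * (c * x)) = cis (- 2 * pi * (x * \<xi>))" for x
    proof -
      have "(- c * \<xi>) * (c * x) = - (c * c) * (x * \<xi>)" by (simp add: algebra_simps)
      also have "\<dots> = - 2 * pi * (x * \<xi>)" by (simp add: c(2))
      finally show ?thesis by (simp only: cis_conv_exp)
    qed
    ultimately have "c *\<^sub>R (std_normal_density (c * x) *\<^sub>R iexp ((- c * \<xi>) * (c * x))) =
        complex_of_real (exp (- pi * (x * x))) * cis (- 2 * pi * (x * \<xi>))" for x
      unfolding scaleR_scaleR by (simp only: scaleR_conv_of_real)
    then show ?thesis
      unfolding integral_scaleR_right[symmetric] by (simp only:)
  qed
  finally show ?thesis by simp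
qed

text \<open>The constant \<open>pi\<close> gives mass 1 and makes the function its own transform. It
  serves twice: as a positive weight for completeness and as an averaging kernel for
  Plancherel.\<close>

definition gaussian :: "'a::euclidean_space \<Rightarrow> real" where
  "gaussian x = exp (- pi * (x \<bullet> x))"

lemma gaussian_prod: "gaussian x = (\<Prod>b\<in>Basis. exp (- pi * ((x \<bullet> b) * (x \<bullet> b))))"
  unfolding gaussian_def by (subst euclidean_inner) (simp add: exp_sum[symmetric] sum_distrib_left sum_negf)

lemma gaussian_bounds: "0 < gaussian x" "gaussian x \<le> 1"
  by (simp_all add: gaussian_def)

lemma gaussian_measurable [measurable]: "gaussian \<in> borel_measurable borel"
  unfolding gaussian_def[abs_def] by measurable

lemma gaussian_integrable: "integrable lborel (gaussian :: 'a::euclidean_space \<Rightarrow> real)"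
  and gaussian_integral: "(LINT x::'a|lborel. gaussian x) = 1"
proof -
  show "integrable lborel (gaussian :: 'a \<Rightarrow> real)"
    unfolding gaussian_prod[abs_def] by (rule lborel_integral_prod(1)[OF gaussian_integrable_real])
  show "(LINT x::'a|lborel. gaussian x) = 1"
    unfolding gaussian_prod[abs_def]
    by (subst lborel_integral_prod(2)[OF gaussian_integrable_real]) (simp add: gaussian_integral_real[simplified])
qed

lemma cis_sum: "cis (\<Sum>i\<in>I. f i) = (\<Prod>i\<in>I. cis (f i))"
  by (induction I rule: infinite_finite_induct) (simp_all add: cis_mult[symmetric])

lemma gaussian_fourier:
  "(LINT x::'a::euclidean_space|lborel. complex_of_real (gaussian x) * cis (- 2 * pi * (x \<bullet> \<xi>))) = of_real (gaussian \<xi>)"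
proof -
  have int: "integrable lborel (\<lambda>x. complex_of_real (exp (- pi * (x * x))) * cis (- 2 * pi * (x * t)))" for t :: real
    by (rule Bochner_Integration.integrable_bound[OF gaussian_integrable_real])
       (auto simp: norm_mult intro!: borel_measurable_continuous_onI continuous_intros)
  have "complex_of_real (gaussian x) * cis (- 2 * pi * (x \<bullet> \<xi>)) =
      (\<Prod>b\<in>Basis. complex_of_real (exp (- pi * ((x \<bullet> b) * (x \<bullet> b)))) * cis (- 2 * pi * ((x \<bullet> b) * (\<xi> \<bullet> b))))" for x :: 'a
    unfolding gaussian_prod prod.distrib
    by (subst euclidean_inner) (simp add: cis_sum[symmetric] sum_distrib_left sum_negf mult.assoc)
  then show ?thesis
    by (simp only: lborel_integral_prod(2)[OF int] gaussian_fourier_real) (simp add: gaussian_prod)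
qed

text \<open>The Gaussian is an admissible weight: it vanishes nowhere, and as its values are at most
  1 its square is dominated by itself.\<close>

lemma L2_complete:
  fixes u :: "nat \<Rightarrow> 'a::euclidean_space \<Rightarrow> complex"
  assumes "\<And>n. u n \<in> L2" "\<And>e. e > 0 \<Longrightarrow> \<exists>N. \<forall>m\<ge>N. \<forall>n\<ge>N. l2_norm (\<lambda>x. u m x - u n x) < e"
  obtains f where "f \<in> L2" "l2_tendsto u f"
proof (rule L2_complete_weighted[of "\<lambda>x::'a. complex_of_real (gaussian x)" u])
  show "(\<lambda>x::'a. complex_of_real (gaussian x)) \<in> L2"
  proof (rule L2_bound[OF _ gaussian_integrable])
    show "(cmod (complex_of_real (gaussian x)))\<^sup>2 \<le> gaussian x" for x :: 'a
      using gaussian_bounds[of x] by (simp add: power2_eq_square mult_left_le)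
  qed measurable
  show "complex_of_real (gaussian x) \<noteq> 0" for x :: 'a
    using gaussian_bounds(1)[of x] by simp
qed (use assms that in auto)

section \<open>Affine changes of variable\<close>

lemma lborel_integral_affine:
  fixes f :: "'a::euclidean_space \<Rightarrow> 'b::{banach,second_countable_topology}"
  assumes "c \<noteq> 0" and [measurable]: "f \<in> borel_measurable borel"
  shows "(LINT x|lborel. f x) = \<bar>c\<bar> ^ DIM('a) *\<^sub>R (LINT x|lborel. f (t + c *\<^sub>R x))"
    and "integrable lborel (\<lambda>x. f (t + c *\<^sub>R x)) \<longleftrightarrow> integrable lborel f"
proof -
  note eq = lborel_affine[OF assms(1), of t]
  show "(LINT x|lborel. f x) = \<bar>c\<bar> ^ DIM('a) *\<^sub>R (LINT x|lborel. f (t + c *\<^sub>R x))"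
    by (subst eq) (simp add: integral_density integral_distr)
  show "integrable lborel (\<lambda>x. f (t + c *\<^sub>R x)) \<longleftrightarrow> integrable lborel f"
  proof -
    have "integrable lborel f \<longleftrightarrow> integrable lborel (\<lambda>x. \<bar>c\<bar> ^ DIM('a) *\<^sub>R f (t + c *\<^sub>R x))"
      by (subst (1) eq) (simp add: integrable_density integrable_distr_eq)
    also have "\<dots> \<longleftrightarrow> integrable lborel (\<lambda>x. f (t + c *\<^sub>R x))"
      using integrable_scaleR_right[of "inverse (\<bar>c\<bar> ^ DIM('a))" lborel "\<lambda>x. \<bar>c\<bar> ^ DIM('a) *\<^sub>R f (t + c *\<^sub>R x)"] assms(1)
      by auto
    finally show ?thesis by simp
  qed
qed

lemma lborel_integral_translate:
  fixes f :: "'a::euclidean_space \<Rightarrow> 'b::{banach,second_countable_topology}"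
  assumes "f \<in> borel_measurable borel"
  shows "(LINT x|lborel. f (x - h)) = (LINT x|lborel. f x)"
    and "integrable lborel (\<lambda>x. f (x - h)) \<longleftrightarrow> integrable lborel f"
  using lborel_integral_affine[of 1 f "- h"] assms by simp_all

section \<open>Continuity of translation in the mean\<close>

lemma L1_triangle:
  fixes f g h :: "'a::euclidean_space \<Rightarrow> complex"
  assumes "integrable lborel f" "integrable lborel g" "integrable lborel h"
  shows "(LINT x|lborel. cmod (f x - h x)) \<le> (LINT x|lborel. cmod (f x - g x)) + (LINT x|lborel. cmod (g x - h x))"
proof -
  have "(LINT x|lborel. cmod (f x - h x)) \<le> (LINT x|lborel. cmod (f x - g x) + cmod (g x - h x))"
    using assms by (intro integral_mono) (auto intro: norm_triangle_ineq[of "f x - g x" "g x - h x" for x, simplified])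
  then show ?thesis using assms by simp
qed

text \<open>A three-epsilon argument: by translation invariance the error between \<open>f\<close>
  and \<open>g\<close> is paid once for the translates and once for the originals.\<close>

lemma L1_translation_approx:
  fixes f :: "'a::euclidean_space \<Rightarrow> complex" and h :: "nat \<Rightarrow> 'a"
  assumes f: "integrable lborel f"
    and approx: "\<And>e. 0 < e \<Longrightarrow> \<exists>g. integrable lborel g \<and> (LINT x|lborel. cmod (f x - g x)) \<le> e \<and>
       (\<lambda>n. LINT x|lborel. cmod (g (x - h n) - g x)) \<longlonglongrightarrow> 0"
  shows "(\<lambda>n. LINT x|lborel. cmod (f (x - h n) - f x)) \<longlonglongrightarrow> 0"
proof (rule LIMSEQ_I)
  fix e :: real assume "0 < e"
  then obtain g where g: "integrable lborel g" and fg: "(LINT x|lborel. cmod (f x - g x)) \<le> e / 3"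
    and lim: "(\<lambda>n. LINT x|lborel. cmod (g (x - h n) - g x)) \<longlonglongrightarrow> 0"
    using approx[of "e / 3"] by auto
  have [measurable]: "f \<in> borel_measurable borel" "g \<in> borel_measurable borel"
    using f g by (auto dest: borel_measurable_integrable)
  have tr: "integrable lborel (\<lambda>x. f (x - h n))" "integrable lborel (\<lambda>x. g (x - h n))" for n
    using f g by (simp_all add: lborel_integral_translate)
  have *: "(LINT x|lborel. cmod (f (x - h n) - f x)) \<le> 2 * e / 3 + (LINT x|lborel. cmod (g (x - h n) - g x))" for n
  proof -
    have "(LINT x|lborel. cmod (f (x - h n) - f x)) \<le>
        (LINT x|lborel. cmod (f (x - h n) - g (x - h n))) + ((LINT x|lborel. cmod (g (x - h n) - g x)) + (LINT x|lborel. cmod (g x - f x)))"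
      using L1_triangle[OF tr(1) tr(2) f, of n n] L1_triangle[OF tr(2) g f, of n] by linarith
    moreover have "(LINT x|lborel. cmod (f (x - h n) - g (x - h n))) = (LINT x|lborel. cmod (f x - g x))"
      using lborel_integral_translate(1)[of "\<lambda>x. cmod (f x - g x)" "h n"] by simp
    ultimately show ?thesis using fg by (simp add: norm_minus_commute)
  qed
  obtain N where "\<And>n. n \<ge> N \<Longrightarrow> norm ((LINT x|lborel. cmod (g (x - h n) - g x)) - 0) < e / 3"
    using LIMSEQ_D[OF lim, of "e / 3"] \<open>0 < e\<close> by auto
  then have "norm ((LINT x|lborel. cmod (f (x - h n) - f x)) - 0) < e" if "n \<ge> N" for n
    using *[of n] that by fastforce
  then show "\<exists>N. \<forall>n\<ge>N. norm ((LINT x|lborel. cmod (f (x - h n) - f x)) - 0) < e" by blast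
qed

text \<open>Openness is what makes the overlap converge: a point of \<open>U\<close> stays in
  \<open>U\<close> under all sufficiently small translations, whatever the boundary looks
  like.\<close>

lemma L1_translation_open:
  fixes h :: "nat \<Rightarrow> 'a::euclidean_space" and c :: complex
  assumes h: "h \<longlonglongrightarrow> 0" and U: "open U" "emeasure lborel U < \<infinity>"
  shows "(\<lambda>n. LINT x|lborel. cmod (indicator U (x - h n) *\<^sub>R c - indicator U x *\<^sub>R c)) \<longlonglongrightarrow> 0"
proof -
  let ?I = "indicator U :: 'a \<Rightarrow> real"
  have [measurable]: "U \<in> sets borel" using U by simp
  have I: "integrable lborel ?I" using U by (simp add: integrable_real_indicator)
  have tr: "integrable lborel (\<lambda>x. ?I (x - h n))" for n
    using I by (simp add: lborel_integral_translate)
  have pr: "integrable lborel (\<lambda>x. ?I x * ?I (x - h n))" for n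
    by (rule Bochner_Integration.integrable_bound[OF I]) (auto simp: indicator_def)
  \<comment> \<open>For indicator values |s - t| = s + t - 2 s t, so only the overlap of
    \<open>U\<close> with its translate remains to be studied.\<close>
  have "cmod (?I (x - h n) *\<^sub>R c - ?I x *\<^sub>R c) = cmod c * (?I (x - h n) + ?I x - 2 * (?I x * ?I (x - h n)))" for n x
    by (auto simp: indicator_def)
  then have eq: "(LINT x|lborel. cmod (?I (x - h n) *\<^sub>R c - ?I x *\<^sub>R c)) =
      cmod c * (2 * (LINT x|lborel. ?I x) - 2 * (LINT x|lborel. ?I x * ?I (x - h n)))" for n
    using I tr[of n] pr[of n] lborel_integral_translate(1)[of ?I "h n"] by simp
  have "(\<lambda>n. LINT x|lborel. ?I x * ?I (x - h n)) \<longlonglongrightarrow> (LINT x|lborel. ?I x)"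
  proof (rule integral_dominated_convergence[where w="?I"])
    show "AE x in lborel. (\<lambda>n. ?I x * ?I (x - h n)) \<longlonglongrightarrow> ?I x"
    proof (rule AE_I2)
      fix x
      show "(\<lambda>n. ?I x * ?I (x - h n)) \<longlonglongrightarrow> ?I x"
      proof (cases "x \<in> U")
        case True
        have "(\<lambda>n. x - h n) \<longlonglongrightarrow> x - 0" by (intro tendsto_intros h)
        then have "\<forall>\<^sub>F n in sequentially. x - h n \<in> U"
          using U(1) True topological_tendstoD by fastforce
        then have "\<forall>\<^sub>F n in sequentially. ?I x * ?I (x - h n) = 1"
          by eventually_elim (simp add: True)
        then show ?thesis using True by (simp add: tendsto_eventually)
      qed simp
    qed
  qed (use I in \<open>auto simp: indicator_def\<close>)
  then have "(\<lambda>n. cmod c * (2 * (LINT x|lborel. ?I x) - 2 * (LINT x|lborel. ?I x * ?I (x - h n)))) \<longlonglongrightarrow>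
      cmod c * (2 * (LINT x|lborel. ?I x) - 2 * (LINT x|lborel. ?I x))"
    by (intro tendsto_intros)
  then show ?thesis unfolding eq by simp
qed

text \<open>Indicators of open sets take the place usually given to continuous functions of compact
  support: outer regularity handles measurable sets, and the induction for integrable functions does
  the rest.\<close>

lemma L1_translation:
  fixes f :: "'a::euclidean_space \<Rightarrow> complex" and h :: "nat \<Rightarrow> 'a"
  assumes h: "h \<longlonglongrightarrow> 0" and f: "integrable lborel f"
  shows "(\<lambda>n. LINT x|lborel. cmod (f (x - h n) - f x)) \<longlonglongrightarrow> 0"
  using f
proof (induction rule: integrable_induct)
  case (base A c)
  show ?case
  proof (rule L1_translation_approx)
    show A: "integrable lborel (\<lambda>x. indicator A x *\<^sub>R c)"
      using base by simp
    fix e :: real assume "0 < e"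
    \<comment> \<open>Chosen so that \<open>cmod c * d \<le> e\<close> holds even for
      \<open>c = 0\<close>.\<close>
    define d where "d = e / (cmod c + 1)"
    have c: "0 < cmod c + 1" by (simp add: add_nonneg_pos)
    then have d: "d > 0" "cmod c * d \<le> e"
      using \<open>0 < e\<close> by (simp_all add: d_def divide_le_eq algebra_simps)
    obtain U where U: "open U" "A \<subseteq> U" "emeasure lborel (U - A) < d"
      using outer_regular_lborel[OF _ d(1), of A] base(1) by auto
    have [measurable]: "A \<in> sets borel" "U \<in> sets borel" using base U by auto
    have "emeasure lborel U = emeasure lborel A + emeasure lborel (U - A)"
      using U(2) by (subst plus_emeasure) (auto simp: Un_absorb1)
    then have Uf: "emeasure lborel U < \<infinity>"
      using U(3) base(2) by (simp add: less_top less_trans[OF U(3) ennreal_less_top])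
    have DA: "measure lborel (U - A) \<le> d"
      using U(3) d(1) by (simp add: measure_def enn2real_leI less_imp_le)
    have "cmod (indicator A x *\<^sub>R c - indicator U x *\<^sub>R c) = cmod c * indicator (U - A) x" for x
      using U(2) by (auto simp: indicator_def)
    then have "(LINT x|lborel. cmod (indicator A x *\<^sub>R c - indicator U x *\<^sub>R c)) = cmod c * measure lborel (U - A)"
      by simp
    also have "\<dots> \<le> e"
      using DA d(2) by (meson mult_left_mono norm_ge_zero order_trans)
    finally show "\<exists>g. integrable lborel g \<and> (LINT x|lborel. cmod (indicator A x *\<^sub>R c - g x)) \<le> e \<and>
       (\<lambda>n. LINT x|lborel. cmod (g (x - h n) - g x)) \<longlonglongrightarrow> 0"
      using Uf L1_translation_open[OF h U(1) Uf, of c]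
      by (intro exI[of _ "\<lambda>x. indicator U x *\<^sub>R c"]) simp
  qed
next
  case (add f g)
  have [measurable]: "f \<in> borel_measurable borel" "g \<in> borel_measurable borel"
    using add by (auto dest: borel_measurable_integrable)
  have tr: "integrable lborel (\<lambda>x. f (x - h n))" "integrable lborel (\<lambda>x. g (x - h n))" for n
    using add by (simp_all add: lborel_integral_translate)
  show ?case
  proof (rule Lim_null_comparison)
    show "(\<lambda>n. (LINT x|lborel. cmod (f (x - h n) - f x)) + (LINT x|lborel. cmod (g (x - h n) - g x))) \<longlonglongrightarrow> 0"
      using tendsto_add[OF add.IH] by simp
    have "(LINT x|lborel. cmod (f (x - h n) + g (x - h n) - (f x + g x))) \<le>
        (LINT x|lborel. cmod (f (x - h n) - f x) + cmod (g (x - h n) - g x))" for n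
      using add tr[of n]
      by (intro integral_mono) (auto simp: add_diff_add intro: norm_triangle_ineq)
    then show "\<forall>\<^sub>F n in sequentially. norm (LINT x|lborel. cmod (f (x - h n) + g (x - h n) - (f x + g x))) \<le>
        (LINT x|lborel. cmod (f (x - h n) - f x)) + (LINT x|lborel. cmod (g (x - h n) - g x))"
      using add tr by simp
  qed
next
  case (lim f s)
  show ?case
  proof (rule L1_translation_approx[OF lim.hyps(4)])
    fix e :: real assume "0 < e"
    have "(\<lambda>i. LINT x|lborel. cmod (f x - s i x)) \<longlonglongrightarrow> (LINT x::'a|lborel. (0::real))"
    \<comment> \<open>The simple functions satisfy \<open>cmod (s i x) \<le> 2 * cmod (f x)\<close>,
      whence the factor 3.\<close>
    proof (rule integral_dominated_convergence[where w="\<lambda>x. 3 * cmod (f x)"])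
      show "AE x in lborel. (\<lambda>i. cmod (f x - s i x)) \<longlonglongrightarrow> 0"
        using lim.hyps(2) by (auto intro!: AE_I2 tendsto_eq_intros)
      show "AE x in lborel. norm (cmod (f x - s i x)) \<le> 3 * cmod (f x)" for i
      proof (rule AE_I2)
        fix x
        show "norm (cmod (f x - s i x)) \<le> 3 * cmod (f x)"
          using lim.hyps(3)[of x i] norm_triangle_ineq4[of "f x" "s i x"] by simp
      qed
    qed (use lim.hyps in auto)
    then obtain i where "norm ((LINT x|lborel. cmod (f x - s i x)) - 0) < e"
      using LIMSEQ_D[of _ 0 e] \<open>0 < e\<close> by fastforce
    then show "\<exists>g. integrable lborel g \<and> (LINT x|lborel. cmod (f x - g x)) \<le> e \<and>
       (\<lambda>n. LINT x|lborel. cmod (g (x - h n) - g x)) \<longlonglongrightarrow> 0"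
      using lim.hyps(1) lim.IH by (intro exI[of _ "s i"]) auto
  qed
qed

section \<open>Plancherel theorem for bounded integrable functions\<close>

lemma fourier_integrand_integrable:
  assumes "integrable lborel f"
  shows "integrable lborel (\<lambda>x. f x * cis (- 2 * pi * (x \<bullet> \<xi>)))"
proof (rule Bochner_Integration.integrable_bound[OF assms])
  have [measurable]: "f \<in> borel_measurable borel" using borel_measurable_integrable[OF assms] by simp
  show "(\<lambda>x. f x * cis (- 2 * pi * (x \<bullet> \<xi>))) \<in> borel_measurable lborel"
    by measurable
qed (simp add: norm_mult)

lemma fourier_integral_measurable [measurable]:
  assumes "integrable lborel f"
  shows "fourier_integral f \<in> borel_measurable borel"
proof -
  have [measurable]: "f \<in> borel_measurable borel" using borel_measurable_integrable[OF assms] by simp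
  have "(\<lambda>(\<xi>, x). f x * cis (- 2 * pi * (x \<bullet> \<xi>))) \<in> borel_measurable (borel \<Otimes>\<^sub>M lborel)"
    by measurable
  from sigma_finite_measure.borel_measurable_lebesgue_integral[OF sigma_finite_lborel this]
  show ?thesis unfolding fourier_integral_def[abs_def] by simp
qed

lemma fourier_integral_bound:
  assumes "integrable lborel f"
  shows "cmod (fourier_integral f \<xi>) \<le> (LINT x|lborel. cmod (f x))"
  unfolding fourier_integral_def
  by (rule order_trans[OF integral_norm_bound]) (simp add: norm_mult)

lemma fourier_integral_add:
  assumes "integrable lborel f" "integrable lborel g"
  shows "fourier_integral (\<lambda>x. f x + g x) \<xi> = fourier_integral f \<xi> + fourier_integral g \<xi>"
  unfolding fourier_integral_def distrib_right
  by (rule Bochner_Integration.integral_add; rule fourier_integrand_integrable; rule assms)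

lemma fourier_integral_scale: "fourier_integral (\<lambda>x. c * f x) \<xi> = c * fourier_integral f \<xi>"
  unfolding fourier_integral_def mult.assoc by (rule integral_mult_right_zero)

lemma fourier_integral_diff:
  assumes "integrable lborel f" "integrable lborel g"
  shows "fourier_integral (\<lambda>x. f x - g x) \<xi> = fourier_integral f \<xi> - fourier_integral g \<xi>"
  using fourier_integral_add[OF assms(1) integrable_mult_right[OF assms(2), of "-1"], of \<xi>]
    fourier_integral_scale[of "-1" g \<xi>] by simp

lemma integrable_lborel_times:
  fixes f :: "'a::euclidean_space \<Rightarrow> complex" and g :: "'b::euclidean_space \<Rightarrow> complex"
  assumes f: "integrable lborel f" and g: "integrable lborel g"
  shows "integrable (lborel \<Otimes>\<^sub>M lborel) (\<lambda>(x, y). f x * g y)"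
proof -
  have [measurable]: "f \<in> borel_measurable borel" "g \<in> borel_measurable borel"
    using assms by (auto dest: borel_measurable_integrable)
  show ?thesis
  proof (rule lborel_pair.Fubini_integrable)
    show "integrable lborel (\<lambda>x. LINT y|lborel. norm (case (x, y) of (x, y) \<Rightarrow> f x * g y))"
      using f by (simp add: norm_mult)
  qed (use f g in auto)
qed

text \<open>Fubini for a kernel that is symmetric in its two variables. Both the Gaussian averaging
  and the surjectivity of the transform rest on this identity.\<close>

lemma fourier_integral_multiplication:
  fixes f g :: "'a::euclidean_space \<Rightarrow> complex"
  assumes f: "integrable lborel f" and g: "integrable lborel g"
  shows "(LINT \<xi>|lborel. fourier_integral f \<xi> * g \<xi>) = (LINT x|lborel. f x * fourier_integral g x)"
proof -
  have [measurable]: "f \<in> borel_measurable borel" "g \<in> borel_measurable borel"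
    using assms by (auto dest: borel_measurable_integrable)
  let ?k = "\<lambda>x \<xi>. f x * g \<xi> * cis (- 2 * pi * (x \<bullet> \<xi>))"
  have "integrable (lborel \<Otimes>\<^sub>M lborel) (\<lambda>(x, \<xi>). ?k x \<xi>)"
  proof (rule Bochner_Integration.integrable_bound[OF integrable_lborel_times[OF f g]])
    show "(\<lambda>(x, \<xi>). ?k x \<xi>) \<in> borel_measurable (lborel \<Otimes>\<^sub>M lborel)"
      by measurable
  qed (auto simp: norm_mult)
  from lborel_pair.Fubini_integral[OF this]
  have "(LINT \<xi>|lborel. LINT x|lborel. ?k x \<xi>) = (LINT x|lborel. LINT \<xi>|lborel. ?k x \<xi>)" .
  moreover have "(LINT x|lborel. ?k x \<xi>) = fourier_integral f \<xi> * g \<xi>" for \<xi>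
    unfolding fourier_integral_def integral_mult_left_zero[symmetric]
    by (intro Bochner_Integration.integral_cong) (simp_all add: mult_ac)
  moreover have "(LINT \<xi>|lborel. ?k x \<xi>) = f x * fourier_integral g x" for x
    unfolding fourier_integral_def integral_mult_right_zero[symmetric]
    by (intro Bochner_Integration.integral_cong) (simp_all add: mult_ac inner_commute)
  ultimately show ?thesis by simp
qed

text \<open>For small \<open>e\<close> a wide Gaussian in frequency turns into a tall and narrow one
  of mass 1, that is, an approximate identity at 0.\<close>

lemma fourier_integral_gaussian_scaled:
  fixes z :: "'a::euclidean_space"
  assumes "e > 0"
  shows "fourier_integral (\<lambda>\<xi>. complex_of_real (gaussian (e *\<^sub>R \<xi>))) z = of_real (inverse e ^ DIM('a) * gaussian (inverse e *\<^sub>R z))"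
proof -
  have "fourier_integral (\<lambda>\<xi>. complex_of_real (gaussian (e *\<^sub>R \<xi>))) z =
     \<bar>inverse e\<bar> ^ DIM('a) *\<^sub>R (LINT \<eta>|lborel. complex_of_real (gaussian (e *\<^sub>R (0 + inverse e *\<^sub>R \<eta>))) *
        cis (- 2 * pi * ((0 + inverse e *\<^sub>R \<eta>) \<bullet> z)))"
    unfolding fourier_integral_def using assms
    by (intro lborel_integral_affine) (auto intro!: borel_measurable_continuous_onI continuous_intros simp: gaussian_def)
  also have "\<dots> = inverse e ^ DIM('a) *\<^sub>R (LINT \<eta>|lborel. complex_of_real (gaussian \<eta>) * cis (- 2 * pi * (\<eta> \<bullet> (inverse e *\<^sub>R z))))"
    using assms by simp
  finally show ?thesis
    by (simp only: gaussian_fourier) (simp add: scaleR_conv_of_real)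
qed

text \<open>This is \<open>u\<close> convolved with its reflected conjugate, so that its value at 0
  is the squared norm of \<open>u\<close>.\<close>

definition autocorrelation :: "('a::euclidean_space \<Rightarrow> complex) \<Rightarrow> 'a \<Rightarrow> complex" where
  "autocorrelation u z = (LINT x|lborel. u x * cnj (u (x - z)))"

text \<open>For fixed \<open>x\<close> the map \<open>z \<mapsto> x - z\<close> preserves Lebesgue
  measure, so the iterated integral of the modulus is the square of the L1 norm.\<close>

lemma autocorrelation_kernel_integrable:
  fixes u :: "'a::euclidean_space \<Rightarrow> complex"
  assumes u: "integrable lborel u"
  shows "integrable (lborel \<Otimes>\<^sub>M lborel) (\<lambda>(x, z). u x * cnj (u (x - z)))"
proof -
  have [measurable]: "u \<in> borel_measurable borel" using u by (auto dest: borel_measurable_integrable)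
  have 1: "(LINT z|lborel. cmod (u (x - z))) = (LINT z|lborel. cmod (u z))" for x
    using lborel_integral_affine(1)[of "-1" "\<lambda>y. cmod (u y)" x] by simp
  have 2: "integrable lborel (\<lambda>z. u (x - z))" for x
    using lborel_integral_affine(2)[of "-1" u x] u by simp
  show ?thesis
  proof (rule lborel_pair.Fubini_integrable)
    show "(\<lambda>(x, z). u x * cnj (u (x - z))) \<in> borel_measurable (lborel \<Otimes>\<^sub>M lborel)"
      by measurable
    show "integrable lborel (\<lambda>x. LINT z|lborel. norm (case (x, z) of (x, z) \<Rightarrow> u x * cnj (u (x - z))))"
      using u by (simp add: norm_mult 1)
    show "AE x in lborel. integrable lborel (\<lambda>z. case (x, z) of (x, z) \<Rightarrow> u x * cnj (u (x - z)))"
      using 2 by (auto intro!: AE_I2 integrable_cnj)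
  qed
qed

lemma autocorrelation_integrable:
  assumes u: "integrable lborel u"
  shows "integrable lborel (autocorrelation u)"
  unfolding autocorrelation_def[abs_def]
  by (rule lborel_pair.integrable_snd[OF autocorrelation_kernel_integrable[OF u]])

text \<open>The convolution theorem: after Fubini, the substitution \<open>y = x - z\<close> splits
  the phase into one factor for \<open>x\<close> and a conjugate one for \<open>y\<close>.\<close>

lemma fourier_integral_autocorrelation:
  fixes u :: "'a::euclidean_space \<Rightarrow> complex"
  assumes u: "integrable lborel u"
  shows "fourier_integral (autocorrelation u) \<xi> = fourier_integral u \<xi> * cnj (fourier_integral u \<xi>)"
proof -
  have [measurable]: "u \<in> borel_measurable borel" using u by (auto dest: borel_measurable_integrable)
  let ?k = "\<lambda>x z. u x * cnj (u (x - z)) * cis (- 2 * pi * (z \<bullet> \<xi>))"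
  have "integrable (lborel \<Otimes>\<^sub>M lborel) (\<lambda>(x, z). ?k x z)"
  proof (rule Bochner_Integration.integrable_bound[OF autocorrelation_kernel_integrable[OF u]])
    show "(\<lambda>(x, z). ?k x z) \<in> borel_measurable (lborel \<Otimes>\<^sub>M lborel)"
      by measurable
  qed (auto simp: norm_mult)
  from lborel_pair.Fubini_integral[OF this]
  have "(LINT z|lborel. LINT x|lborel. ?k x z) = (LINT x|lborel. LINT z|lborel. ?k x z)" .
  moreover have "(LINT x|lborel. ?k x z) = autocorrelation u z * cis (- 2 * pi * (z \<bullet> \<xi>))" for z
    unfolding autocorrelation_def by simp
  moreover have "(LINT z|lborel. ?k x z) = u x * cis (- 2 * pi * (x \<bullet> \<xi>)) * cnj (fourier_integral u \<xi>)" for x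
  proof -
    have "(LINT z|lborel. cnj (u (x - z)) * cis (- 2 * pi * (z \<bullet> \<xi>))) =
        (LINT y|lborel. cnj (u y) * cis (- 2 * pi * ((x - y) \<bullet> \<xi>)))"
      using lborel_integral_affine(1)[of "-1" "\<lambda>z. cnj (u (x - z)) * cis (- 2 * pi * (z \<bullet> \<xi>))" x] by simp
    also have "\<dots> = (LINT y|lborel. cis (- 2 * pi * (x \<bullet> \<xi>)) * cnj (u y * cis (- 2 * pi * (y \<bullet> \<xi>))))"
      by (intro Bochner_Integration.integral_cong)
         (simp_all add: cis_cnj cis_mult inner_diff_left algebra_simps)
    also have "\<dots> = cis (- 2 * pi * (x \<bullet> \<xi>)) * cnj (fourier_integral u \<xi>)"
      unfolding fourier_integral_def
      by (simp only: integral_mult_right_zero Bochner_Integration.integral_cnj)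
    finally show ?thesis by (simp add: mult.assoc)
  qed
  ultimately show ?thesis
    unfolding fourier_integral_def[of "autocorrelation u"] fourier_integral_def[of u] by simp
qed

text \<open>The bound on \<open>u\<close> pulls one factor out and leaves the L1 distance between
  \<open>u\<close> and its translate. This is the reason for treating bounded functions
  first.\<close>

lemma autocorrelation_tendsto:
  fixes u :: "'a::euclidean_space \<Rightarrow> complex" and h :: "nat \<Rightarrow> 'a"
  assumes u: "integrable lborel u" and B: "\<And>x. cmod (u x) \<le> B" and h: "h \<longlonglongrightarrow> 0"
  shows "(\<lambda>n. autocorrelation u (h n)) \<longlonglongrightarrow> autocorrelation u 0"
proof (rule LIM_zero_cancel, rule Lim_null_comparison)
  have [measurable]: "u \<in> borel_measurable borel" using u by (auto dest: borel_measurable_integrable)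
  have "0 \<le> B" using B norm_ge_zero order_trans by blast
  have tr: "integrable lborel (\<lambda>x. u (x - h n))" for n
    using u by (simp add: lborel_integral_translate)
  have pr: "integrable lborel (\<lambda>x. u x * cnj (u (x - h)))" for h
    by (rule Bochner_Integration.integrable_bound[OF integrable_mult_right[OF integrable_norm[OF u], of B]])
       (auto simp: norm_mult mult.commute[of B] \<open>0 \<le> B\<close> intro!: AE_I2 mult_left_mono B)
  show "\<forall>\<^sub>F n in sequentially. norm (autocorrelation u (h n) - autocorrelation u 0) \<le> B * (LINT x|lborel. cmod (u (x - h n) - u x))"
  proof (rule always_eventually, rule allI)
    fix n
    have "autocorrelation u (h n) - autocorrelation u 0 = (LINT x|lborel. u x * cnj (u (x - h n)) - u x * cnj (u (x - 0)))"
      unfolding autocorrelation_def by (rule Bochner_Integration.integral_diff[symmetric, OF pr pr])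
    also have "norm \<dots> \<le> (LINT x|lborel. norm (u x * cnj (u (x - h n)) - u x * cnj (u (x - 0))))"
      by (rule integral_norm_bound)
    also have "\<dots> \<le> (LINT x|lborel. B * cmod (u (x - h n) - u x))"
    proof (rule integral_mono)
      show "norm (u x * cnj (u (x - h n)) - u x * cnj (u (x - 0))) \<le> B * cmod (u (x - h n) - u x)" for x
      proof -
        have "u x * cnj (u (x - h n)) - u x * cnj (u (x - 0)) = u x * cnj (u (x - h n) - u x)"
          by (simp add: algebra_simps)
        then show ?thesis by (simp only: norm_mult complex_mod_cnj) (intro mult_right_mono B norm_ge_zero)
      qed
    qed (use integrable_norm[OF Bochner_Integration.integrable_diff[OF pr[of "h n"] pr[of 0]]] tr u in auto)
    finally show "norm (autocorrelation u (h n) - autocorrelation u 0) \<le> B * (LINT x|lborel. cmod (u (x - h n) - u x))"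
      by simp
  qed
  show "(\<lambda>n. B * (LINT x|lborel. cmod (u (x - h n) - u x))) \<longlonglongrightarrow> 0"
    using tendsto_mult_left[OF L1_translation[OF h u], of B] by simp
qed

lemma autocorrelation_bound:
  fixes u :: "'a::euclidean_space \<Rightarrow> complex"
  assumes u: "integrable lborel u" and B: "\<And>x. cmod (u x) \<le> B"
  shows "cmod (autocorrelation u h) \<le> B * (LINT x|lborel. cmod (u x))"
proof -
  have [measurable]: "u \<in> borel_measurable borel" using u by (auto dest: borel_measurable_integrable)
  have "0 \<le> B" using B norm_ge_zero order_trans by blast
  have pr: "integrable lborel (\<lambda>x. u x * cnj (u (x - h)))"
    by (rule Bochner_Integration.integrable_bound[OF integrable_mult_right[OF integrable_norm[OF u], of B]])
       (auto simp: norm_mult mult.commute[of B] \<open>0 \<le> B\<close> intro!: AE_I2 mult_left_mono B)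
  have "cmod (autocorrelation u h) \<le> (LINT x|lborel. cmod (u x * cnj (u (x - h))))"
    unfolding autocorrelation_def by (rule integral_norm_bound)
  also have "\<dots> \<le> (LINT x|lborel. B * cmod (u x))"
    by (rule integral_mono)
       (use integrable_norm[OF pr] u in \<open>auto simp: norm_mult mult.commute[of B] intro!: mult_left_mono B\<close>)
  finally show ?thesis by simp
qed

text \<open>The transform of the autocorrelation \<open>A\<close> of \<open>u\<close> is the squared modulus of the transform of
  \<open>u\<close>. Integrating it against the Gaussians of scale \<open>1 / e n\<close> averages \<open>A\<close> around \<open>0\<close>, where \<open>A\<close> is
  continuous with value \<open>\<parallel>u\<parallel>\<^sup>2\<close>.\<close>

lemma Plancherel_bounded:
  fixes u :: "'a::euclidean_space \<Rightarrow> complex"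
  assumes u: "integrable lborel u" and B: "\<And>x. cmod (u x) \<le> B"
  shows "fourier_integral u \<in> L2" "l2_norm (fourier_integral u) = l2_norm u"
proof -
  note [measurable] = fourier_integral_measurable[OF u]
  \<comment> \<open>A decreasing sequence, not just a null sequence: the Gaussian factors then
    increase with \<open>n\<close>, as monotone convergence will require.\<close>
  define e where "e n = inverse (real (Suc n))" for n
  have e: "e n > 0" "decseq e" "e \<longlonglongrightarrow> 0" for n
    unfolding e_def using LIMSEQ_inverse_real_of_nat
    by (auto simp: decseq_def field_simps)
  let ?A = "autocorrelation u"
  let ?f = "\<lambda>n \<xi>. (cmod (fourier_integral u \<xi>))\<^sup>2 * gaussian (e n *\<^sub>R \<xi>)"
  have Ai: "integrable lborel ?A" by (rule autocorrelation_integrable[OF u])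
  note [measurable] = borel_measurable_integrable[OF Ai, simplified]
  have gi: "integrable lborel (\<lambda>\<xi>::'a. gaussian (e n *\<^sub>R \<xi>))" for n
    using lborel_integral_affine(2)[of "e n" "gaussian :: 'a \<Rightarrow> real" 0] gaussian_integrable e(1)[of n] by simp
  \<comment> \<open>The transform is bounded by the L1 norm of \<open>u\<close>, so the Gaussian
    factor suffices for integrability.\<close>
  have fi: "integrable lborel (?f n)" for n
  proof (rule Bochner_Integration.integrable_bound[OF integrable_mult_right[OF gi[of n], of "(LINT x|lborel. cmod (u x))\<^sup>2"]])
    show "AE \<xi> in lborel. norm (?f n \<xi>) \<le> norm ((LINT x|lborel. cmod (u x))\<^sup>2 * gaussian (e n *\<^sub>R \<xi>))"
      using gaussian_bounds(1) fourier_integral_bound[OF u]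
      by (intro AE_I2) (auto simp: abs_mult less_imp_le intro!: mult_right_mono power_mono)
  qed measurable
  have int: "complex_of_real (LINT \<xi>|lborel. ?f n \<xi>) = (LINT z|lborel. ?A (e n *\<^sub>R z) * of_real (gaussian z))" for n
  proof -
    have "complex_of_real (LINT \<xi>|lborel. ?f n \<xi>) = (LINT \<xi>|lborel. fourier_integral ?A \<xi> * of_real (gaussian (e n *\<^sub>R \<xi>)))"
      unfolding fourier_integral_autocorrelation[OF u] complex_norm_square[symmetric]
      by (simp flip: integral_complex_of_real)
    also have "\<dots> = (LINT z|lborel. ?A z * of_real (inverse (e n) ^ DIM('a) * gaussian (inverse (e n) *\<^sub>R z)))"
      unfolding fourier_integral_gaussian_scaled[OF e(1), symmetric]
      by (rule fourier_integral_multiplication[OF Ai]) (use gi in simp)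
    \<comment> \<open>The Jacobian cancels the height of the narrow Gaussian; the scale survives
      only inside the argument of \<open>?A\<close>.\<close>
    also have "\<dots> = \<bar>e n\<bar> ^ DIM('a) *\<^sub>R (LINT z|lborel. ?A (0 + e n *\<^sub>R z) * of_real (inverse (e n) ^ DIM('a) * gaussian (inverse (e n) *\<^sub>R (0 + e n *\<^sub>R z))))"
      using e(1)[of n] by (intro lborel_integral_affine) auto
    also have "\<dots> = (LINT z|lborel. ?A (e n *\<^sub>R z) * of_real (gaussian z))"
      unfolding integral_scaleR_right[symmetric] using e(1)[of n]
      by (intro Bochner_Integration.integral_cong) (simp_all add: scaleR_conv_of_real power_inverse)
    finally show ?thesis .
  qed
  have "(\<lambda>n. LINT z::'a|lborel. ?A (e n *\<^sub>R z) * of_real (gaussian z)) \<longlonglongrightarrow> (LINT z::'a|lborel. ?A 0 * of_real (gaussian z))"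
  proof (rule integral_dominated_convergence[where w="\<lambda>z. B * (LINT x|lborel. cmod (u x)) * gaussian z"])
    show "AE z in lborel. (\<lambda>n. ?A (e n *\<^sub>R z) * of_real (gaussian z)) \<longlonglongrightarrow> ?A 0 * of_real (gaussian z)"
    proof (rule AE_I2)
      fix z :: 'a
      have "(\<lambda>n. e n *\<^sub>R z) \<longlonglongrightarrow> 0 *\<^sub>R z" by (intro tendsto_intros e)
      then show "(\<lambda>n. ?A (e n *\<^sub>R z) * of_real (gaussian z)) \<longlonglongrightarrow> ?A 0 * of_real (gaussian z)"
        by (intro tendsto_intros autocorrelation_tendsto[OF u B]) simp
    qed
    show "AE z in lborel. norm (?A (e n *\<^sub>R z) * of_real (gaussian z)) \<le> B * (LINT x|lborel. cmod (u x)) * gaussian z" for n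
      using autocorrelation_bound[OF u B]
      by (intro AE_I2) (simp add: norm_mult gaussian_def mult_right_mono)
  qed (use gaussian_integrable in auto)
  also have "(LINT z::'a|lborel. ?A 0 * of_real (gaussian z)) = ?A 0"
    by (simp add: gaussian_integral)
  also have "?A 0 = complex_of_real ((l2_norm u)\<^sup>2)"
    unfolding autocorrelation_def l2_inner_self[symmetric] l2_inner_def by simp
  finally have lim: "(\<lambda>n. LINT \<xi>|lborel. ?f n \<xi>) \<longlonglongrightarrow> (l2_norm u)\<^sup>2"
    unfolding int[symmetric] tendsto_of_real_iff .
  have mono: "AE \<xi> in lborel. mono (\<lambda>n. ?f n \<xi>)"
  proof (intro AE_I2 monoI mult_left_mono)
    fix \<xi> :: 'a and m n :: nat assume "m \<le> n"
    then have "e n * e n \<le> e m * e m"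
      using e(1)[of m] e(1)[of n] e(2) by (intro mult_mono) (auto simp: decseq_def less_imp_le)
    then have "e n * e n * (\<xi> \<bullet> \<xi>) \<le> e m * e m * (\<xi> \<bullet> \<xi>)"
      by (rule mult_right_mono) simp
    then show "gaussian (e m *\<^sub>R \<xi>) \<le> gaussian (e n *\<^sub>R \<xi>)"
      by (simp add: gaussian_def mult.assoc)
  qed simp
  have ptw: "AE \<xi> in lborel. (\<lambda>n. ?f n \<xi>) \<longlonglongrightarrow> (cmod (fourier_integral u \<xi>))\<^sup>2"
  proof (rule AE_I2)
    fix \<xi> :: 'a
    have "(\<lambda>n. (cmod (fourier_integral u \<xi>))\<^sup>2 * exp (- pi * ((e n *\<^sub>R \<xi>) \<bullet> (e n *\<^sub>R \<xi>)))) \<longlonglongrightarrow>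
        (cmod (fourier_integral u \<xi>))\<^sup>2 * exp (- pi * ((0 *\<^sub>R \<xi>) \<bullet> (0 *\<^sub>R \<xi>)))"
      by (intro tendsto_intros e)
    then show "(\<lambda>n. ?f n \<xi>) \<longlonglongrightarrow> (cmod (fourier_integral u \<xi>))\<^sup>2"
      by (simp add: gaussian_def)
  qed
  have nn: "AE \<xi> in lborel. 0 \<le> ?f n \<xi>" for n
    by (simp add: gaussian_def)
  \<comment> \<open>Both conclusions at once: the increasing integrals converge by
    \<open>lim\<close>, hence the limit function is integrable and its integral is that
    limit.\<close>
  note mc = integral_monotone_convergence_nonneg[OF fi mono nn ptw lim]
  show "fourier_integral u \<in> L2"
    by (rule L2I, measurable, rule mc(1)) measurable
  have "(l2_norm (fourier_integral u))\<^sup>2 = (l2_norm u)\<^sup>2"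
    unfolding l2_norm_power2[of "fourier_integral u"] by (rule mc(2)) measurable
  then show "l2_norm (fourier_integral u) = l2_norm u"
    by (simp add: power2_eq_iff_nonneg)
qed

section \<open>The unitary Fourier transform\<close>

lemma l2_tendsto_dominated:
  fixes f :: "'a::euclidean_space \<Rightarrow> complex"
  assumes f: "f \<in> L2" and [measurable]: "\<And>n. u n \<in> borel_measurable borel"
    and le: "\<And>n x. cmod (u n x) \<le> cmod (f x)" and lim: "\<And>x. (\<lambda>n. u n x) \<longlonglongrightarrow> f x"
  shows "l2_tendsto u f"
proof -
  note [measurable] = L2_measurable[OF f]
  have "(\<lambda>n. LINT x|lborel. (cmod (u n x - f x))\<^sup>2) \<longlonglongrightarrow> (LINT x::'a|lborel. 0)"
  proof (rule integral_dominated_convergence[where w="\<lambda>x. 4 * (cmod (f x))\<^sup>2"])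
    show "AE x in lborel. (\<lambda>n. (cmod (u n x - f x))\<^sup>2) \<longlonglongrightarrow> 0"
      using lim by (intro AE_I2) (auto intro!: tendsto_eq_intros)
    show "AE x in lborel. norm ((cmod (u n x - f x))\<^sup>2) \<le> 4 * (cmod (f x))\<^sup>2" for n
    proof (rule AE_I2)
      fix x
      have "cmod (u n x - f x) \<le> 2 * cmod (f x)"
        using norm_triangle_ineq4[of "u n x" "f x"] le[of n x] by simp
      from power_mono[OF this, of 2] show "norm ((cmod (u n x - f x))\<^sup>2) \<le> 4 * (cmod (f x))\<^sup>2"
        by (simp add: power_mult_distrib)
    qed
  qed (use L2_integrable[OF f] in auto)
  then have "(\<lambda>n. sqrt (LINT x|lborel. (cmod (u n x - f x))\<^sup>2)) \<longlonglongrightarrow> sqrt 0"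
    by (intro tendsto_real_sqrt) simp
  then show ?thesis unfolding l2_tendsto_def l2_norm_def by simp
qed

lemma l2_tendsto_Cauchy:
  assumes u: "\<And>n. u n \<in> L2" and f: "f \<in> L2" and lim: "l2_tendsto u f" and e: "0 < e"
  shows "\<exists>N. \<forall>m\<ge>N. \<forall>n\<ge>N. l2_norm (\<lambda>x. u m x - u n x) < e"
proof -
  obtain N where N: "\<And>n. n \<ge> N \<Longrightarrow> l2_norm (\<lambda>x. u n x - f x) < e / 2"
    using LIMSEQ_D[OF lim[unfolded l2_tendsto_def], of "e / 2"] e by auto
  have "l2_norm (\<lambda>x. u m x - u n x) < e" if "m \<ge> N" "n \<ge> N" for m n
    using l2_norm_triangle_diff[OF u[of m] f u[of n]] N[OF that(1)] N[OF that(2)]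
    by (simp add: l2_norm_minus_commute[of f])
  then show ?thesis by blast
qed

lemma l2_norm_mono:
  assumes "f \<in> L2" "g \<in> borel_measurable borel" "\<And>x. cmod (g x) \<le> cmod (f x)"
  shows "l2_norm g \<le> l2_norm f"
  unfolding l2_norm_def
  using L2_integrable[OF assms(1)] L2_integrable[OF L2_dominated[OF assms]] assms(3)
  by (intro real_sqrt_le_mono integral_mono) (auto intro: power_mono)

text \<open>Truncating large values makes the function bounded. Fatou then yields only an inequality
  of norms, but applied to the truncation errors it makes the transforms converge, and the equality
  of norms passes to the limit.\<close>

lemma Plancherel_L1_L2:
  fixes u :: "'a::euclidean_space \<Rightarrow> complex"
  assumes u: "integrable lborel u" "u \<in> L2"
  shows "fourier_integral u \<in> L2" "l2_norm (fourier_integral u) = l2_norm u"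
proof -
  define v where "v w n x = (if cmod (w x) \<le> real n then w x else 0)" for w :: "'a \<Rightarrow> complex" and n x
  have v_lim: "(\<lambda>n. v w n x) \<longlonglongrightarrow> w x" for w x
  proof (rule tendsto_eventually)
    obtain N where "cmod (w x) \<le> real N" using real_arch_simple by blast
    then show "\<forall>\<^sub>F n in sequentially. v w n x = w x"
      by (intro eventually_sequentiallyI[of N]) (auto simp: v_def)
  qed
  have v_le: "cmod (v w n x) \<le> cmod (w x)" for w n x by (simp add: v_def)
  have v_meas: "v w n \<in> borel_measurable borel" if [measurable]: "w \<in> borel_measurable borel" for w n
    unfolding v_def[abs_def] by measurable
  have v_int: "integrable lborel (v w n)" if w: "integrable lborel w" for w n
    by (rule Bochner_Integration.integrable_bound[OF w])
       (use v_meas[of w n] borel_measurable_integrable[OF w] v_le in auto)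
  have v_L2: "v w n \<in> L2" if w: "w \<in> L2" for w n
    by (rule L2_dominated[OF w v_meas[OF L2_measurable[OF w]] v_le])
  have v_P: "fourier_integral (v w n) \<in> L2" "l2_norm (fourier_integral (v w n)) = l2_norm (v w n)"
    if w: "integrable lborel w" for w n
    by (rule Plancherel_bounded[OF v_int[OF w], of n n]; simp add: v_def)+
  \<comment> \<open>Stated for every \<open>w\<close> because it is used for \<open>u\<close> and
    for the differences \<open>v u n - u\<close>.\<close>
  have bound: "fourier_integral w \<in> L2 \<and> l2_norm (fourier_integral w) \<le> l2_norm w"
    if w: "integrable lborel w" "w \<in> L2" for w :: "'a \<Rightarrow> complex"
  proof -
    note [measurable] = fourier_integral_measurable[OF w(1)] fourier_integral_measurable[OF v_int[OF w(1)]]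
      L2_measurable[OF w(2)] v_meas[OF L2_measurable[OF w(2)]]
    have lim: "(\<lambda>n. fourier_integral (v w n) \<xi>) \<longlonglongrightarrow> fourier_integral w \<xi>" for \<xi>
      unfolding fourier_integral_def
      by (rule integral_dominated_convergence[where w="\<lambda>x. cmod (w x)"])
         (use w(1) v_le in \<open>auto simp: norm_mult intro!: tendsto_intros v_lim\<close>)
    have "(\<integral>\<^sup>+\<xi>. ennreal ((cmod (fourier_integral w \<xi>))\<^sup>2) \<partial>lborel) =
        (\<integral>\<^sup>+\<xi>. liminf (\<lambda>n. ennreal ((cmod (fourier_integral (v w n) \<xi>))\<^sup>2)) \<partial>lborel)"
      by (intro nn_integral_cong lim_imp_Liminf[symmetric]) (auto intro!: tendsto_intros lim)
    also have "\<dots> \<le> liminf (\<lambda>n. \<integral>\<^sup>+\<xi>. ennreal ((cmod (fourier_integral (v w n) \<xi>))\<^sup>2) \<partial>lborel)"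
      by (rule nn_integral_liminf) measurable
    also have "\<dots> \<le> liminf (\<lambda>n. ennreal ((l2_norm w)\<^sup>2))"
      using l2_norm_mono[OF w(2) v_meas[OF L2_measurable[OF w(2)]] v_le]
      by (intro Liminf_mono always_eventually allI)
         (auto simp: nn_integral_l2_norm[OF v_P(1)[OF w(1)]] v_P(2)[OF w(1)] intro!: ennreal_leI power_mono)
    finally have "(\<integral>\<^sup>+\<xi>. ennreal ((cmod (fourier_integral w \<xi>))\<^sup>2) \<partial>lborel) \<le> ennreal ((l2_norm w)\<^sup>2)"
      by (simp add: Liminf_const)
    then show ?thesis
      using L2_I_nn[of "fourier_integral w" "l2_norm w"] by simp
  qed
  show L: "fourier_integral u \<in> L2" using bound[OF u] by simp
  have vu: "l2_tendsto (v u) u"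
    by (rule l2_tendsto_dominated[OF u(2) v_meas[OF L2_measurable[OF u(2)]] v_le v_lim])
  have "l2_tendsto (\<lambda>n. fourier_integral (v u n)) (fourier_integral u)"
    unfolding l2_tendsto_def
  proof (rule Lim_null_comparison)
    have "l2_norm (\<lambda>\<xi>. fourier_integral (v u n) \<xi> - fourier_integral u \<xi>) \<le> l2_norm (\<lambda>x. v u n x - u x)" for n
      using bound[OF Bochner_Integration.integrable_diff[OF v_int[OF u(1)] u(1)] L2_diff[OF v_L2[OF u(2)] u(2)], of n]
      unfolding fourier_integral_diff[OF v_int[OF u(1)] u(1), abs_def] by simp
    then show "\<forall>\<^sub>F n in sequentially. norm (l2_norm (\<lambda>\<xi>. fourier_integral (v u n) \<xi> - fourier_integral u \<xi>)) \<le>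
        l2_norm (\<lambda>x. v u n x - u x)" by simp
  qed (use vu in \<open>simp add: l2_tendsto_def\<close>)
  from l2_tendsto_norm[OF v_P(1)[OF u(1)] L this]
  have "(\<lambda>n. l2_norm (v u n)) \<longlonglongrightarrow> l2_norm (fourier_integral u)"
    by (simp add: v_P(2)[OF u(1)])
  from LIMSEQ_unique[OF this l2_tendsto_norm[OF v_L2[OF u(2)] u(2) vu]]
  show "l2_norm (fourier_integral u) = l2_norm u" .
qed

section \<open>The transform as a relation on square-integrable functions\<close>

lemma has_L2_fourierI:
  assumes "\<And>n. u n \<in> L2" "\<And>n. integrable lborel (u n)" "f \<in> L2" "F \<in> L2"
    "l2_tendsto u f" "l2_tendsto (\<lambda>n. fourier_integral (u n)) F"
  shows "has_L2_fourier f F"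
  unfolding has_L2_fourier_def using assms Plancherel_L1_L2(1) by blast

lemma has_L2_fourierE:
  assumes "has_L2_fourier f F"
  obtains u where "\<And>n. u n \<in> L2" "\<And>n. integrable lborel (u n)" "\<And>n. fourier_integral (u n) \<in> L2"
    "l2_tendsto u f" "l2_tendsto (\<lambda>n. fourier_integral (u n)) F"
  using assms unfolding has_L2_fourier_def by auto

lemma has_L2_fourier_L2: "has_L2_fourier f F \<Longrightarrow> f \<in> L2" "has_L2_fourier f F \<Longrightarrow> F \<in> L2"
  by (simp_all add: has_L2_fourier_def)

lemma has_L2_fourier_norm:
  assumes "has_L2_fourier f F"
  shows "l2_norm F = l2_norm f"
proof -
  obtain u where u: "\<And>n. u n \<in> L2" "\<And>n. integrable lborel (u n)" "\<And>n. fourier_integral (u n) \<in> L2"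
    "l2_tendsto u f" "l2_tendsto (\<lambda>n. fourier_integral (u n)) F"
    using has_L2_fourierE[OF assms] by blast
  have "(\<lambda>n. l2_norm (u n)) \<longlonglongrightarrow> l2_norm F"
    using l2_tendsto_norm[OF u(3) has_L2_fourier_L2(2)[OF assms] u(5)]
    by (simp add: Plancherel_L1_L2(2)[OF u(2,1)])
  with l2_tendsto_norm[OF u(1) has_L2_fourier_L2(1)[OF assms] u(4)] show ?thesis
    by (metis LIMSEQ_unique)
qed

lemma has_L2_fourier_add:
  assumes "has_L2_fourier f F" "has_L2_fourier g G"
  shows "has_L2_fourier (\<lambda>x. f x + g x) (\<lambda>x. F x + G x)"
proof -
  obtain u where u: "\<And>n. u n \<in> L2" "\<And>n. integrable lborel (u n)" "\<And>n. fourier_integral (u n) \<in> L2"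
    "l2_tendsto u f" "l2_tendsto (\<lambda>n. fourier_integral (u n)) F"
    using has_L2_fourierE[OF assms(1)] by blast
  obtain v where v: "\<And>n. v n \<in> L2" "\<And>n. integrable lborel (v n)" "\<And>n. fourier_integral (v n) \<in> L2"
    "l2_tendsto v g" "l2_tendsto (\<lambda>n. fourier_integral (v n)) G"
    using has_L2_fourierE[OF assms(2)] by blast
  note L = has_L2_fourier_L2[OF assms(1)] has_L2_fourier_L2[OF assms(2)]
  show ?thesis
  proof (rule has_L2_fourierI[where u="\<lambda>n x. u n x + v n x"])
    show "l2_tendsto (\<lambda>n. fourier_integral (\<lambda>x. u n x + v n x)) (\<lambda>x. F x + G x)"
      unfolding fourier_integral_add[OF u(2) v(2), abs_def]
      by (rule l2_tendsto_add[OF u(3) L(2) u(5) v(3) L(4) v(5)])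
  qed (use u v L in \<open>auto intro: L2_add l2_tendsto_add\<close>)
qed

lemma has_L2_fourier_scale:
  assumes "has_L2_fourier f F"
  shows "has_L2_fourier (\<lambda>x. c * f x) (\<lambda>x. c * F x)"
proof -
  obtain u where u: "\<And>n. u n \<in> L2" "\<And>n. integrable lborel (u n)" "\<And>n. fourier_integral (u n) \<in> L2"
    "l2_tendsto u f" "l2_tendsto (\<lambda>n. fourier_integral (u n)) F"
    using has_L2_fourierE[OF assms(1)] by blast
  show ?thesis
    by (rule has_L2_fourierI[where u="\<lambda>n x. c * u n x"])
       (use u has_L2_fourier_L2[OF assms] in \<open>auto intro: L2_scale l2_tendsto_scale simp: fourier_integral_scale[abs_def]\<close>)
qed

text \<open>Polarisation: the norm of a sum determines the real part, and multiplying one argument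
  by the imaginary unit reaches the imaginary part.\<close>

lemma has_L2_fourier_inner:
  assumes "has_L2_fourier f F" "has_L2_fourier g G"
  shows "l2_inner F G = l2_inner f g"
proof -
  have re: "Re (l2_inner F G) = Re (l2_inner f g)"
    if "has_L2_fourier f F" "has_L2_fourier g G" for f F g G :: "'a \<Rightarrow> complex"
    using has_L2_fourier_norm[OF has_L2_fourier_add[OF that]] has_L2_fourier_norm[OF that(1)] has_L2_fourier_norm[OF that(2)]
      l2_norm_add_power2[OF has_L2_fourier_L2(1)[OF that(1)] has_L2_fourier_L2(1)[OF that(2)]]
      l2_norm_add_power2[OF has_L2_fourier_L2(2)[OF that(1)] has_L2_fourier_L2(2)[OF that(2)]]
    by simp
  have "Re (l2_inner (\<lambda>x. \<i> * F x) G) = Re (l2_inner (\<lambda>x. \<i> * f x) g)"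
    by (rule re[OF has_L2_fourier_scale[OF assms(1)] assms(2)])
  with re[OF assms] show ?thesis
    by (simp add: l2_inner_scale_left complex_eq_iff)
qed

text \<open>Cutting off outside balls gives integrable functions, as products of two
  square-integrable ones. Their transforms are Cauchy by isometry and converge by
  completeness.\<close>

lemma has_L2_fourier_exists:
  fixes f :: "'a::euclidean_space \<Rightarrow> complex"
  assumes f: "f \<in> L2"
  shows "\<exists>F. has_L2_fourier f F"
proof -
  note [measurable] = L2_measurable[OF f]
  define u where "u n x = f x * of_real (indicator (cball 0 (real n)) x)" for n :: nat and x
  have [measurable]: "cball (0::'a) r \<in> sets borel" for r by simp
  have um [measurable]: "u n \<in> borel_measurable borel" for n
    unfolding u_def[abs_def] by measurable
  have ule: "cmod (u n x) \<le> cmod (f x)" for n x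
    by (simp add: u_def norm_mult indicator_def)
  have u2: "u n \<in> L2" for n
    by (rule L2_dominated[OF f um ule])
  have u1: "integrable lborel (u n)" for n
    unfolding u_def[abs_def]
  proof (rule L2_mult_integrable[OF f])
    have int: "integrable lborel (indicator (cball (0::'a) (real n)) :: 'a \<Rightarrow> real)"
      by (intro integrable_real_indicator emeasure_lborel_cball_finite) simp
    show "(\<lambda>x. complex_of_real (indicator (cball (0::'a) (real n)) x)) \<in> L2"
      by (rule L2_bound[OF _ int]) (auto simp: indicator_def)
  qed
  have uf: "l2_tendsto u f"
  proof (rule l2_tendsto_dominated[OF f um ule])
    fix x :: 'a
    obtain N where "norm x \<le> real N" using real_arch_simple by blast
    then show "(\<lambda>n. u n x) \<longlonglongrightarrow> f x"
      by (intro tendsto_eventually eventually_sequentiallyI[of N]) (auto simp: u_def indicator_def)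
  qed
  have eq: "l2_norm (\<lambda>x. fourier_integral (u m) x - fourier_integral (u n) x) = l2_norm (\<lambda>x. u m x - u n x)" for m n
    using Plancherel_L1_L2(2)[OF Bochner_Integration.integrable_diff[OF u1 u1] L2_diff[OF u2 u2], of m n]
    unfolding fourier_integral_diff[OF u1 u1, abs_def] .
  obtain F where "F \<in> L2" "l2_tendsto (\<lambda>n. fourier_integral (u n)) F"
  proof (rule L2_complete[of "\<lambda>n. fourier_integral (u n)"])
    show "fourier_integral (u n) \<in> L2" for n by (rule Plancherel_L1_L2[OF u1 u2])
  qed (use l2_tendsto_Cauchy[OF u2 f uf] in \<open>auto simp: eq\<close>)
  then show ?thesis using has_L2_fourierI[OF u2 u1 f _ uf] by blast
qed

lemma l2_norm_cnj: "l2_norm (\<lambda>x. cnj (f x)) = l2_norm f"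
  by (simp add: l2_norm_def)

lemma l2_tendsto_cnj: "l2_tendsto u f \<Longrightarrow> l2_tendsto (\<lambda>n x. cnj (u n x)) (\<lambda>x. cnj (f x))"
  unfolding l2_tendsto_def complex_cnj_diff[symmetric] l2_norm_cnj .

text \<open>The extra conjugates cancel those inside \<open>l2_inner\<close>, so both sides are the
  bilinear integrals of the formula for integrable functions, which is continuous under mean
  convergence.\<close>

lemma has_L2_fourier_multiplication:
  assumes "has_L2_fourier f F" "has_L2_fourier g G"
  shows "l2_inner F (\<lambda>x. cnj (g x)) = l2_inner f (\<lambda>x. cnj (G x))"
proof -
  obtain u where u: "\<And>n. u n \<in> L2" "\<And>n. integrable lborel (u n)" "\<And>n. fourier_integral (u n) \<in> L2"
    "l2_tendsto u f" "l2_tendsto (\<lambda>n. fourier_integral (u n)) F"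
    using has_L2_fourierE[OF assms(1)] by blast
  obtain v where v: "\<And>n. v n \<in> L2" "\<And>n. integrable lborel (v n)" "\<And>n. fourier_integral (v n) \<in> L2"
    "l2_tendsto v g" "l2_tendsto (\<lambda>n. fourier_integral (v n)) G"
    using has_L2_fourierE[OF assms(2)] by blast
  note L = has_L2_fourier_L2[OF assms(1)] has_L2_fourier_L2[OF assms(2)]
  have "l2_inner (fourier_integral (u n)) (\<lambda>x. cnj (v n x)) = l2_inner (u n) (\<lambda>x. cnj (fourier_integral (v n) x))" for n
    unfolding l2_inner_def complex_cnj_cnj by (rule fourier_integral_multiplication[OF u(2) v(2)])
  moreover have "(\<lambda>n. l2_inner (fourier_integral (u n)) (\<lambda>x. cnj (v n x))) \<longlonglongrightarrow> l2_inner F (\<lambda>x. cnj (g x))"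
    by (intro l2_tendsto_inner l2_tendsto_cnj L2_cnj u v L)
  moreover have "(\<lambda>n. l2_inner (u n) (\<lambda>x. cnj (fourier_integral (v n) x))) \<longlonglongrightarrow> l2_inner f (\<lambda>x. cnj (G x))"
    by (intro l2_tendsto_inner l2_tendsto_cnj L2_cnj u v L)
  ultimately show ?thesis by (simp add: LIMSEQ_unique)
qed

text \<open>Conjugating the transform of the conjugate gives a preimage: the multiplication formula
  shows that its transform \<open>H\<close> satisfies \<open>\<langle>H, F\<rangle> = \<parallel>F\<parallel>\<^sup>2\<close>, and \<open>\<parallel>H\<parallel> = \<parallel>F\<parallel>\<close>.\<close>

lemma inv_has_L2_fourier_exists:
  assumes F: "F \<in> L2"
  shows "\<exists>f. has_L2_fourier f F"
proof -
  obtain G where G: "has_L2_fourier (\<lambda>x. cnj (F x)) G"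
    using has_L2_fourier_exists[OF L2_cnj[OF F]] by blast
  note GL = has_L2_fourier_L2(2)[OF G]
  obtain H where H: "has_L2_fourier (\<lambda>x. cnj (G x)) H"
    using has_L2_fourier_exists[OF L2_cnj[OF GL]] by blast
  note HL = has_L2_fourier_L2(2)[OF H]
  have nG: "l2_norm G = l2_norm F"
    using has_L2_fourier_norm[OF G] by (simp add: l2_norm_cnj)
  have nH: "l2_norm H = l2_norm F"
    using has_L2_fourier_norm[OF H] nG by (simp add: l2_norm_cnj)
  have "l2_inner H F = l2_inner (\<lambda>x. cnj (G x)) (\<lambda>x. cnj (G x))"
    using has_L2_fourier_multiplication[OF H G] by simp
  also have "\<dots> = of_real ((l2_norm F)\<^sup>2)"
    by (simp add: l2_inner_self l2_norm_cnj nG)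
  finally have "(l2_norm (\<lambda>x. H x - F x))\<^sup>2 = 0"
    by (simp add: l2_norm_diff_power2[OF HL F] nH)
  then have HF: "l2_norm (\<lambda>x. H x - F x) = 0" by simp
  \<comment> \<open>\<open>H\<close> and \<open>F\<close> agree only almost everywhere, so the
    approximating sequence of \<open>H\<close> is reused to show that \<open>F\<close> itself is a
    transform.\<close>
  obtain u where u: "\<And>n. u n \<in> L2" "\<And>n. integrable lborel (u n)" "\<And>n. fourier_integral (u n) \<in> L2"
    "l2_tendsto u (\<lambda>x. cnj (G x))" "l2_tendsto (\<lambda>n. fourier_integral (u n)) H"
    using has_L2_fourierE[OF H] by blast
  have "l2_tendsto (\<lambda>n. fourier_integral (u n)) F"
    unfolding l2_tendsto_def
  proof (rule Lim_null_comparison)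
    show "\<forall>\<^sub>F n in sequentially. norm (l2_norm (\<lambda>x. fourier_integral (u n) x - F x)) \<le>
        l2_norm (\<lambda>x. fourier_integral (u n) x - H x)"
      using l2_norm_triangle_diff[OF u(3) HL F] HF by (intro always_eventually allI) simp
  qed (use u(5) in \<open>simp add: l2_tendsto_def\<close>)
  then have "has_L2_fourier (\<lambda>x. cnj (G x)) F"
    by (rule has_L2_fourierI[OF u(1,2) L2_cnj[OF GL] F u(4)])
  then show ?thesis by blast
qed

text \<open>Together with its companion for the inverse, all that is ever used about the chosen
  transforms; no particular representative matters.\<close>

lemma has_L2_fourier_L2_fourier: "f \<in> L2 \<Longrightarrow> has_L2_fourier f (L2_fourier f)"
  unfolding L2_fourier_def by (rule someI_ex[OF has_L2_fourier_exists])

lemma has_L2_fourier_inv_L2_fourier: "F \<in> L2 \<Longrightarrow> has_L2_fourier (inv_L2_fourier F) F"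
  unfolding inv_L2_fourier_def by (rule someI_ex[OF inv_has_L2_fourier_exists])

section \<open>Normalised dilations and translations of the line\<close>

definition affine_dilation :: "real \<Rightarrow> real \<Rightarrow> (real \<Rightarrow> complex) \<Rightarrow> real \<Rightarrow> complex" where
  "affine_dilation a t f x = of_real (sqrt a) * f (a * x + t)"

lemma affine_dilation_inner:
  assumes "0 < a" "f \<in> borel_measurable borel" "g \<in> borel_measurable borel"
  shows "l2_inner (affine_dilation a t f) (affine_dilation a t g) = l2_inner f g"
proof -
  note [measurable] = assms(2,3)
  have "l2_inner f g = \<bar>a\<bar> ^ DIM(real) *\<^sub>R (LINT x|lborel. f (t + a *\<^sub>R x) * cnj (g (t + a *\<^sub>R x)))"
    unfolding l2_inner_def using assms(1) by (intro lborel_integral_affine) auto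
  also have "\<dots> = (LINT x|lborel. affine_dilation a t f x * cnj (affine_dilation a t g x))"
    unfolding integral_scaleR_right[symmetric]
  proof (intro Bochner_Integration.integral_cong refl)
    fix x :: real
    have "complex_of_real a = of_real (sqrt a) * of_real (sqrt a)"
      using assms(1) by (simp flip: of_real_mult)
    then show "\<bar>a\<bar> ^ DIM(real) *\<^sub>R (f (t + a *\<^sub>R x) * cnj (g (t + a *\<^sub>R x))) =
        affine_dilation a t f x * cnj (affine_dilation a t g x)"
      using assms(1) by (simp add: affine_dilation_def scaleR_conv_of_real add.commute)
  qed
  finally show ?thesis by (simp add: l2_inner_def)
qed

lemma affine_dilation_L2:
  assumes "0 < a" "f \<in> L2"
  shows "affine_dilation a t f \<in> L2"
proof -
  note [measurable] = L2_measurable[OF assms(2)]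
  have "integrable lborel (\<lambda>x. (cmod (f (t + a *\<^sub>R x)))\<^sup>2)"
    using assms lborel_integral_affine(2)[of a "\<lambda>x. (cmod (f x))\<^sup>2" t] by (simp add: L2_integrable)
  then show ?thesis
    unfolding affine_dilation_def[abs_def]
    by (intro L2_scale L2I) (auto simp: add.commute)
qed

lemma affine_dilation_norm:
  assumes "0 < a" "f \<in> borel_measurable borel"
  shows "l2_norm (affine_dilation a t f) = l2_norm f"
  using affine_dilation_inner[OF assms assms(2), of t] by (simp add: l2_inner_self of_real_eq_iff power2_eq_iff_nonneg del: of_real_power)

lemma affine_dilation_diff:
  "affine_dilation a t (\<lambda>x. f x - g x) = (\<lambda>x. affine_dilation a t f x - affine_dilation a t g x)"
  by (simp add: affine_dilation_def[abs_def] right_diff_distrib)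

lemma affine_dilation_l2_tendsto:
  assumes "0 < a" "\<And>n. u n \<in> L2" "f \<in> L2" "l2_tendsto u f"
  shows "l2_tendsto (\<lambda>n. affine_dilation a t (u n)) (affine_dilation a t f)"
  using assms(4) unfolding l2_tendsto_def affine_dilation_diff[symmetric]
  by (simp add: affine_dilation_norm[OF assms(1) L2_measurable[OF L2_diff[OF assms(2,3)]]])

lemma L2_modulation:
  assumes "f \<in> L2"
  shows "(\<lambda>x. cis (c * x) * f x) \<in> L2"
  using L2_measurable[OF assms] by (intro L2_dominated[OF assms]) (auto simp: norm_mult)

text \<open>The reciprocal scale and the phase appear on evaluating the transform of
  \<open>u\<close> at \<open>\<xi> / a\<close> and substituting \<open>t + a x\<close>: the shift
  \<open>t\<close> contributes the phase, the Jacobian the change of normalisation.\<close>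

lemma fourier_integral_affine_dilation:
  assumes "0 < a" and [measurable]: "u \<in> borel_measurable borel"
  shows "fourier_integral (affine_dilation a t u) \<xi> = cis (2 * pi * t / a * \<xi>) * affine_dilation (1 / a) 0 (fourier_integral u) \<xi>"
proof -
  have "fourier_integral u (\<xi> / a) = \<bar>a\<bar> ^ DIM(real) *\<^sub>R (LINT x|lborel. u (t + a *\<^sub>R x) * cis (- 2 * pi * ((t + a *\<^sub>R x) \<bullet> (\<xi> / a))))"
    unfolding fourier_integral_def using assms(1) by (intro lborel_integral_affine) auto
  also have "\<dots> = of_real a * (LINT x|lborel. cis (- (2 * pi * t / a * \<xi>)) * (u (a * x + t) * cis (- 2 * pi * (x \<bullet> \<xi>))))"
  proof -
    have "u (t + a *\<^sub>R x) * cis (- 2 * pi * ((t + a *\<^sub>R x) \<bullet> (\<xi> / a))) =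
        cis (- (2 * pi * t / a * \<xi>)) * (u (a * x + t) * cis (- 2 * pi * (x \<bullet> \<xi>)))" for x
    proof -
      have arg: "- 2 * pi * ((t + a *\<^sub>R x) \<bullet> (\<xi> / a)) = - (2 * pi * t / a * \<xi>) + - 2 * pi * (x \<bullet> \<xi>)"
        using assms(1) by (simp add: field_simps)
      show ?thesis unfolding arg cis_mult[symmetric] by (simp add: add.commute)
    qed
    then show ?thesis using assms(1) by (simp add: scaleR_conv_of_real)
  qed
  also have "\<dots> = of_real (sqrt a) * cis (- (2 * pi * t / a * \<xi>)) * fourier_integral (affine_dilation a t u) \<xi>"
  proof -
    have "complex_of_real a = of_real (sqrt a) * of_real (sqrt a)"
      using assms(1) by (simp flip: of_real_mult)
    then show ?thesis
      unfolding fourier_integral_def affine_dilation_def by (simp add: mult.assoc)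
  qed
  finally have "cis (2 * pi * t / a * \<xi>) * (of_real (1 / sqrt a) * fourier_integral u (\<xi> / a)) =
      (cis (2 * pi * t / a * \<xi>) * cis (- (2 * pi * t / a * \<xi>))) * (of_real (1 / sqrt a) * of_real (sqrt a)) * fourier_integral (affine_dilation a t u) \<xi>"
    by (simp only: mult_ac)
  then show ?thesis
    using assms(1) by (simp add: cis_mult affine_dilation_def real_sqrt_divide)
qed

lemma has_L2_fourier_affine_dilation:
  assumes a: "0 < a" and fF: "has_L2_fourier f F"
  shows "has_L2_fourier (affine_dilation a t f) (\<lambda>\<xi>. cis (2 * pi * t / a * \<xi>) * affine_dilation (1 / a) 0 F \<xi>)"
proof -
  obtain u where u: "\<And>n. u n \<in> L2" "\<And>n. integrable lborel (u n)" "\<And>n. fourier_integral (u n) \<in> L2"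
    "l2_tendsto u f" "l2_tendsto (\<lambda>n. fourier_integral (u n)) F"
    using has_L2_fourierE[OF fF] by blast
  note L = has_L2_fourier_L2[OF fF]
  have a': "0 < 1 / a" using a by simp
  show ?thesis
  proof (rule has_L2_fourierI[where u="\<lambda>n. affine_dilation a t (u n)"])
    show "integrable lborel (affine_dilation a t (u n))" for n
      using lborel_integral_affine(2)[of a "u n" t] u(2)[of n] L2_measurable[OF u(1)[of n]] a
      unfolding affine_dilation_def[abs_def] by (simp add: add.commute)
    show "l2_tendsto (\<lambda>n. fourier_integral (affine_dilation a t (u n))) (\<lambda>\<xi>. cis (2 * pi * t / a * \<xi>) * affine_dilation (1 / a) 0 F \<xi>)"
      using affine_dilation_l2_tendsto[OF a' u(3) L(2) u(5), of 0]
      unfolding l2_tendsto_def fourier_integral_affine_dilation[OF a L2_measurable[OF u(1)], abs_def]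
        right_diff_distrib[symmetric]
      by (simp add: l2_norm_def norm_mult)
    show "(\<lambda>\<xi>. cis (2 * pi * t / a * \<xi>) * affine_dilation (1 / a) 0 F \<xi>) \<in> L2"
      by (rule L2_modulation[OF affine_dilation_L2[OF a' L(2)]])
  qed (use u L a in \<open>auto intro!: affine_dilation_L2 affine_dilation_l2_tendsto\<close>)
qed

section \<open>Orthogonal projections and orthonormal bases\<close>

lemma closed_l2_subspaceD:
  assumes "closed_l2_subspace V"
  shows "f \<in> V \<Longrightarrow> f \<in> L2" "(\<lambda>x. 0) \<in> V"
    "f \<in> V \<Longrightarrow> g \<in> V \<Longrightarrow> (\<lambda>x. f x + g x) \<in> V" "f \<in> V \<Longrightarrow> (\<lambda>x. c * f x) \<in> V"
    "(\<And>n. u n \<in> V) \<Longrightarrow> f \<in> L2 \<Longrightarrow> l2_tendsto u f \<Longrightarrow> f \<in> V"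
  using assms unfolding closed_l2_subspace_def by (auto, blast)

lemma closed_l2_subspace_diff:
  assumes "closed_l2_subspace V" "f \<in> V" "g \<in> V"
  shows "(\<lambda>x. f x - g x) \<in> V"
  using closed_l2_subspaceD(3)[OF assms(1,2) closed_l2_subspaceD(4)[OF assms(1,3), of "-1"]] by simp

lemma l2_parallelogram:
  assumes "f \<in> L2" "g \<in> L2"
  shows "(l2_norm (\<lambda>x. f x - g x))\<^sup>2 = 2 * (l2_norm f)\<^sup>2 + 2 * (l2_norm g)\<^sup>2 - (l2_norm (\<lambda>x. f x + g x))\<^sup>2"
  by (simp add: l2_norm_add_power2[OF assms] l2_norm_diff_power2[OF assms])

text \<open>A small step along \<open>g\<close> in the direction of the inner product would shorten
  \<open>r\<close>, since the gain is linear in the step and the loss quadratic.\<close>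

lemma l2_minimizer_orthogonal:
  assumes r: "r \<in> L2" and g: "g \<in> L2" and le: "\<And>c. (l2_norm r)\<^sup>2 \<le> (l2_norm (\<lambda>x. r x - c * g x))\<^sup>2"
  shows "l2_inner r g = 0"
proof -
  let ?s = "(cmod (l2_inner r g))\<^sup>2" and ?n = "(l2_norm g)\<^sup>2"
  \<comment> \<open>Small enough that \<open>t * ?n < 1\<close>, with \<open>+ 1\<close> covering
    the case of norm zero.\<close>
  define t where "t = 1 / (?n + 1)"
  have t: "0 < t" "t * ?n < 1"
    by (simp_all add: t_def add_nonneg_pos divide_less_eq)
  let ?c = "of_real t * l2_inner r g"
  have "(l2_norm r)\<^sup>2 \<le> (l2_norm r)\<^sup>2 - 2 * Re (cnj ?c * l2_inner r g) + (cmod ?c * l2_norm g)\<^sup>2"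
    using le[of ?c] by (simp only: l2_norm_diff_power2[OF r L2_scale[OF g]] l2_inner_scale_right l2_norm_scale)
  also have "cnj ?c * l2_inner r g = of_real (t * ?s)"
    by (simp add: complex_norm_square mult_ac del: of_real_power)
  also have "(cmod ?c * l2_norm g)\<^sup>2 = t * ?s * (t * ?n)"
    by (simp add: norm_mult power_mult_distrib power2_eq_square)
  finally have "2 * (t * ?s) \<le> t * ?s * (t * ?n)" by simp
  also have "\<dots> \<le> t * ?s * 1"
    using t by (intro mult_left_mono) auto
  finally have "t * ?s \<le> 0" by simp
  then have "?s \<le> 0" using t(1) by (simp add: mult_le_0_iff)
  then show ?thesis by simp
qed

text \<open>The nearest point of a closed subspace: a minimising sequence is Cauchy by the
  parallelogram law, and the minimality of its limit forces orthogonality.\<close>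

lemma l2_projection:
  assumes V: "closed_l2_subspace V" and f: "f \<in> L2"
  obtains p where "p \<in> V" "\<And>g. g \<in> V \<Longrightarrow> l2_inner (\<lambda>x. f x - p x) g = 0"
proof -
  note VD = closed_l2_subspaceD[OF V]
  define S where "S = (\<lambda>g. (l2_norm (\<lambda>x. f x - g x))\<^sup>2) ` V"
  define d where "d = Inf S"
  have S: "S \<noteq> {}" "bdd_below S" using VD(2) by (auto simp: S_def intro!: bdd_belowI[of _ 0])
  have d_le: "d \<le> (l2_norm (\<lambda>x. f x - g x))\<^sup>2" if "g \<in> V" for g
    unfolding d_def by (rule cInf_lower[OF _ S(2)]) (use that in \<open>auto simp: S_def\<close>)
  have "\<exists>g\<in>V. (l2_norm (\<lambda>x. f x - g x))\<^sup>2 < d + inverse (real (Suc n))" for n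
    using cInf_lessD[OF S(1), of "d + inverse (real (Suc n))"] by (auto simp: d_def S_def)
  then obtain u where uV: "\<And>n. u n \<in> V" and u: "\<And>n. (l2_norm (\<lambda>x. f x - u n x))\<^sup>2 < d + inverse (real (Suc n))"
    by metis
  have uL: "u n \<in> L2" for n by (rule VD(1)[OF uV])
  have diff: "(l2_norm (\<lambda>x. u m x - u n x))\<^sup>2 \<le> 2 * inverse (real (Suc m)) + 2 * inverse (real (Suc n))" for m n
  proof -
    \<comment> \<open>The midpoint lies in \<open>V\<close> and so is no closer to \<open>f\<close>
      than the infimum; this bounds the parallelogram term from below.\<close>
    have "(\<lambda>x. 1/2 * (u m x + u n x)) \<in> V" by (intro VD(3,4) uV)
    from d_le[OF this] have "4 * d \<le> 4 * (l2_norm (\<lambda>x. f x - 1/2 * (u m x + u n x)))\<^sup>2" by simp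
    also have "\<dots> = (l2_norm (\<lambda>x. 2 * (f x - 1/2 * (u m x + u n x))))\<^sup>2"
      by (simp only: l2_norm_scale) (simp add: power_mult_distrib)
    also have "(\<lambda>x. 2 * (f x - 1/2 * (u m x + u n x))) = (\<lambda>x. (f x - u m x) + (f x - u n x))"
      by (rule ext) (simp add: field_simps)
    finally have "(l2_norm (\<lambda>x. (f x - u m x) - (f x - u n x)))\<^sup>2 \<le>
        2 * inverse (real (Suc m)) + 2 * inverse (real (Suc n))"
      using l2_parallelogram[OF L2_diff[OF f uL[of m]] L2_diff[OF f uL[of n]]] u[of m] u[of n] by linarith
    then show ?thesis by (simp add: l2_norm_minus_commute[of "u n"])
  qed
  have "\<exists>N. \<forall>m\<ge>N. \<forall>n\<ge>N. l2_norm (\<lambda>x. u m x - u n x) < e" if "e > 0" for e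
  proof -
    \<comment> \<open>The two terms of \<open>diff\<close> add up to at most 4 / (N + 1), hence the
      quarter.\<close>
    obtain N where N: "inverse (real (Suc N)) < e\<^sup>2 / 4"
      using reals_Archimedean[of "e\<^sup>2 / 4"] \<open>e > 0\<close> by auto
    have "l2_norm (\<lambda>x. u m x - u n x) < e" if "m \<ge> N" "n \<ge> N" for m n
    proof (rule power2_less_imp_less)
      have "inverse (real (Suc m)) \<le> inverse (real (Suc N))" "inverse (real (Suc n)) \<le> inverse (real (Suc N))"
        using that by (auto intro!: le_imp_inverse_le)
      then show "(l2_norm (\<lambda>x. u m x - u n x))\<^sup>2 < e\<^sup>2" using diff[of m n] N by linarith
    qed (use \<open>e > 0\<close> in simp)
    then show ?thesis by blast
  qed
  from L2_complete[OF uL this] obtain p where pL: "p \<in> L2" and p: "l2_tendsto u p" by blast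
  have pV: "p \<in> V" by (rule VD(5)[OF uV pL p])
  have "l2_tendsto (\<lambda>n x. f x - u n x) (\<lambda>x. f x - p x)"
    using p by (simp add: l2_tendsto_def l2_norm_minus_commute[of p])
  from tendsto_power[OF l2_tendsto_norm[OF L2_diff[OF f uL] L2_diff[OF f pL] this], of 2]
  have "(l2_norm (\<lambda>x. f x - p x))\<^sup>2 \<le> d"
  proof (rule LIMSEQ_le)
    show "(\<lambda>n. d + inverse (real (Suc n))) \<longlonglongrightarrow> d"
      using LIMSEQ_inverse_real_of_nat_add by simp
  qed (use u in \<open>auto intro: less_imp_le\<close>)
  then have min: "(l2_norm (\<lambda>x. f x - p x))\<^sup>2 \<le> (l2_norm (\<lambda>x. f x - g x))\<^sup>2" if "g \<in> V" for g
    using d_le[OF that] by (rule order_trans)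
  show thesis
  proof (rule that[OF pV], rule l2_minimizer_orthogonal)
    fix g c assume "g \<in> V"
    then have "(\<lambda>x. p x + c * g x) \<in> V" by (intro VD(3,4) pV)
    from min[OF this] show "(l2_norm (\<lambda>x. f x - p x))\<^sup>2 \<le> (l2_norm (\<lambda>x. f x - p x - c * g x))\<^sup>2"
      by (simp add: diff_diff_eq)
  qed (use f pL VD(1) in \<open>auto intro: L2_diff\<close>)
qed

lemma l2_Pythagoras:
  assumes f: "f \<in> L2" and p: "p \<in> L2" and orth: "l2_inner (\<lambda>x. f x - p x) p = 0"
  shows "(l2_norm (\<lambda>x. f x - p x))\<^sup>2 = (l2_norm f)\<^sup>2 - (l2_norm p)\<^sup>2"
  using l2_norm_add_power2[OF L2_diff[OF f p] p] orth by simp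

text \<open>Completing the square. The choice \<open>c i = l2_inner p (e i)\<close> gives Bessel's
  inequality, and dropping the last sum shows that no other coefficients approximate better.\<close>

lemma l2_norm_orthonormal_combination:
  assumes e: "\<And>i. i \<in> F \<Longrightarrow> e i \<in> L2" and p: "p \<in> L2" and "finite F"
    and on: "\<And>i j. i \<in> F \<Longrightarrow> j \<in> F \<Longrightarrow> l2_inner (e i) (e j) = (if i = j then 1 else 0)"
  shows "(l2_norm (\<lambda>x. p x - (\<Sum>i\<in>F. c i * e i x)))\<^sup>2 =
    (l2_norm p)\<^sup>2 - (\<Sum>i\<in>F. (cmod (l2_inner p (e i)))\<^sup>2) + (\<Sum>i\<in>F. (cmod (l2_inner p (e i) - c i))\<^sup>2)"
proof -
  let ?s = "\<lambda>x. \<Sum>i\<in>F. c i * e i x"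
  have sL: "?s \<in> L2" by (intro L2_sum L2_scale e)
  have s_inner: "l2_inner ?s g = (\<Sum>i\<in>F. c i * l2_inner (e i) g)" if "g \<in> L2" for g
    using that e by (simp add: l2_inner_sum_left L2_scale l2_inner_scale_left)
  have "l2_inner ?s (e i) = c i" if "i \<in> F" for i
  proof -
    have "l2_inner ?s (e i) = (\<Sum>j\<in>F. if j = i then c j else 0)"
      unfolding s_inner[OF e[OF that]] by (intro sum.cong) (auto simp: on that)
    then show ?thesis using that \<open>finite F\<close> by simp
  qed
  then have "l2_inner (e i) ?s = cnj (c i)" if "i \<in> F" for i
    using that l2_inner_commute[of "e i" ?s] by simp
  then have "l2_inner ?s ?s = (\<Sum>i\<in>F. c i * cnj (c i))"
    unfolding s_inner[OF sL] by (intro sum.cong) auto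
  also have "\<dots> = of_real (\<Sum>i\<in>F. (cmod (c i))\<^sup>2)"
    by (simp add: complex_norm_square del: of_real_power)
  finally have ss: "(l2_norm ?s)\<^sup>2 = (\<Sum>i\<in>F. (cmod (c i))\<^sup>2)"
    unfolding l2_inner_self of_real_eq_iff .
  have "Re (l2_inner p ?s) = Re (l2_inner ?s p)"
    using l2_inner_commute[of p ?s] by simp
  also have "\<dots> = (\<Sum>i\<in>F. Re (c i * cnj (l2_inner p (e i))))"
    unfolding s_inner[OF p] Re_sum by (intro sum.cong refl) (metis l2_inner_commute)
  finally have ps: "Re (l2_inner p ?s) = (\<Sum>i\<in>F. Re (c i * cnj (l2_inner p (e i))))" .
  have "(cmod (z - w))\<^sup>2 = (cmod z)\<^sup>2 - 2 * Re (w * cnj z) + (cmod w)\<^sup>2" for z w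
    unfolding cmod_power2 by (simp add: power2_eq_square algebra_simps)
  then show ?thesis
    unfolding l2_norm_diff_power2[OF p sL] ss ps
    by (simp add: sum.distrib sum_subtractf sum_distrib_left)
qed

section \<open>Orthonormal bases and Parseval's identity\<close>

lemma orthonormal_basis_in: "orthonormal_basis_of V I e \<Longrightarrow> i \<in> I \<Longrightarrow> e i \<in> V"
  by (simp add: orthonormal_basis_of_def)

lemma orthonormal_basis_norm:
  assumes "orthonormal_basis_of V I e" "i \<in> I"
  shows "l2_norm (e i) = 1"
proof -
  have "l2_inner (e i) (e i) = 1"
    using assms by (simp add: orthonormal_basis_of_def)
  then have "(l2_norm (e i))\<^sup>2 = 1\<^sup>2"
    unfolding l2_inner_self of_real_eq_1_iff by simp
  then show ?thesis by (rule power2_eq_imp_eq) simp_all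
qed

text \<open>Bessel bounds the finite sums from above. Density supplies finite combinations with
  arbitrary coefficients, but the true coefficients do at least as well, which bounds the sums from
  below.\<close>

lemma orthonormal_basis_Parseval:
  assumes basis: "orthonormal_basis_of V I e" and V: "V \<subseteq> L2" and p: "p \<in> V"
  shows "((\<lambda>i. (cmod (l2_inner p (e i)))\<^sup>2) has_sum (l2_norm p)\<^sup>2) I"
proof -
  let ?X = "\<lambda>F. \<Sum>i\<in>F. (cmod (l2_inner p (e i)))\<^sup>2"
  have e: "e i \<in> L2" if "i \<in> I" for i using orthonormal_basis_in[OF basis that] V by auto
  have on: "l2_inner (e i) (e j) = (if i = j then 1 else 0)" if "i \<in> I" "j \<in> I" for i j
    using basis that by (auto simp: orthonormal_basis_of_def)
  have pL: "p \<in> L2" using p V by auto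
  have eq: "(l2_norm (\<lambda>x. p x - (\<Sum>i\<in>F. c i * e i x)))\<^sup>2 =
      (l2_norm p)\<^sup>2 - ?X F + (\<Sum>i\<in>F. (cmod (l2_inner p (e i) - c i))\<^sup>2)" if "finite F" "F \<subseteq> I" for F c
    by (rule l2_norm_orthonormal_combination[OF e pL that(1) on]) (use that in auto)
  have upper: "?X F \<le> (l2_norm p)\<^sup>2" if "finite F" "F \<subseteq> I" for F
    using eq[OF that, of "\<lambda>i. l2_inner p (e i)"] zero_le_power2[of "l2_norm (\<lambda>x. p x - (\<Sum>i\<in>F. l2_inner p (e i) * e i x))"]
    by simp
  show ?thesis
    unfolding has_sum_def
  proof (rule order_tendstoI)
    fix a assume a: "a < (l2_norm p)\<^sup>2"
    define d where "d = sqrt ((l2_norm p)\<^sup>2 - a)"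
    have "d > 0" using a by (simp add: d_def)
    then obtain F c where F: "finite F" "F \<subseteq> I" "l2_norm (\<lambda>x. p x - (\<Sum>i\<in>F. c i * e i x)) < d"
      using basis p unfolding orthonormal_basis_of_def by metis
    have "(l2_norm p)\<^sup>2 - ?X F \<le> (l2_norm (\<lambda>x. p x - (\<Sum>i\<in>F. c i * e i x)))\<^sup>2"
      unfolding eq[OF F(1,2)] by (simp add: sum_nonneg)
    also have "\<dots> < d\<^sup>2" using F(3) by (intro power_strict_mono) auto
    also have "\<dots> = (l2_norm p)\<^sup>2 - a" using a by (simp add: d_def)
    finally have "a < ?X F" by simp
    moreover have "?X F \<le> ?X Y" if "finite Y" "F \<subseteq> Y" for Y
      using that by (intro sum_mono2) auto
    ultimately show "\<forall>\<^sub>F Y in finite_subsets_at_top I. a < ?X Y"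
      unfolding eventually_finite_subsets_at_top using F by (meson less_le_trans)
  next
    fix a assume "(l2_norm p)\<^sup>2 < a"
    then show "\<forall>\<^sub>F Y in finite_subsets_at_top I. ?X Y < a"
      unfolding eventually_finite_subsets_at_top using upper by (meson finite.emptyI empty_subsetI le_less_trans)
  qed
qed

section \<open>Telescoping and iterated unordered sums\<close>

lemma has_sum_telescope_atLeast:
  fixes a :: "int \<Rightarrow> real"
  assumes mono: "\<And>j. a j \<le> a (j + 1)" and lim: "(\<lambda>n. a (j0 + int n)) \<longlonglongrightarrow> L"
  shows "((\<lambda>j. a (j + 1) - a j) has_sum (L - a j0)) {j0..}"
proof -
  have "(\<lambda>n. a (j0 + int (Suc n)) - a (j0 + int n)) sums (L - a (j0 + int 0))"
    by (rule telescope_sums[OF lim])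
  then have "((\<lambda>n. a (j0 + int (Suc n)) - a (j0 + int n)) has_sum (L - a (j0 + int 0))) UNIV"
    by (rule sums_nonneg_imp_has_sum) (use mono[of "j0 + int n" for n] in \<open>simp add: add.assoc add.commute[of 1]\<close>)
  then have "((\<lambda>j. a (j + 1) - a j) \<circ> (\<lambda>n. j0 + int n) has_sum (L - a j0)) UNIV"
    by (simp add: o_def add.assoc add.commute[of 1])
  moreover have "range (\<lambda>n. j0 + int n) = {j0..}"
  proof (intro set_eqI iffI)
    fix x assume "x \<in> {j0..}"
    then have "x = j0 + int (nat (x - j0))" by simp
    then show "x \<in> range (\<lambda>n. j0 + int n)" by blast
  qed auto
  moreover have "inj (\<lambda>n. j0 + int n)" by (simp add: inj_def)
  ultimately show ?thesis using has_sum_reindex[of "\<lambda>n. j0 + int n" UNIV "\<lambda>j. a (j + 1) - a j"] by simp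
qed

lemma has_sum_telescope_UNIV:
  fixes a :: "int \<Rightarrow> real"
  assumes mono: "\<And>j. a j \<le> a (j + 1)" and top: "(\<lambda>n. a (int n)) \<longlonglongrightarrow> L" and bot: "(\<lambda>n. a (- int n)) \<longlonglongrightarrow> l"
  shows "((\<lambda>j. a (j + 1) - a j) has_sum (L - l)) UNIV"
proof -
  have 1: "((\<lambda>j. a (j + 1) - a j) has_sum (L - a 0)) {0..}"
    using has_sum_telescope_atLeast[of a 0 L] mono top by simp
  \<comment> \<open>The negative half is the one-sided case for
    \<open>j \<mapsto> - a (- j)\<close>. Its increment at \<open>j\<close> is that of
    \<open>a\<close> at \<open>- j - 1\<close>, and \<open>j \<mapsto> - j - 1\<close> maps the
    nonnegative integers onto the negative ones.\<close>
  have "((\<lambda>j. - a (- (j + 1)) - - a (- j)) has_sum (- l - - a (- 0))) {0..}"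
    using mono[of "- (j + 1)" for j] tendsto_minus[OF bot] by (intro has_sum_telescope_atLeast) simp_all
  then have "((\<lambda>j. a (j + 1) - a j) \<circ> (\<lambda>j. - j - 1) has_sum (a 0 - l)) {0..}"
    by (simp add: o_def algebra_simps)
  moreover have "(\<lambda>j. - j - 1) ` {0..} = {..<0::int}"
  proof (intro set_eqI iffI)
    fix x :: int assume "x \<in> {..<0}"
    then have "x = - (- x - 1) - 1" "- x - 1 \<in> {0..}" by auto
    then show "x \<in> (\<lambda>j. - j - 1) ` {0..}" by blast
  qed auto
  moreover have "inj_on (\<lambda>j::int. - j - 1) {0..}" by (simp add: inj_on_def)
  ultimately have 2: "((\<lambda>j. a (j + 1) - a j) has_sum (a 0 - l)) {..<0}"
    using has_sum_reindex[of "\<lambda>j. - j - 1" "{0..}" "\<lambda>j. a (j + 1) - a j"] by simp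
  have "{..<0} \<union> {0..} = (UNIV :: int set)" by auto
  moreover have "{..<0} \<inter> {0..} = ({} :: int set)" by auto
  ultimately show ?thesis using has_sum_Un_disjoint[OF 2 1] by simp
qed

lemma has_sum_Sigma_nonneg:
  fixes f :: "'a \<times> 'b \<Rightarrow> real"
  assumes "\<And>x. x \<in> A \<Longrightarrow> ((\<lambda>y. f (x, y)) has_sum g x) (B x)" "(g has_sum S) A" "\<And>p. 0 \<le> f p"
  shows "(f has_sum S) (Sigma A B)"
  using assms by (intro has_sum_SigmaI[where g=g] summable_on_SigmaI[where g=g])
    (auto simp: has_sum_imp_summable)

section \<open>Wavelet frames of a multiresolution analysis\<close>

lemma affine_dilation_inverse:
  assumes "0 < a"
  shows "affine_dilation a 0 (affine_dilation (1 / a) 0 f) = f"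
  using assms by (simp add: affine_dilation_def fun_eq_iff real_sqrt_divide)

text \<open>The equivalence is used both ways: forwards to place the images in \<open>U'\<close>,
  backwards to pull an element of \<open>U'\<close> into \<open>U\<close>, where it can be
  approximated.\<close>

lemma affine_dilation_orthonormal_basis:
  assumes a: "0 < a" and basis: "orthonormal_basis_of U I e"
    and U: "U \<subseteq> L2" "U' \<subseteq> L2" and iff: "\<And>f. f \<in> L2 \<Longrightarrow> f \<in> U \<longleftrightarrow> affine_dilation a 0 f \<in> U'"
  shows "orthonormal_basis_of U' I (\<lambda>i. affine_dilation a 0 (e i))"
  unfolding orthonormal_basis_of_def
proof (intro conjI ballI allI impI)
  have e: "e i \<in> U" "e i \<in> L2" if "i \<in> I" for i using basis U that by (auto simp: orthonormal_basis_of_def)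
  fix i assume i: "i \<in> I"
  show "affine_dilation a 0 (e i) \<in> U'" using iff e[OF i] by simp
  fix j assume j: "j \<in> I"
  show "l2_inner (affine_dilation a 0 (e i)) (affine_dilation a 0 (e j)) = (if i = j then 1 else 0)"
    using basis i j affine_dilation_inner[OF a L2_measurable[OF e(2)[OF i]] L2_measurable[OF e(2)[OF j]], of 0]
    by (simp add: orthonormal_basis_of_def)
next
  have e: "e i \<in> L2" if "i \<in> I" for i using basis U that by (auto simp: orthonormal_basis_of_def)
  fix f and \<epsilon> :: real assume f: "f \<in> U'" and \<epsilon>: "0 < \<epsilon>"
  define g where "g = affine_dilation (1 / a) 0 f"
  have fg: "f = affine_dilation a 0 g" unfolding g_def by (rule affine_dilation_inverse[OF a, symmetric])
  have gL: "g \<in> L2" unfolding g_def using a f U by (intro affine_dilation_L2) auto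
  then have "g \<in> U" using iff f fg by simp
  then obtain F c where F: "finite F" "F \<subseteq> I" "l2_norm (\<lambda>x. g x - (\<Sum>i\<in>F. c i * e i x)) < \<epsilon>"
    using basis \<epsilon> unfolding orthonormal_basis_of_def by blast
  have "(\<lambda>x. \<Sum>i\<in>F. c i * e i x) \<in> L2"
    using F e by (intro L2_sum L2_scale) auto
  from affine_dilation_norm[OF a L2_measurable[OF L2_diff[OF gL this]], of 0]
  have "l2_norm (affine_dilation a 0 (\<lambda>x. g x - (\<Sum>i\<in>F. c i * e i x))) < \<epsilon>"
    using F(3) by simp
  also have "affine_dilation a 0 (\<lambda>x. g x - (\<Sum>i\<in>F. c i * e i x)) =
      (\<lambda>x. f x - (\<Sum>i\<in>F. c i * affine_dilation a 0 (e i) x))"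
    unfolding fg by (rule ext) (simp add: affine_dilation_def right_diff_distrib sum_distrib_left mult.left_commute)
  finally have "l2_norm (\<lambda>x. f x - (\<Sum>i\<in>F. c i * affine_dilation a 0 (e i) x)) < \<epsilon>" .
  then show "\<exists>F c. finite F \<and> F \<subseteq> I \<and> l2_norm (\<lambda>x. f x - (\<Sum>i\<in>F. c i * affine_dilation a 0 (e i) x)) < \<epsilon>"
    using F(1,2) by blast
qed

lemma affine_dilation_translate:
  "affine_dilation a 0 (\<lambda>x. f (x - t)) = affine_dilation a (- t) f"
  by (rule ext) (simp add: affine_dilation_def)

lemma has_sum_Plus:
  fixes f :: "'a + 'b \<Rightarrow> 'c::topological_comm_monoid_add"
  assumes "((f \<circ> Inl) has_sum a) A" "((f \<circ> Inr) has_sum b) B"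
  shows "(f has_sum (a + b)) (A <+> B)"
  unfolding Plus_def using assms
  by (intro has_sum_Un_disjoint) (auto simp: has_sum_reindex)

locale mra_system =
  fixes M :: nat and V :: "int \<Rightarrow> (real \<Rightarrow> complex) set" and \<phi> :: "real \<Rightarrow> complex" and \<psi> :: "nat \<Rightarrow> real \<Rightarrow> complex"
  assumes mra: "orthogonal_mra M V \<phi>" and wavelets: "mra_wavelets M V \<psi>" and M: "0 < M"
begin

lemma V_closed: "closed_l2_subspace (V j)"
  and V_step: "V j \<subseteq> V (j + 1)"
  and V_shift: "f \<in> L2 \<Longrightarrow> f \<in> V j \<longleftrightarrow> (\<lambda>x. f (real M * x)) \<in> V (j + 1)"
  and V_Inter: "(\<And>j. f \<in> V j) \<Longrightarrow> l2_norm f = 0"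
  and V_dense: "f \<in> L2 \<Longrightarrow> 0 < \<epsilon> \<Longrightarrow> \<exists>j. \<exists>g\<in>V j. l2_norm (\<lambda>x. f x - g x) < \<epsilon>"
  and V_basis: "orthonormal_basis_of (V 0) UNIV (\<lambda>(k::int) x. \<phi> (x - of_int k))"
  using mra unfolding orthogonal_mra_def by auto

lemmas V_L2 = closed_l2_subspaceD(1)[OF V_closed]

lemma V_mono: "i \<le> j \<Longrightarrow> V i \<subseteq> V j"
  by (induction j rule: int_ge_induct) (use V_step in blast)+

section \<open>Dilation between the levels of the analysis\<close>

definition scale :: "int \<Rightarrow> real" where "scale j = real M powi j"

lemma scale_pos: "0 < scale j"
  using M by (simp add: scale_def)

text \<open>The dilation axiom is an equivalence between neighbouring levels, so induction upwards
  and downwards reaches every integer \<open>j\<close>.\<close>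

lemma V_scale:
  assumes "f \<in> L2"
  shows "f \<in> V k \<longleftrightarrow> (\<lambda>x. f (scale j * x)) \<in> V (k + j)"
  using assms
proof (induction j arbitrary: f rule: int_induct[where k=0])
  case base
  then show ?case by (simp add: scale_def)
next
  case (step1 i)
  \<comment> \<open>Membership is known for the normalised dilation; dividing by the square root of
    the scale removes the normalisation.\<close>
  have L: "(\<lambda>x. f (scale i * x)) \<in> L2"
    using L2_scale[OF affine_dilation_L2[OF scale_pos[of i] step1.prems, of 0], of "1 / of_real (sqrt (scale i))"] scale_pos[of i]
    by (simp add: affine_dilation_def)
  have "f \<in> V k \<longleftrightarrow> (\<lambda>x. f (scale i * x)) \<in> V (k + i)" by (rule step1.IH[OF step1.prems])
  also have "\<dots> \<longleftrightarrow> (\<lambda>x. f (scale i * (real M * x))) \<in> V (k + i + 1)" by (rule V_shift[OF L])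
  also have "(\<lambda>x. f (scale i * (real M * x))) = (\<lambda>x. f (scale (i + 1) * x))"
    using M by (simp add: scale_def power_int_add mult.assoc)
  finally show ?case by (simp add: add.assoc)
next
  case (step2 i)
  have L: "(\<lambda>x. f (scale (i - 1) * x)) \<in> L2"
    using L2_scale[OF affine_dilation_L2[OF scale_pos[of "i - 1"] step2.prems, of 0], of "1 / of_real (sqrt (scale (i - 1)))"] scale_pos[of "i - 1"]
    by (simp add: affine_dilation_def)
  have "f \<in> V k \<longleftrightarrow> (\<lambda>x. f (scale i * x)) \<in> V (k + i)" by (rule step2.IH[OF step2.prems])
  also have "(\<lambda>x. f (scale i * x)) = (\<lambda>x. f (scale (i - 1) * (real M * x)))"
    using M by (simp add: scale_def power_int_diff)
  also have "\<dots> \<in> V (k + i) \<longleftrightarrow> (\<lambda>x. f (scale (i - 1) * x)) \<in> V (k + (i - 1))"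
    using V_shift[OF L, of "k + (i - 1)"] by simp
  finally show ?case .
qed

text \<open>The normalising factor is absorbed because each level is closed under scalars, with the
  inverse scalar for the converse.\<close>

lemma V_dilation:
  assumes "f \<in> L2"
  shows "f \<in> V k \<longleftrightarrow> affine_dilation (scale j) 0 f \<in> V (k + j)"
proof -
  let ?c = "complex_of_real (sqrt (scale j))"
  have c: "?c \<noteq> 0" using scale_pos[of j] by simp
  have "(\<lambda>x. f (scale j * x)) \<in> V (k + j) \<longleftrightarrow> affine_dilation (scale j) 0 f \<in> V (k + j)"
    unfolding affine_dilation_def
    using closed_l2_subspaceD(4)[OF V_closed, of "\<lambda>x. f (scale j * x)" "k + j" ?c]
      closed_l2_subspaceD(4)[OF V_closed, of "\<lambda>x. ?c * f (scale j * x)" "k + j" "inverse ?c"] c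
    by (auto simp: mult.assoc[symmetric])
  then show ?thesis using V_scale[OF assms] by simp
qed

text \<open>The detail space of level \<open>j\<close>; at level 0 it is the space for which
  \<open>mra_wavelets\<close> prescribes a basis.\<close>

definition W :: "int \<Rightarrow> (real \<Rightarrow> complex) set" where
  "W j = {f \<in> V (j + 1). \<forall>g\<in>V j. l2_inner f g = 0}"

lemma W_L2: "f \<in> W j \<Longrightarrow> f \<in> L2"
  by (auto simp: W_def intro: V_L2)

text \<open>Dilation preserves inner products and carries level 0 onto level \<open>j\<close>, hence
  complements to complements.\<close>

lemma W_dilation:
  assumes f: "f \<in> L2"
  shows "f \<in> W 0 \<longleftrightarrow> affine_dilation (scale j) 0 f \<in> W j"
proof -
  have inner: "l2_inner (affine_dilation (scale j) 0 f) (affine_dilation (scale j) 0 g) = l2_inner f g" if "g \<in> L2" for g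
    using f that by (intro affine_dilation_inner scale_pos L2_measurable)
  have "(\<forall>g\<in>V 0. l2_inner f g = 0) \<longleftrightarrow> (\<forall>g\<in>V j. l2_inner (affine_dilation (scale j) 0 f) g = 0)"
  proof (intro iffI ballI)
    fix g assume *: "\<forall>g\<in>V 0. l2_inner f g = 0" and g: "g \<in> V j"
    let ?h = "affine_dilation (1 / scale j) 0 g"
    have hL: "?h \<in> L2" using g scale_pos[of j] by (intro affine_dilation_L2 V_L2) auto
    have "?h \<in> V 0"
      using V_dilation[OF hL, of 0 j] g by (simp add: affine_dilation_inverse[OF scale_pos])
    then show "l2_inner (affine_dilation (scale j) 0 f) g = 0"
      using inner[OF hL] * by (simp add: affine_dilation_inverse[OF scale_pos])
  next
    fix g assume *: "\<forall>g\<in>V j. l2_inner (affine_dilation (scale j) 0 f) g = 0" and g: "g \<in> V 0"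
    then show "l2_inner f g = 0"
      using inner[OF V_L2[OF g]] V_dilation[OF V_L2[OF g], of 0 j] by simp
  qed
  then show ?thesis
    unfolding W_def using V_dilation[OF f, of 1 j] by (simp add: add.commute)
qed

lemma scaling_basis:
  "orthonormal_basis_of (V j) UNIV (\<lambda>k::int. affine_dilation (scale j) (- of_int k) \<phi>)"
proof -
  have "orthonormal_basis_of (V j) UNIV (\<lambda>k::int. affine_dilation (scale j) 0 (\<lambda>x. \<phi> (x - of_int k)))"
    using V_dilation[of _ 0 j] by (intro affine_dilation_orthonormal_basis[OF scale_pos V_basis]) (auto intro: V_L2)
  then show ?thesis by (simp add: affine_dilation_translate)
qed

lemma wavelet_basis:
  "orthonormal_basis_of (W j) ({1..M - 1} \<times> UNIV) (\<lambda>(l, k::int). affine_dilation (scale j) (- of_int k) (\<psi> l))"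
proof -
  have "orthonormal_basis_of (W 0) ({1..M - 1} \<times> UNIV) (\<lambda>(l, k::int) x. \<psi> l (x - of_int k))"
    using wavelets by (simp add: mra_wavelets_def W_def)
  from affine_dilation_orthonormal_basis[OF scale_pos this _ _ W_dilation, of j]
  have "orthonormal_basis_of (W j) ({1..M - 1} \<times> UNIV)
      (\<lambda>i. affine_dilation (scale j) 0 (case i of (l, k::int) \<Rightarrow> \<lambda>x. \<psi> l (x - of_int k)))"
    by (auto intro: W_L2)
  also have "(\<lambda>i. affine_dilation (scale j) 0 (case i of (l, k::int) \<Rightarrow> \<lambda>x. \<psi> l (x - of_int k))) =
      (\<lambda>(l, k::int). affine_dilation (scale j) (- of_int k) (\<psi> l))"
    by (auto simp: fun_eq_iff affine_dilation_def)
  finally show ?thesis .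
qed

lemma scaling_L2: "\<phi> \<in> L2"
  using V_L2[OF orthonormal_basis_in[OF V_basis, of 0]] by simp

lemma wavelet_L2: "l \<in> {1..M - 1} \<Longrightarrow> \<psi> l \<in> L2"
  using W_L2[OF orthonormal_basis_in[OF wavelet_basis, of "(l, 0)" 0]]
  by (simp add: scale_def affine_dilation_def[abs_def])

section \<open>Projections onto the levels of the analysis\<close>

definition proj :: "(real \<Rightarrow> complex) \<Rightarrow> int \<Rightarrow> real \<Rightarrow> complex" where
  "proj f j = (SOME p. p \<in> V j \<and> (\<forall>g\<in>V j. l2_inner (\<lambda>x. f x - p x) g = 0))"

context
  fixes f :: "real \<Rightarrow> complex" assumes f: "f \<in> L2"
begin

lemma proj_in: "proj f j \<in> V j" and proj_orth: "g \<in> V j \<Longrightarrow> l2_inner (\<lambda>x. f x - proj f j x) g = 0"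
proof -
  have "\<exists>p. p \<in> V j \<and> (\<forall>g\<in>V j. l2_inner (\<lambda>x. f x - p x) g = 0)"
    by (rule l2_projection[OF V_closed f]) blast
  from someI_ex[OF this] show "proj f j \<in> V j" "g \<in> V j \<Longrightarrow> l2_inner (\<lambda>x. f x - proj f j x) g = 0"
    by (simp_all add: proj_def)
qed

lemma proj_L2: "proj f j \<in> L2"
  by (rule V_L2[OF proj_in])

lemma proj_inner:
  assumes g: "g \<in> V i" "i \<le> j"
  shows "l2_inner (proj f j) g = l2_inner f g"
  using proj_orth[of g j] V_mono[OF g(2)] g(1) l2_inner_diff_left[OF f proj_L2 V_L2[OF g(1)], of j] by auto

text \<open>Against elements of the smaller level both projections have the inner products of
  \<open>f\<close>, so their difference is orthogonal to \<open>proj f i\<close> and Pythagoras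
  applies.\<close>

lemma proj_diff_norm:
  assumes "i \<le> j"
  shows "(l2_norm (\<lambda>x. proj f j x - proj f i x))\<^sup>2 = (l2_norm (proj f j))\<^sup>2 - (l2_norm (proj f i))\<^sup>2"
proof (rule l2_Pythagoras[OF proj_L2 proj_L2])
  show "l2_inner (\<lambda>x. proj f j x - proj f i x) (proj f i) = 0"
    using proj_inner[OF proj_in assms] proj_inner[OF proj_in order_refl, of i]
    by (simp add: l2_inner_diff_left proj_L2)
qed

lemma proj_norm_mono: "i \<le> j \<Longrightarrow> (l2_norm (proj f i))\<^sup>2 \<le> (l2_norm (proj f j))\<^sup>2"
  using proj_diff_norm[of i j] zero_le_power2[of "l2_norm (\<lambda>x. proj f j x - proj f i x)"] by simp

text \<open>Density provides a close \<open>g\<close> in some \<open>V J\<close>; at every later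
  level the projection approximates \<open>f\<close> at least as well as \<open>g\<close>.\<close>

lemma proj_norm_top: "(\<lambda>n. (l2_norm (proj f (j0 + int n)))\<^sup>2) \<longlonglongrightarrow> (l2_norm f)\<^sup>2"
proof (rule LIMSEQ_I)
  fix r :: real assume "0 < r"
  then obtain J g where g: "g \<in> V J" "l2_norm (\<lambda>x. f x - g x) < sqrt r"
    using V_dense[OF f, of "sqrt r"] by auto
  have "norm ((l2_norm (proj f (j0 + int n)))\<^sup>2 - (l2_norm f)\<^sup>2) < r" if n: "nat (J - j0) \<le> n" for n
  proof -
    let ?j = "j0 + int n"
    have "J \<le> ?j" using n by simp
    then have gV: "g \<in> V ?j" using V_mono g(1) by blast
    have pg: "(\<lambda>x. proj f ?j x - g x) \<in> V ?j" by (rule closed_l2_subspace_diff[OF V_closed proj_in gV])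
    have "(l2_norm (\<lambda>x. (f x - proj f ?j x) + (proj f ?j x - g x)))\<^sup>2 =
        (l2_norm (\<lambda>x. f x - proj f ?j x))\<^sup>2 + (l2_norm (\<lambda>x. proj f ?j x - g x))\<^sup>2"
      using l2_norm_add_power2[OF L2_diff[OF f proj_L2[of ?j]] V_L2[OF pg]] proj_orth[OF pg] by simp
    then have "(l2_norm (\<lambda>x. f x - proj f ?j x))\<^sup>2 \<le> (l2_norm (\<lambda>x. f x - g x))\<^sup>2"
      by simp
    also have "\<dots> < (sqrt r)\<^sup>2" using g(2) by (intro power_strict_mono) auto
    also have "(l2_norm (\<lambda>x. f x - proj f ?j x))\<^sup>2 = (l2_norm f)\<^sup>2 - (l2_norm (proj f ?j))\<^sup>2"
      by (rule l2_Pythagoras[OF f proj_L2 proj_orth[OF proj_in]])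
    finally have "(l2_norm f)\<^sup>2 - (l2_norm (proj f ?j))\<^sup>2 < r" using \<open>0 < r\<close> by simp
    moreover have "(l2_norm (proj f ?j))\<^sup>2 \<le> (l2_norm f)\<^sup>2"
      using l2_Pythagoras[OF f proj_L2 proj_orth[OF proj_in], of ?j] zero_le_power2[of "l2_norm (\<lambda>x. f x - proj f ?j x)"]
      by simp
    ultimately show ?thesis by simp
  qed
  then show "\<exists>N. \<forall>n\<ge>N. norm ((l2_norm (proj f (j0 + int n)))\<^sup>2 - (l2_norm f)\<^sup>2) < r" by blast
qed

text \<open>Convergence of the decreasing norms makes the projections themselves Cauchy. Their limit
  lies in every level, and the intersection of all levels is trivial.\<close>

lemma proj_norm_bot: "(\<lambda>n. (l2_norm (proj f (- int n)))\<^sup>2) \<longlonglongrightarrow> 0"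
proof -
  let ?a = "\<lambda>n. (l2_norm (proj f (- int n)))\<^sup>2" and ?u = "\<lambda>n. proj f (- int n)"
  have "decseq ?a" unfolding decseq_def by (intro allI impI proj_norm_mono) simp
  then have "convergent ?a"
    using decseq_convergent[of ?a 0] unfolding convergent_def by (metis zero_le_power2)
  then have C: "Cauchy ?a" by (simp add: Cauchy_convergent_iff)
  have "\<exists>N. \<forall>m\<ge>N. \<forall>n\<ge>N. l2_norm (\<lambda>x. ?u m x - ?u n x) < e" if e: "0 < e" for e
  proof -
    obtain N where N: "\<And>m n. m \<ge> N \<Longrightarrow> n \<ge> N \<Longrightarrow> \<bar>?a m - ?a n\<bar> < e\<^sup>2"
      using CauchyD[OF C, of "e\<^sup>2"] e by auto
    have *: "l2_norm (\<lambda>x. ?u m x - ?u n x) < e" if "m \<ge> N" "n \<ge> N" "m \<le> n" for m n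
    proof (rule power2_less_imp_less)
      show "(l2_norm (\<lambda>x. ?u m x - ?u n x))\<^sup>2 < e\<^sup>2"
        using proj_diff_norm[of "- int n" "- int m"] N[of m n] that by simp
    qed (use e in simp)
    have "l2_norm (\<lambda>x. ?u m x - ?u n x) < e" if "m \<ge> N" "n \<ge> N" for m n
      using *[of m n] *[of n m] that l2_norm_minus_commute[of "?u m" "?u n"] by (cases "m \<le> n") auto
    then show ?thesis by blast
  qed
  from L2_complete[OF proj_L2 this] obtain g where gL: "g \<in> L2" and g: "l2_tendsto ?u g" by blast
  have "g \<in> V j" for j
  proof (rule closed_l2_subspaceD(5)[OF V_closed _ gL])
    show "?u (n + nat (- j)) \<in> V j" for n
      \<comment> \<open>The offset \<open>nat (- j)\<close> brings the level down to at most
        \<open>j\<close> from the first term on.\<close>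
      using proj_in[of "- int (n + nat (- j))"] V_mono[of "- int (n + nat (- j))" j] by auto
    show "l2_tendsto (\<lambda>n. ?u (n + nat (- j))) g"
      using g unfolding l2_tendsto_def by (rule LIMSEQ_ignore_initial_segment)
  qed
  then have "l2_norm g = 0" by (rule V_Inter)
  with tendsto_power[OF l2_tendsto_norm[OF proj_L2 gL g], of 2] show ?thesis by simp
qed

lemma scaling_coefficients:
  "((\<lambda>k::int. (cmod (l2_inner f (affine_dilation (scale j) (- of_int k) \<phi>)))\<^sup>2) has_sum (l2_norm (proj f j))\<^sup>2) UNIV"
proof -
  have "l2_inner (proj f j) (affine_dilation (scale j) (- of_int k) \<phi>) = l2_inner f (affine_dilation (scale j) (- of_int k) \<phi>)" for k :: int
    using scaling_basis[of j] by (intro proj_inner[OF _ order_refl]) (auto simp: orthonormal_basis_of_def)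
  with orthonormal_basis_Parseval[OF scaling_basis _ proj_in, of j] show ?thesis
    by (auto intro: V_L2)
qed

text \<open>The difference of consecutive projections lies in \<open>W j\<close>, and a basis
  element of \<open>W j\<close> has the same inner product with it as with \<open>f\<close>.
  Parseval in \<open>W j\<close> then gives an increment of squared norms.\<close>

lemma wavelet_coefficients:
  "((\<lambda>(l, k::int). (cmod (l2_inner f (affine_dilation (scale j) (- of_int k) (\<psi> l))))\<^sup>2) has_sum
     ((l2_norm (proj f (j + 1)))\<^sup>2 - (l2_norm (proj f j))\<^sup>2)) ({1..M - 1} \<times> UNIV)"
proof -
  let ?e = "\<lambda>(l, k::int). affine_dilation (scale j) (- of_int k) (\<psi> l)"
  let ?q = "\<lambda>x. proj f (j + 1) x - proj f j x"
  have qW: "?q \<in> W j"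
    unfolding W_def
  proof (intro CollectI conjI ballI)
    show "?q \<in> V (j + 1)"
      using V_step proj_in by (intro closed_l2_subspace_diff[OF V_closed]) auto
    fix g assume g: "g \<in> V j"
    show "l2_inner ?q g = 0"
      using proj_inner[OF g, of "j + 1"] proj_inner[OF g, of j] V_L2[OF g]
      by (simp add: l2_inner_diff_left proj_L2)
  qed
  have "l2_inner ?q (?e i) = l2_inner f (?e i)" if "i \<in> {1..M - 1} \<times> UNIV" for i
  proof -
    have eW: "?e i \<in> W j" by (rule orthonormal_basis_in[OF wavelet_basis that])
    have "l2_inner (proj f j) (?e i) = 0"
      using eW proj_in[of j] l2_inner_commute[of "proj f j" "?e i"] by (simp add: W_def)
    moreover have "l2_inner (proj f (j + 1)) (?e i) = l2_inner f (?e i)"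
      using eW by (intro proj_inner[OF _ order_refl]) (simp add: W_def)
    ultimately show ?thesis using W_L2[OF eW] by (simp add: l2_inner_diff_left proj_L2)
  qed
  note eq = this
  have "((\<lambda>i. (cmod (l2_inner ?q (?e i)))\<^sup>2) has_sum (l2_norm ?q)\<^sup>2) ({1..M - 1} \<times> UNIV)"
    by (rule orthonormal_basis_Parseval[OF wavelet_basis _ qW]) (auto intro: W_L2)
  then have "((\<lambda>i. (cmod (l2_inner f (?e i)))\<^sup>2) has_sum (l2_norm ?q)\<^sup>2) ({1..M - 1} \<times> UNIV)"
    by (rule has_sum_cong[THEN iffD1, rotated]) (simp only: eq)
  then show ?thesis
    using proj_diff_norm[of j "j + 1"] by (simp add: case_prod_beta')
qed

end

text \<open>The shift is \<open>+ k\<close> although the bases use \<open>- k\<close>: under the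
  transform it produces the phase with the sign required for the shearlets. Reindexing by negation
  preserves the sums.\<close>

definition scaling_atom :: "int \<Rightarrow> int \<Rightarrow> real \<Rightarrow> complex" where
  "scaling_atom j k = affine_dilation (scale j) (of_int k) \<phi>"

definition wavelet_atom :: "int \<times> nat \<times> int \<Rightarrow> real \<Rightarrow> complex" where
  "wavelet_atom = (\<lambda>(j, l, k). affine_dilation (scale j) (of_int k) (\<psi> l))"

lemma scaling_atom_L2: "scaling_atom j k \<in> L2"
  unfolding scaling_atom_def by (rule affine_dilation_L2[OF scale_pos scaling_L2])

lemma wavelet_atom_L2: "i \<in> UNIV \<times> {1..M - 1} \<times> UNIV \<Longrightarrow> wavelet_atom i \<in> L2"
  unfolding wavelet_atom_def by (auto intro!: affine_dilation_L2 scale_pos wavelet_L2)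

lemma scaling_atom_has_sum:
  assumes "f \<in> L2"
  shows "((\<lambda>k. (cmod (l2_inner f (scaling_atom j k)))\<^sup>2) has_sum (l2_norm (proj f j))\<^sup>2) UNIV"
  using scaling_coefficients[OF assms, of j]
  by (rule has_sum_reindex_bij_witness[where i=uminus and j=uminus, THEN iffD1, rotated -1])
     (auto simp: scaling_atom_def)

lemma wavelet_atom_has_sum:
  assumes "f \<in> L2"
  shows "((\<lambda>i. (cmod (l2_inner f (wavelet_atom (j, i))))\<^sup>2) has_sum
     ((l2_norm (proj f (j + 1)))\<^sup>2 - (l2_norm (proj f j))\<^sup>2)) ({1..M - 1} \<times> UNIV)"
  using wavelet_coefficients[OF assms, of j]
  by (rule has_sum_reindex_bij_witness[where i="map_prod id uminus" and j="map_prod id uminus", THEN iffD1, rotated -1])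
     (auto simp: wavelet_atom_def)

text \<open>Summed over all \<open>j\<close>, the increments telescope from the limit 0 at the
  bottom to the squared norm of \<open>f\<close> at the top.\<close>

lemma wavelet_frame: "tight_frame 1 (UNIV \<times> {1..M - 1} \<times> UNIV) wavelet_atom"
  unfolding tight_frame_def
proof (intro conjI ballI wavelet_atom_L2)
  fix f :: "real \<Rightarrow> complex" assume f: "f \<in> L2"
  have "((\<lambda>j. (l2_norm (proj f (j + 1)))\<^sup>2 - (l2_norm (proj f j))\<^sup>2) has_sum ((l2_norm f)\<^sup>2 - 0)) UNIV"
    using proj_norm_top[OF f, of 0] proj_norm_bot[OF f]
    by (intro has_sum_telescope_UNIV proj_norm_mono[OF f]) simp_all
  from has_sum_Sigma_nonneg[OF wavelet_atom_has_sum[OF f] this]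
  show "((\<lambda>i. (cmod (l2_inner f (wavelet_atom i)))\<^sup>2) has_sum 1 * (l2_norm f)\<^sup>2) (UNIV \<times> {1..M - 1} \<times> UNIV)"
    by simp
qed auto

text \<open>The telescope now starts at \<open>j0\<close>; the scaling functions contribute exactly
  the missing squared norm of \<open>proj f j0\<close>.\<close>

lemma inhomogeneous_wavelet_frame:
  "tight_frame 1 (UNIV <+> {j0..} \<times> {1..M - 1} \<times> UNIV) (case_sum (scaling_atom j0) wavelet_atom)"
  unfolding tight_frame_def
proof (intro conjI ballI)
  fix f :: "real \<Rightarrow> complex" assume f: "f \<in> L2"
  have "((\<lambda>j. (l2_norm (proj f (j + 1)))\<^sup>2 - (l2_norm (proj f j))\<^sup>2) has_sum
      ((l2_norm f)\<^sup>2 - (l2_norm (proj f j0))\<^sup>2)) {j0..}"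
    using proj_norm_top[OF f, of j0] by (intro has_sum_telescope_atLeast proj_norm_mono[OF f]) simp_all
  from has_sum_Sigma_nonneg[OF wavelet_atom_has_sum[OF f] this]
  have "((\<lambda>i. (cmod (l2_inner f (case_sum (scaling_atom j0) wavelet_atom i)))\<^sup>2) \<circ> Inr has_sum
      ((l2_norm f)\<^sup>2 - (l2_norm (proj f j0))\<^sup>2)) ({j0..} \<times> {1..M - 1} \<times> UNIV)"
    by (simp add: o_def)
  moreover have "((\<lambda>i. (cmod (l2_inner f (case_sum (scaling_atom j0) wavelet_atom i)))\<^sup>2) \<circ> Inl has_sum
      (l2_norm (proj f j0))\<^sup>2) UNIV"
    using scaling_atom_has_sum[OF f, of j0] by (simp add: o_def)
  ultimately have "((\<lambda>i. (cmod (l2_inner f (case_sum (scaling_atom j0) wavelet_atom i)))\<^sup>2) has_sum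
      ((l2_norm (proj f j0))\<^sup>2 + ((l2_norm f)\<^sup>2 - (l2_norm (proj f j0))\<^sup>2)))
      (UNIV <+> {j0..} \<times> {1..M - 1} \<times> UNIV)"
    by (rule has_sum_Plus[rotated])
  then show "((\<lambda>i. (cmod (l2_inner f (case_sum (scaling_atom j0) wavelet_atom i)))\<^sup>2) has_sum 1 * (l2_norm f)\<^sup>2)
      (UNIV <+> {j0..} \<times> {1..M - 1} \<times> UNIV)"
    by simp
qed (use wavelet_atom_L2 in \<open>auto simp: scaling_atom_L2 split: sum.split\<close>)

lemma scaling_norm: "l2_norm \<phi> = 1"
  using orthonormal_basis_norm[OF V_basis, of 0] by simp

lemma wavelet_norm: "l \<in> {1..M - 1} \<Longrightarrow> l2_norm (\<psi> l) = 1"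
  using orthonormal_basis_norm[OF wavelet_basis, of "(l, 0)" 0]
  by (simp add: scale_def affine_dilation_def[abs_def])

end

section \<open>Shear coordinates\<close>

text \<open>The first shear coordinate as a function of one variable. The sign makes it an
  increasing bijection of the line.\<close>

definition half_square :: "real \<Rightarrow> real" where
  "half_square x = 1/2 * sgn x * x\<^sup>2"

definition half_square_inv :: "real \<Rightarrow> real" where
  "half_square_inv y = sgn y * sqrt (2 * \<bar>y\<bar>)"

lemma half_square_inv_left: "half_square_inv (half_square x) = x"
  by (cases "x > 0"; cases "x = 0") (auto simp: half_square_def half_square_inv_def sgn_if abs_mult real_sqrt_abs mult_less_0_iff)

lemma half_square_inv_right: "half_square (half_square_inv y) = y"
  by (cases "y > 0"; cases "y = 0") (auto simp: half_square_def half_square_inv_def sgn_if mult_less_0_iff power_mult_distrib)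

lemma has_real_derivative_half_square: "(half_square has_real_derivative \<bar>x\<bar>) (at x)"
proof -
  consider "x > 0" | "x < 0" | "x = 0" by linarith
  then show ?thesis
  proof cases
    case 1
    have "((\<lambda>x. x\<^sup>2 / 2) has_real_derivative \<bar>x\<bar>) (at x)"
      using 1 by (auto intro!: derivative_eq_intros)
    then show ?thesis
      by (rule has_field_derivative_transform_within_open[where S="{0<..}"])
         (use 1 in \<open>auto simp: half_square_def\<close>)
  next
    case 2
    have "((\<lambda>x. - (x\<^sup>2 / 2)) has_real_derivative \<bar>x\<bar>) (at x)"
      using 2 by (auto intro!: derivative_eq_intros)
    then show ?thesis
      by (rule has_field_derivative_transform_within_open[where S="{..<0}"])
         (use 2 in \<open>auto simp: half_square_def\<close>)
  next
    case 3
    \<comment> \<open>The two branches meet at 0, where the difference quotient is |h| / 2.\<close>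
    have "((\<lambda>h. \<bar>h\<bar> / 2) \<longlongrightarrow> \<bar>0\<bar> / 2) (at (0::real))"
      by (intro tendsto_intros) simp
    moreover have "\<forall>\<^sub>F h in at 0. \<bar>h\<bar> / 2 = half_square h / h"
      by (auto simp: eventually_at_filter half_square_def sgn_if power2_eq_square)
    ultimately have "((\<lambda>h. half_square h / h) \<longlongrightarrow> 0) (at 0)"
      using Lim_transform_eventually by force
    then show ?thesis
      using 3 by (simp add: has_field_derivative_iff half_square_def)
  qed
qed

lemma half_square_strict_mono: "half_square x < half_square y \<longleftrightarrow> x < y"
proof -
  have *: "half_square x \<le> half_square y" if "x \<le> y" for x y
    by (rule DERIV_nonneg_imp_nondecreasing[OF that]) (use has_real_derivative_half_square in fastforce)
  then show ?thesis
    using half_square_inv_left by (metis linorder_not_le order_antisym order_less_imp_le)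
qed

lemma half_square_measurable [measurable]: "half_square \<in> borel_measurable borel"
  unfolding half_square_def[abs_def] by measurable

lemma half_square_inv_measurable [measurable]: "half_square_inv \<in> borel_measurable borel"
  unfolding half_square_inv_def[abs_def] by measurable

text \<open>The substitution rule with derivative |x|, checked on intervals: this density is half of
  the Jacobian of the shear coordinates.\<close>

lemma half_square_distr:
  "distr (density lborel (\<lambda>x. ennreal \<bar>x\<bar>)) borel half_square = lborel"
proof (rule lborel_eqI[symmetric])
  fix l u :: real
  assume "\<And>b. b \<in> Basis \<Longrightarrow> l \<bullet> b \<le> u \<bullet> b"
  then have lu: "l \<le> u" by simp
  define a c where "a = half_square_inv l" and "c = half_square_inv u"
  have ac: "half_square a = l" "half_square c = u"
    by (simp_all add: a_def c_def half_square_inv_right)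
  have "a \<le> c" using lu half_square_strict_mono[of c a] ac by simp
  have "emeasure (distr (density lborel (\<lambda>x. ennreal \<bar>x\<bar>)) borel half_square) (box l u) =
      emeasure (density lborel (\<lambda>x. ennreal \<bar>x\<bar>)) {a<..<c}"
  proof -
    have "half_square -` box l u = {a<..<c}"
      by (auto simp: ac[symmetric] half_square_strict_mono)
    then show ?thesis by (simp add: emeasure_distr)
  qed
  also have "\<dots> = (\<integral>\<^sup>+x. ennreal \<bar>x\<bar> * indicator {a<..<c} x \<partial>lborel)"
    by (simp add: emeasure_density)
  also have "\<dots> = (\<integral>\<^sup>+x. ennreal (\<bar>x\<bar> * indicator {a..c} x) \<partial>lborel)"
  proof (rule nn_integral_cong_AE)
    \<comment> \<open>The substitution theorem speaks of closed intervals, the uniqueness of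
      Lebesgue measure of open ones; the endpoints are null.\<close>
    show "AE x in lborel. ennreal \<bar>x\<bar> * indicator {a<..<c} x = ennreal (\<bar>x\<bar> * indicator {a..c} x)"
      using AE_lborel_singleton[of a] AE_lborel_singleton[of c]
      by eventually_elim (auto simp: indicator_def)
  qed
  also have "\<dots> = (\<integral>\<^sup>+y. ennreal (indicator {half_square a..half_square c} y) \<partial>lborel)"
    using nn_integral_substitution[where f="\<lambda>_. 1" and g=half_square and g'="\<lambda>x. \<bar>x\<bar>" and a=a and b=c] \<open>a \<le> c\<close>
    by (simp add: has_real_derivative_half_square continuous_intros set_borel_measurable_def)
  also have "\<dots> = ennreal (u - l)"
    using lu by (simp add: ac ennreal_indicator)
  finally show "emeasure (distr (density lborel (\<lambda>x. ennreal \<bar>x\<bar>)) borel half_square) (box l u) = (\<Prod>b\<in>Basis. (u - l) \<bullet> b)"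
    by simp
qed simp

section \<open>The measure-preserving map of the plane\<close>

definition shear_coords :: "real \<times> real \<Rightarrow> real \<times> real" where
  "shear_coords \<xi> = (\<gamma>\<^sub>1 \<xi>, \<gamma>\<^sub>2 \<xi>)"

lemma shear_coords_eq: "shear_coords (x, y) = (half_square x, y / x)"
  by (simp add: shear_coords_def \<gamma>\<^sub>1_def \<gamma>\<^sub>2_def half_square_def)

lemma shear_coords_measurable [measurable]: "shear_coords \<in> borel_measurable borel"
proof -
  have "(\<lambda>\<xi>::real \<times> real. (half_square (fst \<xi>), snd \<xi> / fst \<xi>)) \<in> borel \<Otimes>\<^sub>M borel \<rightarrow>\<^sub>M borel \<Otimes>\<^sub>M borel"
    by measurable
  moreover have "shear_coords = (\<lambda>\<xi>. (half_square (fst \<xi>), snd \<xi> / fst \<xi>))"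
    by (rule ext) (metis prod.collapse shear_coords_eq)
  ultimately show ?thesis by (simp add: borel_prod)
qed

text \<open>The Jacobian is \<open>\<bar>\<xi>\<^sub>1\<bar> \<sqdot> 1 / \<bar>\<xi>\<^sub>1\<bar> = 1\<close>.\<close>

lemma shear_coords_distr: "distr lborel borel shear_coords = lborel"
proof (rule measure_eqI)
  fix A :: "(real \<times> real) set" assume "A \<in> sets (distr lborel borel shear_coords)"
  then have A [measurable]: "A \<in> sets borel" by simp
  have [measurable]: "(\<lambda>p. indicator A p :: ennreal) \<in> borel_measurable (lborel \<Otimes>\<^sub>M lborel)"
    unfolding lborel_prod by simp
  have [measurable]: "(\<lambda>p. indicator A (shear_coords p) :: ennreal) \<in> borel_measurable (lborel \<Otimes>\<^sub>M lborel)"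
    unfolding lborel_prod by simp
  define H where "H x = (\<integral>\<^sup>+y. indicator A (x, y) \<partial>lborel)" for x :: real
  have H [measurable]: "H \<in> borel_measurable borel"
    using lborel.borel_measurable_nn_integral_fst[of "indicator A" lborel] by (simp add: H_def[abs_def])
  have "emeasure (distr lborel borel shear_coords) A = (\<integral>\<^sup>+\<xi>. indicator A (shear_coords \<xi>) \<partial>lborel)"
  proof -
    have "emeasure (distr lborel borel shear_coords) A = (\<integral>\<^sup>+\<eta>. indicator A \<eta> \<partial>distr lborel borel shear_coords)"
      by simp
    also have "\<dots> = (\<integral>\<^sup>+\<xi>. indicator A (shear_coords \<xi>) \<partial>lborel)"
      by (rule nn_integral_distr) measurable
    finally show ?thesis .
  qed
  also have "\<dots> = (\<integral>\<^sup>+x. \<integral>\<^sup>+y. indicator A (shear_coords (x, y)) \<partial>lborel \<partial>lborel)"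
    unfolding lborel_prod[symmetric] by (rule lborel.nn_integral_fst[symmetric]) measurable
  also have "\<dots> = (\<integral>\<^sup>+x. ennreal \<bar>x\<bar> * H (half_square x) \<partial>lborel)"
  proof (rule nn_integral_cong_AE)
    show "AE x in lborel. (\<integral>\<^sup>+y. indicator A (shear_coords (x, y)) \<partial>lborel) = ennreal \<bar>x\<bar> * H (half_square x)"
      using AE_lborel_singleton[of 0]
    proof eventually_elim
      case (elim x)
      have [measurable]: "(\<lambda>y. (half_square x, y / x)) \<in> borel_measurable borel"
        by (intro borel_measurable_continuous_onI continuous_intros) (use elim in auto)
      \<comment> \<open>On the vertical line over \<open>x\<close> the substitution of
        \<open>x * y\<close> for \<open>y\<close> undoes the division and produces |x|, the density
        pushed forward by \<open>half_square\<close>.\<close>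
      have "(\<integral>\<^sup>+y. indicator A (half_square x, y / x) \<partial>lborel) = \<bar>x\<bar> * (\<integral>\<^sup>+y. indicator A (half_square x, (0 + x * y) / x) \<partial>lborel)"
        using elim by (intro nn_integral_real_affine) measurable
      then show ?case using elim by (simp add: shear_coords_eq H_def)
    qed
  qed
  also have "\<dots> = (\<integral>\<^sup>+x. H x \<partial>distr (density lborel (\<lambda>x. ennreal \<bar>x\<bar>)) borel half_square)"
    by (simp add: nn_integral_distr nn_integral_density)
  also have "\<dots> = (\<integral>\<^sup>+x. H x \<partial>lborel)"
    by (simp only: half_square_distr)
  also have "\<dots> = (\<integral>\<^sup>+p. indicator A p \<partial>(lborel \<Otimes>\<^sub>M lborel))"
    unfolding H_def by (rule lborel.nn_integral_fst) measurable
  also have "\<dots> = emeasure lborel A"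
    by (simp add: lborel_prod)
  finally show "emeasure (distr lborel borel shear_coords) A = emeasure lborel A" .
qed simp

definition shear_coords_inv :: "real \<times> real \<Rightarrow> real \<times> real" where
  "shear_coords_inv \<eta> = (half_square_inv (fst \<eta>), snd \<eta> * half_square_inv (fst \<eta>))"

lemma shear_coords_inv_measurable [measurable]: "shear_coords_inv \<in> borel_measurable borel"
proof -
  have "(\<lambda>\<eta>::real \<times> real. (half_square_inv (fst \<eta>), snd \<eta> * half_square_inv (fst \<eta>))) \<in> borel \<Otimes>\<^sub>M borel \<rightarrow>\<^sub>M borel \<Otimes>\<^sub>M borel"
    by measurable
  then show ?thesis by (simp add: borel_prod shear_coords_inv_def[abs_def])
qed

text \<open>Failure is confined to the axis where the first coordinate is 0: division by zero
  collapses it to one point, but it is null.\<close>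

lemma AE_shear_coords_inv: "AE \<xi> in lborel. shear_coords_inv (shear_coords \<xi>) = \<xi>"
proof -
  have "AE \<xi> in lborel \<Otimes>\<^sub>M lborel. fst \<xi> \<noteq> (0::real)"
  proof (rule lborel_pair.AE_pair_measure)
    show "AE x in lborel. AE y in lborel. fst (x, y) \<noteq> (0::real)"
      using AE_lborel_singleton[of "0::real"] by eventually_elim simp
  qed measurable
  then have "AE \<xi> in lborel \<Otimes>\<^sub>M (lborel :: real measure). shear_coords_inv (shear_coords \<xi>) = \<xi>"
  proof eventually_elim
    case (elim \<xi>)
    then show ?case
      by (cases \<xi>) (simp add: shear_coords_eq shear_coords_inv_def half_square_inv_left)
  qed
  then show ?thesis by (simp only: lborel_prod)
qed

lemma L2_shear_coords:
  assumes f: "f \<in> borel_measurable borel"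
  shows "(\<lambda>\<xi>. f (shear_coords \<xi>)) \<in> L2 \<longleftrightarrow> f \<in> L2"
proof -
  note [measurable] = f
  have "integrable lborel (\<lambda>x. (cmod (f x))\<^sup>2) \<longleftrightarrow> integrable (distr lborel borel shear_coords) (\<lambda>x. (cmod (f x))\<^sup>2)"
    by (simp only: shear_coords_distr)
  also have "\<dots> \<longleftrightarrow> integrable lborel (\<lambda>\<xi>. (cmod (f (shear_coords \<xi>)))\<^sup>2)"
    by (rule integrable_distr_eq) measurable
  finally show ?thesis by (simp add: L2_def)
qed

lemma l2_inner_shear_coords:
  assumes [measurable]: "f \<in> borel_measurable borel" "g \<in> borel_measurable borel"
  shows "l2_inner (\<lambda>\<xi>. f (shear_coords \<xi>)) (\<lambda>\<xi>. g (shear_coords \<xi>)) = l2_inner f g"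
proof -
  have "l2_inner f g = (LINT x|distr lborel borel shear_coords. f x * cnj (g x))"
    by (simp only: shear_coords_distr l2_inner_def)
  also have "\<dots> = l2_inner (\<lambda>\<xi>. f (shear_coords \<xi>)) (\<lambda>\<xi>. g (shear_coords \<xi>))"
    unfolding l2_inner_def by (rule integral_distr) measurable
  finally show ?thesis by simp
qed

lemma l2_norm_shear_coords:
  assumes "f \<in> borel_measurable borel"
  shows "l2_norm (\<lambda>\<xi>. f (shear_coords \<xi>)) = l2_norm f"
  using l2_inner_shear_coords[OF assms assms]
  by (simp add: l2_inner_self of_real_eq_iff power2_eq_iff_nonneg del: of_real_power)

text \<open>Measure preservation gives the isometry. The measurable inverse gives surjectivity:
  every \<open>f\<close> is almost everywhere a function \<open>g\<close> of the shear coordinates,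
  on which the given frame can be tested.\<close>

lemma tight_frame_shear_coords:
  assumes "tight_frame a I e"
  shows "tight_frame a I (\<lambda>i \<xi>. e i (shear_coords \<xi>))"
  unfolding tight_frame_def
proof (intro conjI ballI)
  have e: "e i \<in> L2" if "i \<in> I" for i using assms that by (simp add: tight_frame_def)
  show "(\<lambda>\<xi>. e i (shear_coords \<xi>)) \<in> L2" if "i \<in> I" for i
    using e[OF that] L2_shear_coords L2_measurable by blast
  fix f :: "real \<times> real \<Rightarrow> complex" assume f: "f \<in> L2"
  note [measurable] = L2_measurable[OF f]
  define g where "g \<eta> = f (shear_coords_inv \<eta>)" for \<eta>
  have gm [measurable]: "g \<in> borel_measurable borel" unfolding g_def[abs_def] by measurable
  have AE: "AE \<xi> in lborel. g (shear_coords \<xi>) = f \<xi>"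
    using AE_shear_coords_inv by eventually_elim (simp add: g_def)
  have "integrable lborel (\<lambda>\<xi>. (cmod (g (shear_coords \<xi>)))\<^sup>2) \<longleftrightarrow> integrable lborel (\<lambda>\<xi>. (cmod (f \<xi>))\<^sup>2)"
    by (rule integrable_cong_AE) (use AE in auto)
  then have gL: "g \<in> L2"
    using L2_integrable[OF f] by (subst L2_shear_coords[OF gm, symmetric]) (auto intro!: L2I)
  have "l2_norm f = l2_norm (\<lambda>\<xi>. g (shear_coords \<xi>))"
    by (rule l2_norm_cong_AE) (use AE in auto)
  then have norm: "l2_norm f = l2_norm g" by (simp add: l2_norm_shear_coords)
  have inner: "l2_inner f (\<lambda>\<xi>. e i (shear_coords \<xi>)) = l2_inner g (e i)" if "i \<in> I" for i
  proof -
    note [measurable] = L2_measurable[OF e[OF that]]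
    have "l2_inner f (\<lambda>\<xi>. e i (shear_coords \<xi>)) = l2_inner (\<lambda>\<xi>. g (shear_coords \<xi>)) (\<lambda>\<xi>. e i (shear_coords \<xi>))"
      unfolding l2_inner_def by (rule integral_cong_AE) (use AE in auto)
    then show ?thesis by (simp add: l2_inner_shear_coords)
  qed
  have "((\<lambda>i. (cmod (l2_inner g (e i)))\<^sup>2) has_sum a * (l2_norm g)\<^sup>2) I"
    using assms gL by (simp add: tight_frame_def)
  then show "((\<lambda>i. (cmod (l2_inner f (\<lambda>\<xi>. e i (shear_coords \<xi>))))\<^sup>2) has_sum a * (l2_norm f)\<^sup>2) I"
    unfolding norm by (rule has_sum_cong[THEN iffD1, rotated]) (simp only: inner)
qed

section \<open>Tensor products of frames and the shearlet systems\<close>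

text \<open>Turns an unordered sum into an integral over counting measure, so that Tonelli can
  exchange it with a Lebesgue integral.\<close>

lemma has_sum_nn_integral_count_space:
  fixes f :: "'i \<Rightarrow> real"
  assumes nn: "\<And>i. 0 \<le> f i" and s: "0 \<le> s"
  shows "(f has_sum s) I \<longleftrightarrow> (\<integral>\<^sup>+i. ennreal (f i) \<partial>count_space I) = ennreal s"
proof
  assume "(f has_sum s) I"
  then have "f summable_on I" and inf: "infsum f I = s"
    by (auto simp: has_sum_imp_summable infsumI)
  then have abs: "Infinite_Set_Sum.abs_summable_on f I"
    using nn by (simp add: abs_summable_equivalent[symmetric])
  then have "integrable (count_space I) f" by (simp add: abs_summable_on_def)
  then have "(\<integral>\<^sup>+i. ennreal (f i) \<partial>count_space I) = ennreal (integral\<^sup>L (count_space I) f)"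
    by (rule nn_integral_eq_integral) (use nn in auto)
  then show "(\<integral>\<^sup>+i. ennreal (f i) \<partial>count_space I) = ennreal s"
    using infsetsum_infsum[OF abs] inf by (simp add: infsetsum_def)
next
  assume *: "(\<integral>\<^sup>+i. ennreal (f i) \<partial>count_space I) = ennreal s"
  have int: "integrable (count_space I) f"
    by (rule integrableI_nonneg) (use nn * in auto)
  then have abs: "Infinite_Set_Sum.abs_summable_on f I" by (simp add: abs_summable_on_def)
  have "ennreal (integral\<^sup>L (count_space I) f) = ennreal s"
    using nn_integral_eq_integral[OF int] nn * by simp
  then have "infsum f I = s"
    using infsetsum_infsum[OF abs] s nn by (simp add: infsetsum_def integral_nonneg_AE)
  moreover have "f summable_on I"
    using abs nn by (simp add: abs_summable_equivalent[symmetric])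
  ultimately show "(f has_sum s) I" using has_sum_infsum by blast
qed

definition tensor :: "(real \<Rightarrow> complex) \<Rightarrow> (real \<Rightarrow> complex) \<Rightarrow> real \<times> real \<Rightarrow> complex" where
  "tensor u v p = u (fst p) * v (snd p)"

lemma measurable_lborel_pair:
  "measurable (lborel \<Otimes>\<^sub>M lborel) N = measurable (borel :: (real \<times> real) measure) N"
  by (simp add: lborel_prod)

lemma tensor_measurable:
  assumes [measurable]: "u \<in> borel_measurable borel" "v \<in> borel_measurable borel"
  shows "tensor u v \<in> borel_measurable borel"
proof -
  have "tensor u v \<in> borel_measurable (lborel \<Otimes>\<^sub>M lborel)"
    unfolding tensor_def[abs_def] by measurable
  then show ?thesis by (simp only: measurable_lborel_pair)
qed

lemma tensor_L2_norm:
  assumes u: "u \<in> L2" and v: "v \<in> L2"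
  shows "tensor u v \<in> L2" "l2_norm (tensor u v) = l2_norm u * l2_norm v"
proof -
  note [measurable] = L2_measurable[OF u] L2_measurable[OF v]
  have m: "tensor u v \<in> borel_measurable borel" by (rule tensor_measurable) measurable
  have "(\<integral>\<^sup>+p. ennreal ((cmod (tensor u v p))\<^sup>2) \<partial>lborel) =
      (\<integral>\<^sup>+x. \<integral>\<^sup>+y. ennreal ((cmod (tensor u v (x, y)))\<^sup>2) \<partial>lborel \<partial>lborel)"
    unfolding lborel_prod[symmetric]
    by (rule lborel.nn_integral_fst[symmetric]) (use m in \<open>simp add: measurable_lborel_pair\<close>)
  also have "\<dots> = (\<integral>\<^sup>+x. ennreal ((cmod (u x))\<^sup>2) * ennreal ((l2_norm v)\<^sup>2) \<partial>lborel)"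
    by (intro nn_integral_cong)
       (simp add: tensor_def norm_mult power_mult_distrib ennreal_mult nn_integral_cmult nn_integral_l2_norm[OF v])
  also have "\<dots> = ennreal ((l2_norm u * l2_norm v)\<^sup>2)"
    by (simp add: nn_integral_multc nn_integral_l2_norm[OF u] power_mult_distrib ennreal_mult)
  finally have eq: "(\<integral>\<^sup>+p. ennreal ((cmod (tensor u v p))\<^sup>2) \<partial>lborel) = ennreal ((l2_norm u * l2_norm v)\<^sup>2)" .
  show L: "tensor u v \<in> L2"
    by (rule L2_I_nn(1)[OF m eq_refl[OF eq]]) simp
  have "(l2_norm (tensor u v))\<^sup>2 = (l2_norm u * l2_norm v)\<^sup>2"
    using eq nn_integral_l2_norm[OF L] by simp
  then show "l2_norm (tensor u v) = l2_norm u * l2_norm v"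
    by (rule power2_eq_imp_eq) simp_all
qed

text \<open>The coefficient of the horizontal slice of \<open>F\<close> at height \<open>y\<close>
  with respect to \<open>u\<close>, as a function of \<open>y\<close>.\<close>

definition partial_inner :: "(real \<times> real \<Rightarrow> complex) \<Rightarrow> (real \<Rightarrow> complex) \<Rightarrow> real \<Rightarrow> complex" where
  "partial_inner F u y = (LINT x|lborel. F (x, y) * cnj (u x))"

lemma partial_inner_measurable:
  assumes F: "F \<in> borel_measurable borel" and [measurable]: "u \<in> borel_measurable borel"
  shows "partial_inner F u \<in> borel_measurable borel"
proof -
  have [measurable]: "F \<in> borel_measurable (borel \<Otimes>\<^sub>M borel)"
    using F by (simp add: borel_prod)
  have "(\<lambda>(y, x). F (x, y) * cnj (u x)) \<in> borel_measurable (borel \<Otimes>\<^sub>M lborel)"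
    by measurable
  from sigma_finite_measure.borel_measurable_lebesgue_integral[OF sigma_finite_lborel this]
  show ?thesis by (simp add: partial_inner_def[abs_def])
qed

lemma l2_inner_tensor:
  assumes F: "F \<in> L2" and u: "u \<in> L2" and v: "v \<in> L2"
  shows "l2_inner F (tensor u v) = l2_inner (partial_inner F u) v"
proof -
  have "integrable (lborel \<Otimes>\<^sub>M lborel) (\<lambda>(x, y). F (x, y) * cnj (tensor u v (x, y)))"
    using L2_inner_integrable[OF F tensor_L2_norm(1)[OF u v]] by (simp add: lborel_prod case_prod_beta')
  from lborel_pair.integral_snd[OF this]
  have "l2_inner F (tensor u v) = (LINT y|lborel. LINT x|lborel. F (x, y) * cnj (tensor u v (x, y)))"
    by (simp add: l2_inner_def lborel_prod case_prod_beta')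
  also have "\<dots> = (LINT y|lborel. partial_inner F u y * cnj (v y))"
  proof (intro Bochner_Integration.integral_cong refl)
    fix y :: real
    have "(LINT x|lborel. F (x, y) * cnj (tensor u v (x, y))) = (LINT x|lborel. (F (x, y) * cnj (u x)) * cnj (v y))"
      by (simp add: tensor_def mult.assoc)
    also have "\<dots> = partial_inner F u y * cnj (v y)"
      unfolding partial_inner_def by (rule integral_mult_left_zero)
    finally show "(LINT x|lborel. F (x, y) * cnj (tensor u v (x, y))) = partial_inner F u y * cnj (v y)" .
  qed
  finally show ?thesis by (simp add: l2_inner_def)
qed

text \<open>Parseval is applied to each slice and integrated over \<open>y\<close>. Countability of
  \<open>I\<close> allows sum and integral to be exchanged.\<close>

lemma partial_inner_has_sum:
  assumes I: "countable I" and u: "tight_frame 1 I u" and F: "F \<in> L2"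
  shows "i \<in> I \<Longrightarrow> partial_inner F (u i) \<in> L2"
    and "((\<lambda>i. (l2_norm (partial_inner F (u i)))\<^sup>2) has_sum (l2_norm F)\<^sup>2) I"
proof -
  have uL: "u i \<in> L2" if "i \<in> I" for i using u that by (simp add: tight_frame_def)
  note Fm = L2_measurable[OF F]
  have [measurable]: "F \<in> borel_measurable (borel \<Otimes>\<^sub>M borel)" using Fm by (simp add: borel_prod)
  have pm: "partial_inner F (u i) \<in> borel_measurable borel" if "i \<in> I" for i
    by (rule partial_inner_measurable[OF Fm L2_measurable[OF uL[OF that]]])
  let ?n = "\<lambda>y. \<integral>\<^sup>+x. ennreal ((cmod (F (x, y)))\<^sup>2) \<partial>lborel"
  have "(\<integral>\<^sup>+y. ?n y \<partial>lborel) = (\<integral>\<^sup>+p. ennreal ((cmod (F p))\<^sup>2) \<partial>(lborel \<Otimes>\<^sub>M lborel))"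
    by (rule lborel_pair.nn_integral_snd) measurable
  then have tot: "(\<integral>\<^sup>+y. ?n y \<partial>lborel) = ennreal ((l2_norm F)\<^sup>2)"
    by (simp add: lborel_prod nn_integral_l2_norm[OF F])
  \<comment> \<open>Only almost every slice is square-integrable, which is enough under the
    integral.\<close>
  have "AE y in lborel. ?n y \<noteq> \<infinity>"
    by (rule nn_integral_PInf_AE) (use tot in auto)
  then have AE: "AE y in lborel. (\<integral>\<^sup>+i. ennreal ((cmod (partial_inner F (u i) y))\<^sup>2) \<partial>count_space I) = ?n y"
  proof eventually_elim
    case (elim y)
    have L: "(\<lambda>x. F (x, y)) \<in> L2"
      by (rule L2I, measurable, rule integrableI_nonneg) (use elim in \<open>auto simp: less_top\<close>)
    have "((\<lambda>i. (cmod (l2_inner (\<lambda>x. F (x, y)) (u i)))\<^sup>2) has_sum 1 * (l2_norm (\<lambda>x. F (x, y)))\<^sup>2) I"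
      using u L unfolding tight_frame_def by blast
    then have "(\<integral>\<^sup>+i. ennreal ((cmod (l2_inner (\<lambda>x. F (x, y)) (u i)))\<^sup>2) \<partial>count_space I) = ennreal ((l2_norm (\<lambda>x. F (x, y)))\<^sup>2)"
      by (subst has_sum_nn_integral_count_space[symmetric]) auto
    then show ?case
      by (simp add: nn_integral_l2_norm[OF L] l2_inner_def partial_inner_def)
  qed
  have "(\<integral>\<^sup>+i. \<integral>\<^sup>+y. ennreal ((cmod (partial_inner F (u i) y))\<^sup>2) \<partial>lborel \<partial>count_space I) =
      (\<integral>\<^sup>+y. \<integral>\<^sup>+i. ennreal ((cmod (partial_inner F (u i) y))\<^sup>2) \<partial>count_space I \<partial>lborel)"
    by (rule nn_integral_count_space_nn_integral[OF I, symmetric]) (use pm in simp)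
  also have "\<dots> = (\<integral>\<^sup>+y. ?n y \<partial>lborel)"
    by (rule nn_integral_cong_AE[OF AE])
  finally have sum: "(\<integral>\<^sup>+i. \<integral>\<^sup>+y. ennreal ((cmod (partial_inner F (u i) y))\<^sup>2) \<partial>lborel \<partial>count_space I) = ennreal ((l2_norm F)\<^sup>2)"
    unfolding tot .
  \<comment> \<open>For counting measure almost every index means every index, so the finite total
    puts each \<open>partial_inner F (u i)\<close> in \<open>L2\<close>.\<close>
  have "AE i in count_space I. (\<integral>\<^sup>+y. ennreal ((cmod (partial_inner F (u i) y))\<^sup>2) \<partial>lborel) \<noteq> \<infinity>"
    by (rule nn_integral_PInf_AE) (use sum in auto)
  then have fin: "(\<integral>\<^sup>+y. ennreal ((cmod (partial_inner F (u i) y))\<^sup>2) \<partial>lborel) \<noteq> \<infinity>" if "i \<in> I" for i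
    using that by (simp add: AE_count_space)
  show pL: "partial_inner F (u i) \<in> L2" if "i \<in> I" for i
    by (rule L2I[OF pm[OF that]], rule integrableI_nonneg) (use pm[OF that] fin[OF that] in \<open>auto simp: less_top\<close>)
  have "(\<integral>\<^sup>+i. ennreal ((l2_norm (partial_inner F (u i)))\<^sup>2) \<partial>count_space I) = ennreal ((l2_norm F)\<^sup>2)"
    unfolding sum[symmetric] by (rule nn_integral_cong) (simp add: nn_integral_l2_norm[OF pL])
  then show "((\<lambda>i. (l2_norm (partial_inner F (u i)))\<^sup>2) has_sum (l2_norm F)\<^sup>2) I"
    by (subst has_sum_nn_integral_count_space) auto
qed

text \<open>Pairing with a tensor product is pairing \<open>partial_inner F (u i)\<close> with
  \<open>v i k\<close>; the sum over \<open>k\<close> gives \<open>a\<close> times its squared norm,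
  and these norms have just been summed.\<close>

lemma tight_frame_tensor:
  assumes I: "countable I" and u: "tight_frame 1 I u" and v: "\<And>i. i \<in> I \<Longrightarrow> tight_frame a K (v i)"
  shows "tight_frame a (I \<times> K) (\<lambda>(i, k). tensor (u i) (v i k))"
  unfolding tight_frame_def
proof (intro conjI ballI)
  have uL: "u i \<in> L2" if "i \<in> I" for i using u that by (simp add: tight_frame_def)
  have vL: "v i k \<in> L2" if "i \<in> I" "k \<in> K" for i k using v that by (simp add: tight_frame_def)
  show "(case p of (i, k) \<Rightarrow> tensor (u i) (v i k)) \<in> L2" if "p \<in> I \<times> K" for p
    using that by (auto intro!: tensor_L2_norm uL vL)
  fix F :: "real \<times> real \<Rightarrow> complex" assume F: "F \<in> L2"
  show "((\<lambda>p. (cmod (l2_inner F (case p of (i, k) \<Rightarrow> tensor (u i) (v i k))))\<^sup>2) has_sum a * (l2_norm F)\<^sup>2) (I \<times> K)"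
  proof (rule has_sum_Sigma_nonneg[where g="\<lambda>i. a * (l2_norm (partial_inner F (u i)))\<^sup>2"])
    fix i assume i: "i \<in> I"
    have "((\<lambda>k. (cmod (l2_inner (partial_inner F (u i)) (v i k)))\<^sup>2) has_sum a * (l2_norm (partial_inner F (u i)))\<^sup>2) K"
      using v[OF i] partial_inner_has_sum(1)[OF I u F i] by (simp add: tight_frame_def)
    then show "((\<lambda>k. (cmod (l2_inner F (case (i, k) of (i, k) \<Rightarrow> tensor (u i) (v i k))))\<^sup>2) has_sum a * (l2_norm (partial_inner F (u i)))\<^sup>2) K"
      by (rule has_sum_cong[THEN iffD1, rotated]) (simp add: l2_inner_tensor[OF F uL[OF i] vL[OF i]])
  qed (use has_sum_cmult_right[OF partial_inner_has_sum(2)[OF I u F]] in auto)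
qed

section \<open>Transport of tight frames along unitary maps and reindexings\<close>

lemma tight_frame_fourier:
  fixes e :: "'i \<Rightarrow> 'a::euclidean_space \<Rightarrow> complex"
  assumes "tight_frame a I e" and E: "\<And>i. i \<in> I \<Longrightarrow> has_L2_fourier (e i) (E i)"
  shows "tight_frame a I E"
  unfolding tight_frame_def
proof (intro conjI ballI)
  show "E i \<in> L2" if "i \<in> I" for i by (rule has_L2_fourier_L2(2)[OF E[OF that]])
  fix F :: "'a \<Rightarrow> complex" assume "F \<in> L2"
  \<comment> \<open>Surjectivity of the transform: the identity for \<open>F\<close> is read off
    from a preimage.\<close>
  then obtain f where f: "has_L2_fourier f F" using inv_has_L2_fourier_exists by blast
  have "((\<lambda>i. (cmod (l2_inner f (e i)))\<^sup>2) has_sum a * (l2_norm f)\<^sup>2) I"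
    using assms(1) has_L2_fourier_L2(1)[OF f] by (simp add: tight_frame_def)
  then show "((\<lambda>i. (cmod (l2_inner F (E i)))\<^sup>2) has_sum a * (l2_norm F)\<^sup>2) I"
    unfolding has_L2_fourier_norm[OF f]
    by (rule has_sum_cong[THEN iffD1, rotated]) (simp add: has_L2_fourier_inner[OF f E])
qed

lemma tight_frame_inv_L2_fourier:
  fixes E :: "'i \<Rightarrow> 'a::euclidean_space \<Rightarrow> complex"
  assumes "tight_frame a I E"
  shows "tight_frame a I (\<lambda>i. inv_L2_fourier (E i))"
  unfolding tight_frame_def
proof (intro conjI ballI)
  have E: "has_L2_fourier (inv_L2_fourier (E i)) (E i)" if "i \<in> I" for i
    using assms that by (intro has_L2_fourier_inv_L2_fourier) (simp add: tight_frame_def)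
  show "inv_L2_fourier (E i) \<in> L2" if "i \<in> I" for i by (rule has_L2_fourier_L2(1)[OF E[OF that]])
  fix f :: "'a \<Rightarrow> complex" assume "f \<in> L2"
  then obtain F where F: "has_L2_fourier f F" using has_L2_fourier_exists by blast
  have "((\<lambda>i. (cmod (l2_inner F (E i)))\<^sup>2) has_sum a * (l2_norm F)\<^sup>2) I"
    using assms has_L2_fourier_L2(2)[OF F] by (simp add: tight_frame_def)
  then show "((\<lambda>i. (cmod (l2_inner f (inv_L2_fourier (E i))))\<^sup>2) has_sum a * (l2_norm f)\<^sup>2) I"
    unfolding has_L2_fourier_norm[OF F]
    by (rule has_sum_cong[THEN iffD1, rotated]) (simp add: has_L2_fourier_inner[OF F E])
qed

lemma tight_frame_affine_dilation:
  assumes e: "tight_frame a I e" and c: "0 < c"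
  shows "tight_frame a I (\<lambda>i. affine_dilation c 0 (e i))"
  unfolding tight_frame_def
proof (intro conjI ballI)
  have eL: "e i \<in> L2" if "i \<in> I" for i using e that by (simp add: tight_frame_def)
  show "affine_dilation c 0 (e i) \<in> L2" if "i \<in> I" for i by (rule affine_dilation_L2[OF c eL[OF that]])
  fix f :: "real \<Rightarrow> complex" assume f: "f \<in> L2"
  define g where "g = affine_dilation (1 / c) 0 f"
  have gL: "g \<in> L2" unfolding g_def using c f by (intro affine_dilation_L2) auto
  have fg: "f = affine_dilation c 0 g" unfolding g_def by (rule affine_dilation_inverse[OF c, symmetric])
  have "((\<lambda>i. (cmod (l2_inner g (e i)))\<^sup>2) has_sum a * (l2_norm g)\<^sup>2) I"
    using e gL by (simp add: tight_frame_def)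
  then show "((\<lambda>i. (cmod (l2_inner f (affine_dilation c 0 (e i))))\<^sup>2) has_sum a * (l2_norm f)\<^sup>2) I"
    unfolding fg affine_dilation_norm[OF c L2_measurable[OF gL]]
    by (rule has_sum_cong[THEN iffD1, rotated])
       (simp add: affine_dilation_inner[OF c L2_measurable[OF gL] L2_measurable[OF eL]])
qed

lemma tight_frame_reindex:
  fixes e :: "'j \<Rightarrow> 'a::euclidean_space \<Rightarrow> complex"
  assumes "tight_frame a J e" and "bij_betw h I J"
  shows "tight_frame a I (\<lambda>i. e (h i))"
  unfolding tight_frame_def
proof (intro conjI ballI)
  show "e (h i) \<in> L2" if "i \<in> I" for i
    using assms that bij_betwE by (fastforce simp: tight_frame_def)
  fix f :: "'a \<Rightarrow> complex" assume "f \<in> L2"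
  then have "((\<lambda>i. (cmod (l2_inner f (e i)))\<^sup>2) has_sum a * (l2_norm f)\<^sup>2) J"
    using assms(1) by (simp add: tight_frame_def)
  then show "((\<lambda>i. (cmod (l2_inner f (e (h i))))\<^sup>2) has_sum a * (l2_norm f)\<^sup>2) I"
    using has_sum_reindex_bij_betw[OF assms(2), of "\<lambda>i. (cmod (l2_inner f (e i)))\<^sup>2"] by simp
qed

lemma tight_frame_cong:
  assumes "tight_frame a I e" and "\<And>i. i \<in> I \<Longrightarrow> e i = e' i"
  shows "tight_frame a I e'"
proof -
  have "((\<lambda>i. (cmod (l2_inner f (e' i)))\<^sup>2) has_sum s) I \<longleftrightarrow> ((\<lambda>i. (cmod (l2_inner f (e i)))\<^sup>2) has_sum s) I" for f s
    by (rule has_sum_cong) (simp add: assms(2))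
  then show ?thesis using assms by (simp add: tight_frame_def)
qed

text \<open>Unit norms turn the weights into 1, so the redundancy function is the frame sum and
  hence constant on the sphere.\<close>

lemma tight_frame_redundancy:
  fixes e :: "'i \<Rightarrow> 'a::euclidean_space \<Rightarrow> complex"
  assumes e: "tight_frame a I e" and unit: "unit_norm_family I e" and I: "I \<noteq> {}"
  shows "upper_redundancy I e = ennreal a" and "uniform_redundancy I e"
proof -
  have red: "redundancy I e x = ennreal a" if x: "x \<in> L2" "l2_norm x = 1" for x
  proof -
    let ?f = "\<lambda>i. (cmod (l2_inner x (e i)))\<^sup>2"
    have "(?f has_sum a) I" using e x by (auto simp: tight_frame_def dest!: bspec[of _ _ x])
    then have "((\<lambda>F. ennreal (sum ?f F)) \<longlongrightarrow> ennreal a) (finite_subsets_at_top I)"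
      unfolding has_sum_def by (rule tendsto_ennrealI)
    moreover have "sum (\<lambda>i. ennreal (?f i)) = (\<lambda>F. ennreal (sum ?f F))"
      by (rule ext) (simp add: sum_ennreal)
    ultimately have "((\<lambda>i. ennreal (?f i)) has_sum ennreal a) I"
      unfolding has_sum_def by simp
    then have "(\<Sum>\<^sub>\<infinity>i\<in>I. ennreal (?f i)) = ennreal a" by (rule infsumI)
    moreover have "redundancy I e x = (\<Sum>\<^sub>\<infinity>i\<in>I. ennreal (?f i))"
      unfolding redundancy_def using unit by (intro infsum_cong) (simp add: unit_norm_family_def)
    ultimately show ?thesis by simp
  qed
  \<comment> \<open>A frame element witnesses that the unit sphere is nonempty; over an empty sphere
    the supremum would be 0 and the infimum infinite.\<close>
  obtain i where "i \<in> I" using I by blast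
  then have "{x :: 'a \<Rightarrow> complex. x \<in> L2 \<and> l2_norm x = 1} \<noteq> {}"
    using e unit by (auto simp: tight_frame_def unit_norm_family_def)
  moreover have "redundancy I e ` {x \<in> L2. l2_norm x = 1} \<subseteq> {ennreal a}" using red by auto
  ultimately have im: "redundancy I e ` {x \<in> L2. l2_norm x = 1} = {ennreal a}"
    by (metis (no_types, lifting) image_is_empty subset_singleton_iff)
  show "upper_redundancy I e = ennreal a" and "uniform_redundancy I e"
    unfolding uniform_redundancy_def upper_redundancy_def lower_redundancy_def im by simp_all
qed

section \<open>The shearlet atoms as tensor products in shear coordinates\<close>

definition fourier_atom :: "(real \<Rightarrow> complex) \<Rightarrow> int \<Rightarrow> int \<Rightarrow> real \<Rightarrow> complex" where
  "fourier_atom g j m \<eta> = cis (2 * pi * of_int m / 16 powi j * \<eta>) * affine_dilation (1 / 16 powi j) 0 (L2_fourier g) \<eta>"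

definition dilated_gabor :: "real \<Rightarrow> (real \<Rightarrow> complex) \<Rightarrow> int \<Rightarrow> int \<times> int \<Rightarrow> real \<Rightarrow> complex" where
  "dilated_gabor b w j i = affine_dilation (2 powi j) 0 (gabor_atom b w i)"

text \<open>The origin of the formula for \<open>fourier_atom\<close>: the dilation rule with scale
  16^j and shift \<open>m\<close>.\<close>

lemma has_L2_fourier_fourier_atom:
  "g \<in> L2 \<Longrightarrow> has_L2_fourier (affine_dilation (16 powi j) (of_int m) g) (fourier_atom g j m)"
  unfolding fourier_atom_def[abs_def]
  by (intro has_L2_fourier_affine_dilation has_L2_fourier_L2_fourier) simp_all

text \<open>The factor 2^(-3j/2) splits as sqrt(16^(-j)) sqrt(2^j), one root for each dilation. The
  two functions under the inverse transform agree at every point, so the same choice is made on both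
  sides.\<close>

lemma shearlet_atom_eq:
  "shearlet_atom g w b j k m =
     inv_L2_fourier (\<lambda>\<xi>. tensor (fourier_atom g j (fst m)) (dilated_gabor b w j (snd m, k)) (shear_coords \<xi>))"
proof -
  have p: "(2::real) powi (- 4 * j) = 1 / 16 powi j"
  proof -
    have "(2::real) powi (4 * j) = 16 powi j"
      by (simp add: power_int_mult)
    then show ?thesis by (simp add: power_int_minus field_simps)
  qed
  have c: "2 powr (- 3 * of_int j / 2) = sqrt (1 / 16 powi j) * sqrt (2 powi j :: real)"
  proof -
    have "sqrt (1 / 16 powi j) * sqrt (2 powi j :: real) = sqrt (2 powi (- 4 * j) * 2 powi j)"
      by (simp only: p real_sqrt_mult)
    also have "(2::real) powi (- 4 * j) * 2 powi j = 2 powi (- 3 * j)"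
      by (simp add: power_int_add[symmetric])
    also have "\<dots> = 2 powr (- 3 * of_int j)"
      by (simp add: powr_real_of_int'[symmetric])
    also have "sqrt (2 powr (- 3 * of_int j)) = 2 powr (- 3 * of_int j / 2)"
      by (simp add: powr_half_sqrt[symmetric] powr_powr)
    finally show ?thesis by simp
  qed
  show ?thesis
    unfolding shearlet_atom_def p c
    by (intro arg_cong[where f=inv_L2_fourier] ext)
       (simp add: tensor_def fourier_atom_def dilated_gabor_def affine_dilation_def gabor_atom_def shear_coords_def mult_ac)
qed

lemma gabor_atom_L2_norm:
  assumes w: "w \<in> L2"
  shows "gabor_atom b w i \<in> L2" "l2_norm (gabor_atom b w i) = l2_norm w"
proof -
  obtain m k where i: "i = (m, k)" by (cases i)
  have eq: "gabor_atom b w i = (\<lambda>x. cis (2 * pi * of_int m * b * x) * affine_dilation 1 (- of_int k) w x)"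
    by (simp add: gabor_atom_def i affine_dilation_def fun_eq_iff)
  show "gabor_atom b w i \<in> L2"
    unfolding eq by (intro L2_modulation affine_dilation_L2 w) simp
  have "l2_norm (gabor_atom b w i) = l2_norm (affine_dilation 1 (- of_int k) w)"
    unfolding eq by (simp add: l2_norm_def norm_mult)
  also have "\<dots> = l2_norm w"
    by (rule affine_dilation_norm[OF _ L2_measurable[OF w]]) simp
  finally show "l2_norm (gabor_atom b w i) = l2_norm w" .
qed

lemma shearlet_atom_norm:
  assumes g: "g \<in> L2" "l2_norm g = 1" and w: "w \<in> L2" "l2_norm w = 1"
  shows "l2_norm (shearlet_atom g w b j k m) = 1"
proof -
  let ?u = "fourier_atom g j (fst m)" and ?v = "dilated_gabor b w j (snd m, k)"
  note u = has_L2_fourier_fourier_atom[OF g(1), of j "fst m"]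
  have uL: "?u \<in> L2" by (rule has_L2_fourier_L2(2)[OF u])
  have "l2_norm ?u = 1"
    using has_L2_fourier_norm[OF u] g by (simp add: affine_dilation_norm L2_measurable)
  moreover have vL: "?v \<in> L2"
    unfolding dilated_gabor_def by (intro affine_dilation_L2 gabor_atom_L2_norm w) simp
  moreover have "l2_norm ?v = 1"
    unfolding dilated_gabor_def using w
    by (simp add: affine_dilation_norm L2_measurable gabor_atom_L2_norm)
  ultimately have "l2_norm (\<lambda>\<xi>. tensor ?u ?v (shear_coords \<xi>)) = 1"
    by (simp add: l2_norm_shear_coords L2_measurable tensor_L2_norm uL)
  moreover have "(\<lambda>\<xi>. tensor ?u ?v (shear_coords \<xi>)) \<in> L2"
    using tensor_L2_norm(1)[OF uL vL] by (simp add: L2_shear_coords L2_measurable)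
  ultimately show ?thesis
    unfolding shearlet_atom_eq using has_L2_fourier_norm[OF has_L2_fourier_inv_L2_fourier] by metis
qed

text \<open>Serves both systems. An index \<open>i\<close> of the wavelet frame carries its
  generator, scale and translation; \<open>h\<close> regroups the shearlet index into
  \<open>i\<close> and the Gabor index \<open>(n, k)\<close>.\<close>

lemma shearlet_tight_frame:
  assumes I: "countable I" and gL: "\<And>i. i \<in> I \<Longrightarrow> g i \<in> L2"
    and frame: "tight_frame 1 I (\<lambda>i. affine_dilation (16 powi s i) (of_int (t i)) (g i))"
    and gabor: "tight_frame a UNIV (gabor_atom b w)"
    and h: "bij_betw h J (I \<times> UNIV)"
    and e: "\<And>x i n k. x \<in> J \<Longrightarrow> h x = (i, n, k) \<Longrightarrow> e x = shearlet_atom (g i) w b (s i) k (t i, n)"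
  shows "tight_frame a J e"
proof -
  have "tight_frame 1 I (\<lambda>i. fourier_atom (g i) (s i) (t i))"
    by (rule tight_frame_fourier[OF frame has_L2_fourier_fourier_atom[OF gL]])
  moreover have "tight_frame a UNIV (dilated_gabor b w j)" for j
    unfolding dilated_gabor_def[abs_def] by (rule tight_frame_affine_dilation[OF gabor]) simp
  ultimately have "tight_frame a (I \<times> UNIV) (\<lambda>(i, p). tensor (fourier_atom (g i) (s i) (t i)) (dilated_gabor b w (s i) p))"
    by (rule tight_frame_tensor[OF I])
  from tight_frame_inv_L2_fourier[OF tight_frame_shear_coords[OF tight_frame_reindex[OF this h]]]
  show ?thesis
  proof (rule tight_frame_cong)
    fix x assume x: "x \<in> J"
    obtain i n k where hx: "h x = (i, n, k)" by (metis prod.exhaust)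
    show "inv_L2_fourier (\<lambda>\<xi>. (case h x of (i, p) \<Rightarrow> tensor (fourier_atom (g i) (s i) (t i)) (dilated_gabor b w (s i) p)) (shear_coords \<xi>)) = e x"
      by (simp add: e[OF x hx] hx shearlet_atom_eq)
  qed
qed

theorem corollary3p1:
  fixes V :: "int \<Rightarrow> (real \<Rightarrow> complex) set"
    and \<phi> w :: "real \<Rightarrow> complex"
    and \<psi> :: "nat \<Rightarrow> real \<Rightarrow> complex"
    and b :: real and j\<^sub>0 :: int
  assumes "orthogonal_mra 16 V \<phi>"
    and "mra_wavelets 16 V \<psi>"
    and "b > 0"
    and "w \<in> L2" and "l2_norm w = 1"
    and "tight_frame (inverse b) UNIV (gabor_atom b w)"
  shows "unit_norm_family (inhomogeneous_indices j\<^sub>0) (inhomogeneous_atom \<phi> \<psi> w b j\<^sub>0) \<and>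
         tight_frame (inverse b) (inhomogeneous_indices j\<^sub>0) (inhomogeneous_atom \<phi> \<psi> w b j\<^sub>0) \<and>
         unit_norm_family homogeneous_indices (fine_atom \<psi> w b) \<and>
         tight_frame (inverse b) homogeneous_indices (fine_atom \<psi> w b) \<and>
         uniform_redundancy (inhomogeneous_indices j\<^sub>0) (inhomogeneous_atom \<phi> \<psi> w b j\<^sub>0) \<and>
         upper_redundancy (inhomogeneous_indices j\<^sub>0) (inhomogeneous_atom \<phi> \<psi> w b j\<^sub>0) = ennreal (inverse b) \<and>
         uniform_redundancy homogeneous_indices (fine_atom \<psi> w b) \<and>
         upper_redundancy homogeneous_indices (fine_atom \<psi> w b) = ennreal (inverse b)"
proof -
  interpret mra_system 16 V \<phi> \<psi>
    by unfold_locales (use assms(1,2) in auto)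
  have \<psi>L: "\<psi> l \<in> L2" and \<psi>1: "l2_norm (\<psi> l) = 1" if "l \<in> {1..15}" for l
    using wavelet_L2[of l] wavelet_norm[of l] that by auto
  \<comment> \<open>The first component of \<open>m\<close> is the wavelet translation; the second
    one and \<open>k\<close> are the modulation and translation of the Gabor atom.\<close>
  let ?fine = "(\<lambda>(j, k, m, l). ((j, l, fst m), (snd m, k))) :: fine_index \<Rightarrow> _"
  let ?coarse = "(\<lambda>(k, m). (fst m, (snd m, k))) :: coarse_index \<Rightarrow> _"
  \<comment> \<open>\<open>map_prod\<close> moves the tags \<open>Inl\<close> and \<open>Inr\<close>
    onto the wavelet index, since a disjoint sum of products has to become a product whose first
    factor is a disjoint sum.\<close>
  let ?inhom = "case_sum (\<lambda>x. map_prod Inl id (?coarse x)) (\<lambda>x. map_prod Inr id (?fine x))"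

  have unit_fine: "unit_norm_family homogeneous_indices (fine_atom \<psi> w b)"
    using assms(4,5) by (auto simp: unit_norm_family_def homogeneous_indices_def fine_atom_def intro!: shearlet_atom_norm \<psi>L \<psi>1)
  have unit_inhom: "unit_norm_family (inhomogeneous_indices j\<^sub>0) (inhomogeneous_atom \<phi> \<psi> w b j\<^sub>0)"
    using assms(4,5)
    by (auto simp: unit_norm_family_def inhomogeneous_indices_def inhomogeneous_atom_def fine_atom_def
        intro!: shearlet_atom_norm \<psi>L \<psi>1 scaling_L2 scaling_norm)

  have frame_fine: "tight_frame (inverse b) homogeneous_indices (fine_atom \<psi> w b)"
  proof (rule shearlet_tight_frame[where I="UNIV \<times> {1..15} \<times> UNIV" and g="\<lambda>(j, l, m). \<psi> l"
        and s="\<lambda>(j, l, m). j" and t="\<lambda>(j, l, m). m", OF _ _ _ assms(6)])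
    show "tight_frame 1 (UNIV \<times> {1..15} \<times> UNIV) (\<lambda>i. affine_dilation (16 powi (case i of (j, l, m) \<Rightarrow> j))
        (of_int (case i of (j, l, m) \<Rightarrow> m)) (case i of (j, l, m) \<Rightarrow> \<psi> l))"
      by (rule tight_frame_cong[where e=wavelet_atom])
         (use wavelet_frame in simp, auto simp: wavelet_atom_def scale_def)
    show "bij_betw ?fine homogeneous_indices ((UNIV \<times> {1..15} \<times> UNIV) \<times> UNIV)"
      by (rule bij_betw_byWitness[where f'="\<lambda>((j, l, m), (n, k)). (j, k, (m, n), l)"])
         (auto simp: homogeneous_indices_def)
  qed (auto simp: \<psi>L fine_atom_def)

  have frame_inhom: "tight_frame (inverse b) (inhomogeneous_indices j\<^sub>0) (inhomogeneous_atom \<phi> \<psi> w b j\<^sub>0)"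
  proof (rule shearlet_tight_frame[where I="UNIV <+> {j\<^sub>0..} \<times> {1..15} \<times> UNIV" and g="case_sum (\<lambda>m. \<phi>) (\<lambda>(j, l, m). \<psi> l)"
        and s="case_sum (\<lambda>m. j\<^sub>0) (\<lambda>(j, l, m). j)" and t="case_sum (\<lambda>m. m) (\<lambda>(j, l, m). m)", OF _ _ _ assms(6)])
    show "tight_frame 1 (UNIV <+> {j\<^sub>0..} \<times> {1..15} \<times> UNIV)
        (\<lambda>i. affine_dilation (16 powi case_sum (\<lambda>m. j\<^sub>0) (\<lambda>(j, l, m). j) i)
          (of_int (case_sum (\<lambda>m. m) (\<lambda>(j, l, m). m) i)) (case_sum (\<lambda>m. \<phi>) (\<lambda>(j, l, m). \<psi> l) i))"
      by (rule tight_frame_cong[where e="case_sum (scaling_atom j\<^sub>0) wavelet_atom"])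
         (use inhomogeneous_wavelet_frame[of j\<^sub>0] in simp, auto simp: scaling_atom_def wavelet_atom_def scale_def)
    show "bij_betw ?inhom (inhomogeneous_indices j\<^sub>0) ((UNIV <+> {j\<^sub>0..} \<times> {1..15} \<times> UNIV) \<times> UNIV)"
      by (rule bij_betw_byWitness[where f'="\<lambda>(i, (n, k)). case i of Inl m \<Rightarrow> Inl (k, (m, n)) | Inr (j, l, m) \<Rightarrow> Inr (j, k, (m, n), l)"])
         (auto simp: inhomogeneous_indices_def)
  qed (auto simp: \<psi>L scaling_L2 fine_atom_def inhomogeneous_atom_def inhomogeneous_indices_def)

  have ne: "homogeneous_indices \<noteq> {}" "inhomogeneous_indices j\<^sub>0 \<noteq> {}"
    by (auto simp: homogeneous_indices_def inhomogeneous_indices_def)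
  show ?thesis
    using unit_fine unit_inhom frame_fine frame_inhom
      tight_frame_redundancy[OF frame_fine unit_fine ne(1)] tight_frame_redundancy[OF frame_inhom unit_inhom ne(2)]
    by blast
qed

end
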